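(* Suppose that $\gamma>1$ and $\ell(N)=o(N)$ as $N\to\infty$. Suppose further that there is a compact set $K\subseteq\mathbb{C}$ such that all the measures $\mu_N$ are supported on $K$, and that there is a probability measure $\mu$ on $\mathbb{C}$ such that $\mu_N$ converges weakly to $\mu$ as $N\to\infty$. Then the empirical spectral measure $L_N$ of $M^N+N^{-\gamma}G^N$ converges to $\mu$ weakly in probability as $N\to\infty$.
   Context: Setting. For each $N$, let $B^1(N),\dots,B^{\ell(N)}(N)$ be Jordan blocks, where $B^i=B^i(N)$ has dimension $a_i\log N$ with $a_i=a_i(N)>0$ (so each $a_i\log N$ is a positive integer) and $\sum_{i=1}^{\ell(N)}a_i\log N=N$. The block $B^i$ has eigenvalue $c_i=c_i(N)\in\mathbb{C}$ on its diagonal, ones on the first superdiagonal, and zeros elsewhere. $M^N$ is the $N\times N$ block-diagonal matrix with diagonal blocks $B^1,\dots,B^{\ell(N)}$. $G^N$ is an $N\times N$ random matrix with i.i.d. (real) standard Gaussian entries. Let $r_i=r_i(N)=\exp\big((-\gamma+\tfrac12)/a_i\big)$, let $m_{c,r}$ be the uniform probability measure on the circle in $\mathbb{C}$ with center $c$ and radius $r$, and set $$\mu_N=\sum_{i=1}^{\ell(N)}\frac{a_i\log N}{N}\,m_{c_i,r_i}.$$ The empirical spectral measure of an $N\times N$ matrix with eigenvalues $\lambda_1,\dots,\lambda_N$ (with algebraic multiplicity) is $\frac1N\sum_{i=1}^N\delta_{\lambda_i}$. Random probability measures $L_N$ on $\mathbb{C}$ converge to $\mu$ weakly in probability if $\int\phi\,dL_N\to\int\phi\,d\mu$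 in probability for every bounded continuous $\phi:\mathbb{C}\to\mathbb{R}$. *)

theory Defs
  imports
    "HOL-Probability.Probability"
    "HOL-Library.Landau_Symbols"
    "Jordan_Normal_Form.Jordan_Normal_Form"
begin

(* The finite mixture of the Borel measures nu i with weights w i, i in I. *)
definition mixture ::
    "'i set \<Rightarrow> ('i \<Rightarrow> real) \<Rightarrow> ('i \<Rightarrow> complex measure) \<Rightarrow> complex measure" where
  "mixture I w \<nu> =
     measure_of UNIV (sets borel) (\<lambda>S. \<Sum>i\<in>I. ennreal (w i) * emeasure (\<nu> i) S)"

lemma sets_mixture [simp]: "sets (mixture I w \<nu>) = sets borel"
  by (simp add: mixture_def sets.sigma_sets_eq[of borel, simplified])

(* mixture is given by measure_of, which is 0 unless the set function is countably additive. *)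
lemma emeasure_mixture:
  assumes "\<And>i. i \<in> I \<Longrightarrow> sets (\<nu> i) = sets borel" and "S \<in> sets borel"
  shows "emeasure (mixture I w \<nu>) S = (\<Sum>i\<in>I. ennreal (w i) * emeasure (\<nu> i) S)"
proof (rule emeasure_measure_of[OF mixture_def])
  show "countably_additive (sets (mixture I w \<nu>))
          (\<lambda>S. \<Sum>i\<in>I. ennreal (w i) * emeasure (\<nu> i) S)"
  proof (rule countably_additiveI)
    fix A :: "nat \<Rightarrow> complex set"
    assume A: "range A \<subseteq> sets (mixture I w \<nu>)" "disjoint_family A"
    have "(\<Sum>n. \<Sum>i\<in>I. ennreal (w i) * emeasure (\<nu> i) (A n)) =
          (\<Sum>i\<in>I. \<Sum>n. ennreal (w i) * emeasure (\<nu> i) (A n))"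
      by (rule suminf_sum) auto
    also have "\<dots> = (\<Sum>i\<in>I. ennreal (w i) * emeasure (\<nu> i) (\<Union>n. A n))"
      using A assms(1) by (intro sum.cong) (auto simp: suminf_emeasure)
    finally show "(\<Sum>n. \<Sum>i\<in>I. ennreal (w i) * emeasure (\<nu> i) (A n)) =
          (\<Sum>i\<in>I. ennreal (w i) * emeasure (\<nu> i) (\<Union>n. A n))" .
  qed
qed (use assms in \<open>auto simp: positive_def\<close>)

definition circle_measure :: "complex \<Rightarrow> real \<Rightarrow> complex measure" where
  "circle_measure c r =
     distr (uniform_measure lborel {0..2 * pi}) borel (\<lambda>t. c + complex_of_real r * cis t)"

definition empirical_spectral_measure :: "complex mat \<Rightarrow> complex measure" where
  "empirical_spectral_measure A =
     mixture {z. eigenvalue A z}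
       (\<lambda>z. real (Polynomial.order z (char_poly A)) / real (dim_row A)) (return borel)"

(* A random n x n real matrix with i.i.d. standard Gaussian entries. *)
definition std_gaussian_matrix :: "'w measure \<Rightarrow> nat \<Rightarrow> ('w \<Rightarrow> real mat) \<Rightarrow> bool" where
  "std_gaussian_matrix P n G \<longleftrightarrow>
     (\<forall>\<omega>\<in>space P. G \<omega> \<in> carrier_mat n n) \<and>
     (\<forall>i<n. \<forall>j<n. distributed P lborel (\<lambda>\<omega>. G \<omega> $$ (i, j)) std_normal_density) \<and>
     prob_space.indep_vars P (\<lambda>_. borel) (\<lambda>p \<omega>. G \<omega> $$ p) ({..<n} \<times> {..<n})"

definition converges_weakly :: "(nat \<Rightarrow> complex measure) \<Rightarrow> complex measure \<Rightarrow> bool" where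
  "converges_weakly \<mu>s \<mu> \<longleftrightarrow>
     (\<forall>\<phi> :: complex \<Rightarrow> real. continuous_on UNIV \<phi> \<longrightarrow> bounded (range \<phi>) \<longrightarrow>
        (\<lambda>n. \<integral>z. \<phi> z \<partial>\<mu>s n) \<longlonglongrightarrow> (\<integral>z. \<phi> z \<partial>\<mu>))"

(* Convergence in probability to a constant; the n-th variable lives on its own space P n.
   Measurability is part of the definition, since measure is 0 on non-measurable sets. *)
definition tendsto_in_probability ::
    "(nat \<Rightarrow> 'w measure) \<Rightarrow> (nat \<Rightarrow> 'w \<Rightarrow> real) \<Rightarrow> real \<Rightarrow> bool" where
  "tendsto_in_probability P X x \<longleftrightarrow>
     (\<forall>\<^sub>F n in sequentially. X n \<in> borel_measurable (P n)) \<and>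
     (\<forall>\<epsilon>>0. (\<lambda>n. measure (P n) {\<omega> \<in> space (P n). \<epsilon> < \<bar>X n \<omega> - x\<bar>}) \<longlonglongrightarrow> 0)"

definition converges_weakly_in_probability ::
    "(nat \<Rightarrow> 'w measure) \<Rightarrow> (nat \<Rightarrow> 'w \<Rightarrow> complex measure) \<Rightarrow> complex measure \<Rightarrow> bool" where
  "converges_weakly_in_probability P L \<mu> \<longleftrightarrow>
     (\<forall>\<phi> :: complex \<Rightarrow> real. continuous_on UNIV \<phi> \<longrightarrow> bounded (range \<phi>) \<longrightarrow>
        tendsto_in_probability P (\<lambda>n \<omega>. \<integral>z. \<phi> z \<partial>L n \<omega>) (\<integral>z. \<phi> z \<partial>\<mu>))"

(* Block-diagonal matrix with l Jordan blocks, the i-th of dimension d i and eigenvalue c i. *)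
definition block_matrix :: "nat \<Rightarrow> (nat \<Rightarrow> nat) \<Rightarrow> (nat \<Rightarrow> complex) \<Rightarrow> complex mat" where
  "block_matrix l d c = jordan_matrix (map (\<lambda>i. (d i, c i)) [0..<l])"

definition block_radius :: "real \<Rightarrow> real \<Rightarrow> real" where
  "block_radius \<gamma> a = exp ((- \<gamma> + 1 / 2) / a)"

definition circle_mixture ::
    "real \<Rightarrow> nat \<Rightarrow> nat \<Rightarrow> (nat \<Rightarrow> real) \<Rightarrow> (nat \<Rightarrow> complex) \<Rightarrow> complex measure" where
  "circle_mixture \<gamma> N l a c =
     mixture {..<l} (\<lambda>i. a i * ln (real N) / real N)
       (\<lambda>i. circle_measure (c i) (block_radius \<gamma> (a i)))"

end

theory Submission
  imports Defs "HOL-Complex_Analysis.Complex_Analysis" "HOL-Real_Asymp.Real_Asymp"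
begin

text \<open>The logarithmic potential of \<open>\<mu>\<^sub>N\<close> is \<open>(1/N) \<Sum>i. ln (max (\<bar>z - c i\<bar> ^ d i) (N powr (1/2 - \<gamma>)))\<close>, and it
is compared with \<open>(1/N) ln \<bar>det (z - X)\<bar>\<close> for the perturbed matrix \<open>X\<close>. Averaging a test function over circles
turns it, up to a small uniform error, into \<open>\<lambda>w. \<integral>z. ln \<bar>z - w\<bar> * g z\<close> with bounded compactly supported \<open>g\<close>, so
it suffices that the two potentials are close in \<open>L\<^sup>1\<close> on bounded sets, in probability.

A Jordan block shifted by \<open>z\<close> has small determinant \<open>(z - c i) ^ d i\<close> but becomes well conditioned once its
bottom row is modified; blocks with \<open>\<bar>z - c i\<bar>\<close> close to 1 are replaced altogether. Both changes concern few
rows: at most one per block, and the exceptional blocks are rare on average over \<open>z\<close>. Expanding the determinant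
in these rows, on the event that the noise has norm at most about \<open>\<surd>N\<close>, gives the upper bound. For the lower
bound one integrates \<open>\<bar>det\<bar> powr (-1/2)\<close> over these rows only: integrating out \<open>k\<close> Gaussian rows one by one
gains the factor \<open>\<surd>(k!)\<close> of a Gaussian determinant, which is the source of the \<open>1/2\<close> in the radii.\<close>

section \<open>Logarithmic averages over circles\<close>

text \<open>From \<open>l N = o(N)\<close> it does not follow that \<open>l N * ln N = o(N)\<close>,
  yet each block closed up to a cycle costs \<open>3 * \<eta> * ln N\<close> in the logarithm of the
  determinant. Uniformly in \<open>z\<close> this loss can be too large. It is absorbed on average:
  a block with parameter \<open>a\<close> has small determinant only on a disc of radius
  \<open>exp (- c0 / a)\<close>, and \<open>ln N * exp (- 2 * c0 / a)\<close> is at most a constant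
  times the block size \<open>a * ln N\<close>, so the mean loss is of order
  \<open>\<eta> * N\<close>. Hence \<open>\<eta>\<close> is fixed by the accuracy before
  \<open>N\<close> grows. Of the exponent \<open>3 * \<eta>\<close>, a share
  \<open>2 * \<eta>\<close> pays for the factor \<open>\<theta>\<^sup>2\<close> in the conditioning
  of a cycle, \<open>\<eta> / 2\<close> for the norm bound \<open>N powr (1/2 + \<eta>/2)\<close>,
  and the rest makes the relative perturbation vanish. A single real Gaussian already makes the
  power -1/2 of a modulus integrable, and this moment controls the lower tail of the
  log-determinant, so no bound on the smallest singular value enters. The factor
  \<open>sqrt (k!)\<close> of \<open>k\<close> rows falls short of the desired
  \<open>N powr (k / 2)\<close>; for the \<open>k \<le> l N\<close> small blocks the gap, about
  \<open>k * ln (N / k) / 2\<close>, is \<open>o(N)\<close>.\<close>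

lemma mean_ln_one_minus_cis:
  fixes q :: complex
  assumes q: "cmod q < 1"
  shows "((\<lambda>t. ln (cmod (1 - q * cis t))) has_integral 0) {0..2*pi}"
proof -
  define f where "f = (\<lambda>u::complex. Ln (1 - q * u))"
  have re: "0 < Re (1 - q * u)" if "u \<in> cball 0 1" for u
  proof -
    have "Re (q * u) \<le> cmod (q * u)" by (rule complex_Re_le_cmod)
    also have "\<dots> \<le> cmod q * 1"
      unfolding norm_mult using that by (intro mult_left_mono) auto
    finally show ?thesis using q by simp
  qed
  have hol: "f holomorphic_on cball 0 1"
    unfolding f_def
  proof (intro holomorphic_intros)
    fix u :: complex assume "u \<in> cball 0 1"
    then have "0 < Re (1 - q * u)" by (rule re)
    then show "1 - q * u \<notin> \<real>\<^sub>\<le>\<^sub>0"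
      using complex_nonpos_Reals_iff by auto
  qed
  \<comment> \<open>Cauchy's formula at the centre computes the mean of \<open>f\<close> over the
    unit circle as \<open>f 0 = Ln 1 = 0\<close>; the real part is the claim.\<close>
  have "((\<lambda>u. f u / (u - 0)) has_contour_integral 2 * complex_of_real pi * \<i> * f 0) (circlepath 0 1)"
    by (rule Cauchy_integral_circlepath_simple[OF hol]) auto
  then have "((\<lambda>u. f u / u) has_contour_integral 0) (part_circlepath 0 1 0 (2*pi))"
    by (simp add: f_def circlepath_def)
  then have "((\<lambda>t. f (cis t)) has_integral 0) {0..2*pi}"
    by (subst (asm) has_contour_integral_part_circlepath_iff) (auto simp: has_integral_mult_left
        has_integral_iff field_simps)
  then have "((\<lambda>t. Re (f (cis t))) has_integral Re 0) {0..2*pi}"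
    by (rule has_integral_Re)
  moreover have "Re (f (cis t)) = ln (cmod (1 - q * cis t))" for t
  proof -
    have "0 < Re (1 - q * cis t)" by (rule re) simp
    then have "1 - q * cis t \<noteq> 0" by (metis less_irrefl zero_complex.simps(1))
    then show ?thesis by (simp add: f_def)
  qed
  ultimately show ?thesis by simp
qed

abbreviation unif_angle :: "real measure" where
  "unif_angle \<equiv> uniform_measure lborel {0..2*pi}"

lemma prob_space_unif_angle: "prob_space unif_angle"
  by (rule prob_space_uniform_measure) auto

lemma integral_unif_angle:
  fixes f :: "real \<Rightarrow> real"
  assumes f: "continuous_on {0..2*pi} f" and I: "(f has_integral I) {0..2*pi}"
    and m: "f \<in> borel_measurable borel"
  shows "(\<integral>t. f t \<partial>unif_angle) = I / (2*pi)"
proof -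
  have e: "emeasure lborel {0..2*pi} = ennreal (2*pi)" by simp
  have "unif_angle = density lborel (\<lambda>t. ennreal (indicator {0..2*pi} t / (2*pi)))"
    unfolding uniform_measure_def e
    by (intro density_cong AE_I2) (auto simp: divide_ennreal ennreal_indicator[symmetric])
  then have "(\<integral>t. f t \<partial>unif_angle) = (\<integral>t. (indicator {0..2*pi} t / (2*pi)) *\<^sub>R f t \<partial>lborel)"
    using m by (simp add: integral_density)
  also have "\<dots> = (\<integral>t. (indicator {0..2*pi} t *\<^sub>R f t) / (2*pi) \<partial>lborel)"
    by (intro Bochner_Integration.integral_cong) auto
  also have "\<dots> = (\<integral>t. indicator {0..2*pi} t *\<^sub>R f t \<partial>lborel) / (2*pi)"
    by simp
  also have "(\<integral>t. indicator {0..2*pi} t *\<^sub>R f t \<partial>lborel) = integral {0..2*pi} f"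
    using set_borel_integral_eq_integral(2)[OF borel_integrable_atLeastAtMost', of 0 "2*pi" f] f
    by (simp add: set_lebesgue_integral_def)
  also have "\<dots> = I" using I by (rule integral_unique)
  finally show ?thesis .
qed

text \<open>The larger of \<open>a\<close> and \<open>r * cis t\<close> is factored out; what
  remains is \<open>1 - q * cis t\<close> with \<open>cmod q < 1\<close>, whose logarithm has mean
  0. When \<open>cmod a = r\<close> the integrand has a pole, but in the application those points
  form a null circle.\<close>

lemma circle_mean_ln:
  fixes a :: complex and r :: real
  assumes r: "r > 0" and ar: "cmod a \<noteq> r"
  shows "(\<integral>t. ln (cmod (a - of_real r * cis t)) \<partial>unif_angle) = ln (max (cmod a) r)"
proof -
  interpret U: prob_space unif_angle by (rule prob_space_unif_angle)
  have m: "(\<lambda>t. ln (cmod (c - q * cis t))) \<in> borel_measurable borel" for c q :: complex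
    by (intro borel_measurable_ln borel_measurable_continuous_onI continuous_intros)
  have noisy_rows: "1 - q * cis t \<noteq> 0" if "cmod q < 1" for q t
  proof
    assume "1 - q * cis t = 0"
    then have "cmod (q * cis t) = 1" by (metis norm_one right_minus_eq)
    then show False using that by (simp add: norm_mult)
  qed
  have one: "(\<integral>t. ln (cmod (1 - q * cis t)) \<partial>unif_angle) = 0" if q: "cmod q < 1" for q
  proof -
    have "continuous_on {0..2*pi} (\<lambda>t. ln (cmod (1 - q * cis t)))"
    proof (intro continuous_on_ln continuous_intros ballI)
      show "cmod (1 - q * cis t) \<noteq> 0" for t using noisy_rows[OF q, of t] by (simp only: norm_eq_zero
          not_False_eq_True)
    qed
    from integral_unif_angle[OF this mean_ln_one_minus_cis[OF q] m] show ?thesis by simp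
  qed
  have int: "integrable unif_angle (\<lambda>t. ln (cmod (1 - q * cis t)))" if q: "cmod q < 1" for q
  proof (rule U.integrable_const_bound[where B="max (ln 2) (- ln (1 - cmod q))"])
    have "\<bar>ln (cmod (1 - q * cis t))\<bar> \<le> max (ln 2) (- ln (1 - cmod q))" for t
    proof -
      have c: "cmod (q * cis t) = cmod q" by (simp add: norm_mult)
      have "cmod (1 - q * cis t) \<le> 1 + cmod q" using norm_triangle_ineq4[of 1 "q * cis t"] c by simp
      then have 1: "ln (cmod (1 - q * cis t)) \<le> ln 2"
        using q noisy_rows[OF q, of t] by (subst ln_le_cancel_iff) auto
      have "1 - cmod q \<le> cmod (1 - q * cis t)" using norm_triangle_ineq2[of 1 "q * cis t"] c by simp
      then have 2: "ln (1 - cmod q) \<le> ln (cmod (1 - q * cis t))"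
        using q noisy_rows[OF q, of t] by (subst ln_le_cancel_iff) auto
      from 1 2 show ?thesis by auto
    qed
    then show "AE t in unif_angle. norm (ln (cmod (1 - q * cis t))) \<le> max (ln 2) (- ln (1 - cmod q))"
      by simp
    show "(\<lambda>t. ln (cmod (1 - q * cis t))) \<in> borel_measurable unif_angle"
      using m[of 1 q] by simp
  qed
  show ?thesis
  proof (cases "cmod a < r")
    case True
    \<comment> \<open>Factoring out \<open>r * cis t\<close> leaves
      \<open>1 - (a / r) * cis (- t)\<close>; conjugating this factor keeps its modulus and turns
      \<open>cis (- t)\<close> into \<open>cis t\<close>.\<close>
    define q where "q = cnj (a / of_real r)"
    have q: "cmod q < 1" using True r by (simp add: q_def norm_divide)
    have "ln (cmod (a - of_real r * cis t)) = ln r + ln (cmod (1 - q * cis t))" for t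
    proof -
      have "a - of_real r * cis t = - (of_real r * cis t * cnj (1 - q * cis t))"
        using r by (simp add: q_def field_simps cis_cnj flip: cis_inverse)
      then have "cmod (a - of_real r * cis t) = r * cmod (1 - q * cis t)"
        using r by (simp add: norm_mult del: complex_cnj_diff complex_cnj_mult)
      then show ?thesis using r noisy_rows[OF q, of t] by (simp add: ln_mult)
    qed
    then have "(\<integral>t. ln (cmod (a - of_real r * cis t)) \<partial>unif_angle) = ln r"
      using int[OF q] one[OF q] by (simp add: U.prob_space)
    then show ?thesis using True by simp
  next
    case False
    then have ra: "r < cmod a" using ar by simp
    then have a0: "a \<noteq> 0" using r by auto
    define q where "q = of_real r / a"
    have q: "cmod q < 1" using ra r by (simp add: q_def norm_divide divide_less_eq)
    have "ln (cmod (a - of_real r * cis t)) = ln (cmod a) + ln (cmod (1 - q * cis t))" for t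
    proof -
      have "a - of_real r * cis t = a * (1 - q * cis t)"
        using a0 by (simp add: q_def field_simps)
      then have "cmod (a - of_real r * cis t) = cmod a * cmod (1 - q * cis t)"
        by (simp add: norm_mult)
      then show ?thesis using a0 noisy_rows[OF q, of t] by (simp add: ln_mult)
    qed
    then have "(\<integral>t. ln (cmod (a - of_real r * cis t)) \<partial>unif_angle) = ln (cmod a)"
      using int[OF q] one[OF q] by (simp add: U.prob_space)
    then show ?thesis using ra by simp
  qed
qed

section \<open>Local integrability of the logarithm in the plane\<close>

lemma cball_sets_borel [measurable]: "cball (c::complex) r \<in> sets borel"
  by (rule borel_closed) simp

lemma emeasure_cball_complex:
  "r \<ge> 0 \<Longrightarrow> emeasure lborel (cball (c::complex) r) = ennreal (pi * r^2)"
  by (simp add: emeasure_cball unit_ball_vol_2)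

text \<open>Inside the unit disc, \<open>- ln (cmod u)\<close> is at most the number of
  \<open>k\<close> with \<open>cmod u \<le> exp (- k)\<close>. The areas of these discs decay
  geometrically, so the pole becomes integrable without polar coordinates. At \<open>u = 0\<close>
  the value \<open>ln 0 = 0\<close> is covered by \<open>R\<close>.\<close>

lemma abs_ln_cmod_le:
  assumes "cmod u \<le> R"
  shows "ennreal \<bar>ln (cmod u)\<bar> \<le> ennreal R + (\<Sum>k. indicator (cball 0 (exp (- real k))) u)"
proof (cases "u = 0 \<or> cmod u \<ge> 1")
  case True
  then have "\<bar>ln (cmod u)\<bar> \<le> R"
  proof
    assume "u = 0" then show ?thesis using assms by simp
  next
    assume u: "cmod u \<ge> 1"
    then have "ln (cmod u) \<le> cmod u - 1" by (intro ln_le_minus_one) auto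
    then show ?thesis using u assms by (simp add: ln_ge_zero)
  qed
  then have "ennreal \<bar>ln (cmod u)\<bar> \<le> ennreal R + 0"
    by (simp add: ennreal_leI)
  also have "\<dots> \<le> ennreal R + (\<Sum>k. indicator (cball 0 (exp (- real k))) u)"
    by (intro add_left_mono) simp
  finally show ?thesis .
next
  case False
  then have u: "u \<noteq> 0" "cmod u < 1" by auto
  define m where "m = nat \<lfloor>- ln (cmod u)\<rfloor> + 1"
  have l: "ln (cmod u) < 0" using u by simp
  then have m: "- ln (cmod u) \<le> real m" unfolding m_def by linarith
  have "ennreal \<bar>ln (cmod u)\<bar> \<le> ennreal (real m)" using l m by (intro ennreal_leI) simp
  also have "ennreal (real m) = (\<Sum>k<m. indicator (cball 0 (exp (- real k))) u)"
  proof -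
    have "u \<in> cball 0 (exp (- real k))" if "k < m" for k
    proof -
      have "real k \<le> - ln (cmod u)" using that l unfolding m_def by linarith
      then have "exp (ln (cmod u)) \<le> exp (- real k)" by simp
      then show ?thesis using u by simp
    qed
    then have "(\<Sum>k<m. indicator (cball 0 (exp (- real k))) u) = (\<Sum>k<m. 1 :: ennreal)"
      by (intro sum.cong) auto
    then show ?thesis by (simp add: ennreal_of_nat_eq_real_of_nat)
  qed
  also have "\<dots> \<le> (\<Sum>k. indicator (cball 0 (exp (- real k))) u)"
    by (rule sum_le_suminf) auto
  also have "\<dots> \<le> ennreal R + (\<Sum>k. indicator (cball 0 (exp (- real k))) u)" by simp
  finally show ?thesis .
qed

lemma ln_cmod_nn_integral_finite:
  "\<exists>C\<ge>0. (\<integral>\<^sup>+u. ennreal \<bar>ln (cmod u)\<bar> * indicator (cball (0::complex) R) u \<partial>lborel) \<le> ennreal C"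
proof -
  have "(\<integral>\<^sup>+u. ennreal \<bar>ln (cmod u)\<bar> * indicator (cball (0::complex) R) u \<partial>lborel)
      \<le> (\<integral>\<^sup>+u. ennreal R * indicator (cball (0::complex) R) u + (\<Sum>k. indicator (cball 0 (exp (- real k))) u)
          \<partial>lborel)"
    by (intro nn_integral_mono) (auto split: split_indicator intro: abs_ln_cmod_le)
  also have "\<dots> = (\<integral>\<^sup>+u. ennreal R * indicator (cball (0::complex) R) u \<partial>lborel)
      + (\<integral>\<^sup>+u. (\<Sum>k. indicator (cball (0::complex) (exp (- real k))) u) \<partial>lborel)"
    by (rule nn_integral_add) measurable
  also have "(\<integral>\<^sup>+u. ennreal R * indicator (cball (0::complex) R) u \<partial>lborel) = ennreal R * emeasure lborel (cball
      (0::complex) R)"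
    by (rule nn_integral_cmult_indicator) simp
  also have "(\<integral>\<^sup>+u. (\<Sum>k. indicator (cball (0::complex) (exp (- real k))) u) \<partial>lborel)
      = (\<Sum>k. \<integral>\<^sup>+u. indicator (cball (0::complex) (exp (- real k))) u \<partial>lborel)"
    by (rule nn_integral_suminf) simp
  also have "\<dots> = (\<Sum>k. emeasure lborel (cball (0::complex) (exp (- real k))))"
    by simp
  also have "(\<Sum>k. emeasure lborel (cball (0::complex) (exp (- real k)))) = (\<Sum>k. ennreal (pi * exp (-2) ^ k))"
    proof -
    have "exp (- real k) ^ 2 = exp (-2) ^ k" for k
    proof -
      have "exp (- real k) ^ 2 = exp (- real k + - real k)" by (simp only: power2_eq_square exp_add)
      also have "\<dots> = exp (real k * (-2))" by (rule arg_cong[where f=exp]) simp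
      also have "\<dots> = exp (-2) ^ k" by (rule exp_of_nat_mult)
      finally show ?thesis .
    qed
    then show ?thesis by (simp only: emeasure_cball_complex[OF exp_ge_zero])
  qed
  also have "\<dots> = ennreal (\<Sum>k. pi * exp (-2) ^ k)"
    by (rule suminf_ennreal2) (simp, intro summable_mult summable_geometric, simp)
  finally have le: "(\<integral>\<^sup>+u. ennreal \<bar>ln (cmod u)\<bar> * indicator (cball (0::complex) R) u \<partial>lborel)
      \<le> ennreal R * emeasure lborel (cball (0::complex) R) + ennreal (\<Sum>k. pi * exp (-2) ^ k)" .
  have "ennreal R * emeasure lborel (cball (0::complex) R) + ennreal (\<Sum>k. pi * exp (-2) ^ k) < \<top>"
    by (simp add: ennreal_mult_less_top emeasure_lborel_cball_finite[unfolded infinity_ennreal_def])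
  with le have "(\<integral>\<^sup>+u. ennreal \<bar>ln (cmod u)\<bar> * indicator (cball (0::complex) R) u \<partial>lborel) < \<top>"
    by (rule le_less_trans)
  then have "(\<integral>\<^sup>+u. ennreal \<bar>ln (cmod u)\<bar> * indicator (cball (0::complex) R) u \<partial>lborel)
     = ennreal (enn2real (\<integral>\<^sup>+u. ennreal \<bar>ln (cmod u)\<bar> * indicator (cball (0::complex) R) u \<partial>lborel))"
    by (simp only: ennreal_enn2real)
  then show ?thesis
    by (intro exI[of _ "enn2real (\<integral>\<^sup>+u. ennreal \<bar>ln (cmod u)\<bar> * indicator (cball (0::complex) R) u \<partial>lborel)"]
        conjI enn2real_nonneg eq_refl)
qed

lemma nn_integral_lborel_shift:
  fixes f :: "'a::euclidean_space \<Rightarrow> ennreal"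
  assumes "f \<in> borel_measurable borel"
  shows "(\<integral>\<^sup>+u. f (c + u) \<partial>lborel) = (\<integral>\<^sup>+u. f u \<partial>lborel)"
proof -
  have "(\<integral>\<^sup>+u. f u \<partial>lborel) = (\<integral>\<^sup>+u. f u \<partial>distr lborel borel ((+) c))"
    by (simp add: lborel_distr_plus)
  also have "\<dots> = (\<integral>\<^sup>+u. f (c + u) \<partial>lborel)"
    using assms by (subst nn_integral_distr) auto
  finally show ?thesis by simp
qed

lemma integral_lborel_shift:
  fixes f :: "'a::euclidean_space \<Rightarrow> real"
  assumes "f \<in> borel_measurable borel"
  shows "(\<integral>u. f (c + u) \<partial>lborel) = (\<integral>u. f u \<partial>lborel)"
proof -
  have "(\<integral>u. f u \<partial>lborel) = (\<integral>u. f u \<partial>distr lborel borel ((+) c))"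
    by (simp add: lborel_distr_plus)
  also have "\<dots> = (\<integral>u. f (c + u) \<partial>lborel)"
    using assms by (subst integral_distr) auto
  finally show ?thesis by simp
qed

section \<open>Circle averages against the logarithmic kernel\<close>

definition bdd_supp :: "real \<Rightarrow> real \<Rightarrow> (complex \<Rightarrow> real) \<Rightarrow> bool" where
  "bdd_supp B R g \<longleftrightarrow> g \<in> borel_measurable borel \<and> (\<forall>z. \<bar>g z\<bar> \<le> B) \<and> (\<forall>z. cmod z > R \<longrightarrow> g z = 0)"

lemma bdd_suppD:
  assumes "bdd_supp B R g"
  shows "g \<in> borel_measurable borel" "\<bar>g z\<bar> \<le> B" "cmod z > R \<Longrightarrow> g z = 0" "B \<ge> 0"
  using assms abs_ge_zero order_trans unfolding bdd_supp_def by blast+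

text \<open>The constant depends on \<open>B\<close>, \<open>R\<close> and \<open>R'\<close> alone.
  This uniformity yields joint integrability in the two Fubini arguments that follow: in one the
  pole \<open>w\<close> runs over a circle, in the other the density \<open>g\<close> is translated
  along one.\<close>

lemma ln_kernel_nn_integral_bound:
  assumes "B \<ge> 0"
  shows "\<exists>C\<ge>0. \<forall>w. cmod w \<le> R' \<longrightarrow> (\<forall>g. bdd_supp B R g \<longrightarrow>
     (\<integral>\<^sup>+z. ennreal \<bar>ln (cmod (z - w)) * g z\<bar> \<partial>lborel) \<le> ennreal C)"
proof -
  obtain C where C: "C \<ge> 0" "(\<integral>\<^sup>+u. ennreal \<bar>ln (cmod u)\<bar> * indicator (cball (0::complex) (R + R')) u \<partial>lborel) \<le>
      ennreal C"
    using ln_cmod_nn_integral_finite by blast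
  have "(\<integral>\<^sup>+z. ennreal \<bar>ln (cmod (z - w)) * g z\<bar> \<partial>lborel) \<le> ennreal (B * C)"
    if w: "cmod w \<le> R'" and g: "bdd_supp B R g" for w g
  proof -
    note g = bdd_suppD[OF g]
    define h where "h = (\<lambda>u. ennreal \<bar>ln (cmod u)\<bar> * indicator (cball (0::complex) (R + R')) u)"
    have hm [measurable]: "h \<in> borel_measurable borel" unfolding h_def by measurable
    have "(\<integral>\<^sup>+z. ennreal \<bar>ln (cmod (z - w)) * g z\<bar> \<partial>lborel) \<le> (\<integral>\<^sup>+z. ennreal B * h (-w + z) \<partial>lborel)"
    proof (rule nn_integral_mono)
      fix z
      show "ennreal \<bar>ln (cmod (z - w)) * g z\<bar> \<le> ennreal B * h (-w + z)"
      proof (cases "cmod z > R")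
        case True then show ?thesis using g(3) by simp
      next
        case False
        then have "cmod (-w + z) \<le> R + R'" using w norm_triangle_ineq[of "-w" z] by simp
        then have "h (-w + z) = ennreal \<bar>ln (cmod (z - w))\<bar>" by (simp add: h_def)
        moreover have "\<bar>ln (cmod (z - w)) * g z\<bar> \<le> B * \<bar>ln (cmod (z - w))\<bar>"
          using g(2)[of z] by (simp add: abs_mult mult.commute[of _ "\<bar>g z\<bar>"] mult_right_mono)
        ultimately show ?thesis using assms by (simp add: ennreal_leI flip: ennreal_mult)
      qed
    qed
    also have "\<dots> = (\<integral>\<^sup>+z. ennreal B * h z \<partial>lborel)"
      by (rule nn_integral_lborel_shift) measurable
    also have "\<dots> = ennreal B * (\<integral>\<^sup>+z. h z \<partial>lborel)"
      by (rule nn_integral_cmult) simp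
    also have "\<dots> \<le> ennreal B * ennreal C"
      using C(2) by (intro mult_left_mono) (simp_all only: h_def zero_le)
    finally show ?thesis using assms C(1) by (simp add: ennreal_mult)
  qed
  then show ?thesis using assms C(1) by (intro exI[of _ "B * C"]) auto
qed

lemma integrable_ln_kernel:
  assumes g: "bdd_supp B R g"
  shows "integrable lborel (\<lambda>z. ln (cmod (z - w)) * g z)"
proof -
  obtain C where "(\<integral>\<^sup>+z. ennreal \<bar>ln (cmod (z - w)) * g z\<bar> \<partial>lborel) \<le> ennreal C"
    using ln_kernel_nn_integral_bound[OF bdd_suppD(4)[OF g], of "cmod w" R] g by blast
  then show ?thesis using bdd_suppD(1)[OF g]
    by (intro integrableI_bounded) (auto simp: ennreal_less_top order_le_less_trans)
qed

text \<open>After exchanging the integrals, the inner one is the potential of a uniform measure on a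
  circle, which \<open>circle_mean_ln\<close> evaluates for every \<open>z\<close> off that circle,
  a null set.\<close>

lemma circle_fubini:
  assumes g: "bdd_supp B R g" and r: "r > 0"
  shows "integrable unif_angle (\<lambda>t. \<integral>z. ln (cmod (z - (c + of_real r * cis t))) * g z \<partial>lborel)" (is ?A)
    and "(\<integral>t. (\<integral>z. ln (cmod (z - (c + of_real r * cis t))) * g z \<partial>lborel) \<partial>unif_angle)
     = (\<integral>z. ln (max (cmod (z - c)) r) * g z \<partial>lborel)" (is ?B)
proof -
  interpret U: prob_space unif_angle by (rule prob_space_unif_angle)
  interpret pair_sigma_finite unif_angle "lborel :: complex measure" ..
  have [measurable]: "g \<in> borel_measurable borel" using g by (rule bdd_suppD)
  have [measurable]: "cis \<in> borel_measurable borel"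
    by (intro borel_measurable_continuous_onI continuous_intros)
  let ?f = "\<lambda>(t, z). ln (cmod (z - (c + of_real r * cis t))) * g z"
  obtain C where C: "\<And>w. cmod w \<le> cmod c + r \<Longrightarrow> (\<integral>\<^sup>+z. ennreal \<bar>ln (cmod (z - w)) * g z\<bar> \<partial>lborel) \<le> ennreal C"
    using ln_kernel_nn_integral_bound[OF bdd_suppD(4)[OF g], of "cmod c + r" R] g by blast
  have m: "?f \<in> borel_measurable (unif_angle \<Otimes>\<^sub>M lborel)" by measurable
  have int: "integrable (unif_angle \<Otimes>\<^sub>M lborel) ?f"
  proof (rule integrableI_bounded[OF m])
    have "(\<integral>\<^sup>+x. ennreal (norm (?f x)) \<partial>(unif_angle \<Otimes>\<^sub>M lborel))
        = (\<integral>\<^sup>+t. \<integral>\<^sup>+z. ennreal (norm (?f (t, z))) \<partial>lborel \<partial>unif_angle)"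
      by (subst lborel.nn_integral_fst[symmetric]) (use m in \<open>auto simp: case_prod_beta\<close>)
    also have "\<dots> \<le> (\<integral>\<^sup>+t. ennreal C \<partial>unif_angle)"
    proof (intro nn_integral_mono)
      fix t
      have "cmod (c + of_real r * cis t) \<le> cmod c + r"
        using r norm_triangle_ineq[of c "of_real r * cis t"] by (simp add: norm_mult)
      from C[OF this] show "(\<integral>\<^sup>+z. ennreal (norm (?f (t, z))) \<partial>lborel) \<le> ennreal C" by simp
    qed
    also have "\<dots> < \<infinity>" by (simp add: U.emeasure_space_1 del: space_uniform_measure)
    finally show "(\<integral>\<^sup>+x. ennreal (norm (?f x)) \<partial>(unif_angle \<Otimes>\<^sub>M lborel)) < \<infinity>" .
  qed
  from integrable_fst[OF int] show ?A by simp
  have "(\<integral>t. (\<integral>z. ?f (t, z) \<partial>lborel) \<partial>unif_angle) = (\<integral>z. (\<integral>t. ?f (t, z) \<partial>unif_angle) \<partial>lborel)"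
    using Fubini_integral[of "\<lambda>t z. ?f (t, z)"] int by (simp add: case_prod_beta')
  also have "\<dots> = (\<integral>z. ln (max (cmod (z - c)) r) * g z \<partial>lborel)"
  proof (rule integral_cong_AE)
    show "(\<lambda>z. \<integral>t. ?f (t, z) \<partial>unif_angle) \<in> borel_measurable lborel"
      using m by measurable
    show "(\<lambda>z. ln (max (cmod (z - c)) r) * g z) \<in> borel_measurable lborel" by measurable
    have "negligible (sphere c r)" by (rule negligible_sphere)
    then have "AE z in lborel. z \<notin> sphere c r"
      using AE_not_in[of "sphere c r" lborel] by (simp add: negligible_iff_null_sets null_sets_completion_iff)
    then show "AE z in lborel. (\<integral>t. ?f (t, z) \<partial>unif_angle) = ln (max (cmod (z - c)) r) * g z"
    proof eventually_elim
      case (elim z)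
      then have "cmod (z - c) \<noteq> r" by (simp add: dist_norm norm_minus_commute)
      from circle_mean_ln[OF r this] show ?case by (simp add: diff_diff_eq)
    qed
  qed
  finally show ?B by simp
qed

definition circ_avg :: "real \<Rightarrow> (complex \<Rightarrow> real) \<Rightarrow> complex \<Rightarrow> real" where
  "circ_avg r g z = (\<integral>t. g (z + of_real r * cis t) \<partial>unif_angle)"

lemma bdd_supp_circ_avg:
  assumes g: "bdd_supp B R g" and r: "r > 0"
  shows "bdd_supp B (R + r) (circ_avg r g)"
proof -
  interpret U: prob_space unif_angle by (rule prob_space_unif_angle)
  have [measurable]: "g \<in> borel_measurable borel" using g by (rule bdd_suppD)
  have [measurable]: "cis \<in> borel_measurable borel"
    by (intro borel_measurable_continuous_onI continuous_intros)
  have "circ_avg r g \<in> borel_measurable borel"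
    unfolding circ_avg_def[abs_def] by measurable
  moreover have "\<bar>circ_avg r g z\<bar> \<le> B" for z
  proof -
    have int: "integrable unif_angle (\<lambda>t. g (z + of_real r * cis t))"
      using bdd_suppD(2)[OF g] by (intro U.integrable_const_bound[where B=B]) auto
    have "\<bar>circ_avg r g z\<bar> \<le> (\<integral>t. \<bar>g (z + of_real r * cis t)\<bar> \<partial>unif_angle)"
      unfolding circ_avg_def by (rule integral_abs_bound)
    also have "\<dots> \<le> B" using bdd_suppD(2)[OF g] int by (intro U.integral_le_const) auto
    finally show ?thesis .
  qed
  moreover have "circ_avg r g z = 0" if "cmod z > R + r" for z
  proof -
    have "g (z + of_real r * cis t) = 0" for t
    proof (rule bdd_suppD(3)[OF g])
      have "cmod z - cmod (of_real r * cis t) \<le> cmod (z + of_real r * cis t)"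
        using norm_triangle_ineq4[of "z + of_real r * cis t" "of_real r * cis t"] by simp
      then show "R < cmod (z + of_real r * cis t)" using that r by (simp add: norm_mult)
    qed
    then show ?thesis by (simp add: circ_avg_def)
  qed
  ultimately show ?thesis by (simp add: bdd_supp_def)
qed

text \<open>The substitution \<open>p = z + r * cis t\<close> moves the circle from the density to
  the pole: \<open>z - w\<close> becomes \<open>p - (w + r * cis t)\<close>, and
  \<open>circle_fubini\<close> with centre \<open>w\<close> applies.\<close>

lemma ln_kernel_circ_avg:
  assumes g: "bdd_supp B R g" and r: "r > 0"
  shows "(\<integral>z. ln (cmod (z - w)) * circ_avg r g z \<partial>lborel) = (\<integral>p. ln (max (cmod (p - w)) r) * g p \<partial>lborel)"
proof -
  interpret U: prob_space unif_angle by (rule prob_space_unif_angle)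
  interpret pair_sigma_finite unif_angle "lborel :: complex measure" ..
  have [measurable]: "g \<in> borel_measurable borel" using g by (rule bdd_suppD)
  have [measurable]: "cis \<in> borel_measurable borel"
    by (intro borel_measurable_continuous_onI continuous_intros)
  let ?f = "\<lambda>(t, z). ln (cmod (z - w)) * g (z + of_real r * cis t)"
  obtain C where C: "\<And>g. bdd_supp B (R + r) g \<Longrightarrow> (\<integral>\<^sup>+z. ennreal \<bar>ln (cmod (z - w)) * g z\<bar> \<partial>lborel) \<le> ennreal C"
    using ln_kernel_nn_integral_bound[OF bdd_suppD(4)[OF g], of "cmod w" "R + r"] by blast
  have m: "?f \<in> borel_measurable (unif_angle \<Otimes>\<^sub>M lborel)" by measurable
  have int: "integrable (unif_angle \<Otimes>\<^sub>M lborel) ?f"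
  proof (rule integrableI_bounded[OF m])
    have "(\<integral>\<^sup>+x. ennreal (norm (?f x)) \<partial>(unif_angle \<Otimes>\<^sub>M lborel))
        = (\<integral>\<^sup>+t. \<integral>\<^sup>+z. ennreal (norm (?f (t, z))) \<partial>lborel \<partial>unif_angle)"
      by (subst lborel.nn_integral_fst[symmetric]) (use m in \<open>auto simp: case_prod_beta\<close>)
    also have "\<dots> \<le> (\<integral>\<^sup>+t. ennreal C \<partial>unif_angle)"
    proof (intro nn_integral_mono)
      fix t
      have "(\<lambda>z. g (z + of_real r * cis t)) \<in> borel_measurable borel" by measurable
      moreover have "\<bar>g (z + of_real r * cis t)\<bar> \<le> B" for z using g by (rule bdd_suppD)
      moreover have "g (z + of_real r * cis t) = 0" if z: "R + r < cmod z" for z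
      proof (rule bdd_suppD(3)[OF g])
        have "cmod z - cmod (of_real r * cis t) \<le> cmod (z + of_real r * cis t)"
          using norm_triangle_ineq4[of "z + of_real r * cis t" "of_real r * cis t"] by simp
        then show "R < cmod (z + of_real r * cis t)" using z r by (simp add: norm_mult)
      qed
      ultimately have "bdd_supp B (R + r) (\<lambda>z. g (z + of_real r * cis t))"
        by (simp add: bdd_supp_def)
      from C[OF this] show "(\<integral>\<^sup>+z. ennreal (norm (?f (t, z))) \<partial>lborel) \<le> ennreal C" by simp
    qed
    also have "\<dots> < \<infinity>" by (simp add: U.emeasure_space_1 del: space_uniform_measure)
    finally show "(\<integral>\<^sup>+x. ennreal (norm (?f x)) \<partial>(unif_angle \<Otimes>\<^sub>M lborel)) < \<infinity>" .
  qed
  have "(\<integral>z. ln (cmod (z - w)) * circ_avg r g z \<partial>lborel) = (\<integral>z. (\<integral>t. ?f (t, z) \<partial>unif_angle) \<partial>lborel)"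
    by (simp add: circ_avg_def)
  also have "\<dots> = (\<integral>t. (\<integral>z. ?f (t, z) \<partial>lborel) \<partial>unif_angle)"
    using Fubini_integral[of "\<lambda>t z. ?f (t, z)"] int by (simp add: case_prod_beta')
  also have "\<dots> = (\<integral>t. (\<integral>p. ln (cmod (p - (w + of_real r * cis t))) * g p \<partial>lborel) \<partial>unif_angle)"
  proof (rule Bochner_Integration.integral_cong[OF refl])
    fix t
    show "(\<integral>z. ?f (t, z) \<partial>lborel) = (\<integral>p. ln (cmod (p - (w + of_real r * cis t))) * g p \<partial>lborel)"
      using integral_lborel_shift[of "\<lambda>p. ln (cmod (p - (w + of_real r * cis t))) * g p" "of_real r * cis t"]
      by (simp add: algebra_simps)
  qed
  also have "\<dots> = (\<integral>p. ln (max (cmod (p - w)) r) * g p \<partial>lborel)"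
    by (rule circle_fubini[OF g r])
  finally show ?thesis .
qed

text \<open>A second difference of the potentials of circles with radii \<open>e\<close>, \<open>2e\<close>, \<open>4e\<close>: the smooth logarithmic
  parts cancel outside radius \<open>4e\<close>.\<close>

definition bump :: "real \<Rightarrow> complex \<Rightarrow> real" where
  "bump e u = ln (max (cmod u) e) - 2 * ln (max (cmod u) (2*e)) + ln (max (cmod u) (4*e))"

text \<open>As a function of \<open>ln (cmod u)\<close> the bump is a tent, rising with slope 1 from
  \<open>ln e\<close> to \<open>ln (2*e)\<close> and falling with slope -1 to
  \<open>ln (4*e)\<close>. The disc in the third claim lies in the annulus between
  \<open>3/2*e\<close> and \<open>5/2*e\<close>, where the tent is at least \<open>ln (3/2)\<close>;
  this makes its total mass positive.\<close>

lemma bump_props: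
  assumes e: "e > 0"
  shows "bump e u \<ge> 0" "cmod u \<ge> 4*e \<Longrightarrow> bump e u = 0"
    "u \<in> cball (of_real (2*e)) (e/2) \<Longrightarrow> bump e u \<ge> ln (3/2)"
    "bump e u \<le> 2 * ln 2"
proof -
  have l2: "ln (2*e) = ln 2 + ln e" using e by (simp add: ln_mult)
  have l4: "ln (4*e) = 2 * ln 2 + ln e" using e ln_realpow[of 2 2] by (simp add: ln_mult)
  have l23: "ln (3/2) \<le> ln (2::real)" by simp
  have v: "bump e u = (if cmod u \<le> e then 0 else if cmod u \<le> 2*e then ln (cmod u) - ln e
      else if cmod u < 4*e then 2 * ln 2 + ln e - ln (cmod u) else 0)"
    using e by (simp add: bump_def max_def l2 l4)
  have mid1: "ln e \<le> ln (cmod u)" "ln (cmod u) \<le> ln 2 + ln e" if "e < cmod u" "cmod u \<le> 2*e"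
    using that e unfolding l2[symmetric] by (auto intro!: ln_mono)
  have mid2: "ln 2 + ln e \<le> ln (cmod u)" "ln (cmod u) \<le> 2 * ln 2 + ln e" if "2*e < cmod u" "cmod u < 4*e"
    using that e unfolding l2[symmetric] l4[symmetric] by (auto intro!: ln_mono)
  show "bump e u \<ge> 0" "bump e u \<le> 2 * ln 2"
    using mid1 mid2 by (auto simp: v)
  show "cmod u \<ge> 4*e \<Longrightarrow> bump e u = 0" using e by (simp add: v)
  assume "u \<in> cball (of_real (2*e)) (e/2)"
  then have d: "cmod (of_real (2*e) - u) \<le> e/2" by (simp add: dist_norm)
  have a: "cmod u \<le> 5/2*e" "cmod u \<ge> 3/2*e"
    using d norm_triangle_ineq2[of u "of_real (2*e)"] norm_triangle_ineq2[of "of_real (2*e)" u] e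
    by (simp_all add: norm_minus_commute)
  have a1: "ln (3/2) + ln e \<le> ln (cmod u)"
    using a e ln_mono[of "3/2*e" "cmod u"] ln_mult[of "3/2" e] by simp
  have "ln (cmod u) \<le> ln (5/2*e)" using a e by (subst ln_le_cancel_iff) auto
  also have "\<dots> = ln (5/2) + ln e" using e by (subst ln_mult) auto
  also have "ln (5/2) \<le> 2 * ln 2 - ln (3/2::real)"
  proof -
    have "ln (5/2 * (3/2)) \<le> ln (4::real)" by (subst ln_le_cancel_iff) auto
    moreover have "ln (5/2 * (3/2)) = ln (5/2) + ln (3/2::real)" by (subst ln_mult) auto
    moreover have "ln (4::real) = 2 * ln 2" using ln_realpow[of 2 2] by simp
    ultimately show ?thesis by simp
  qed
  finally have a2: "ln (cmod u) \<le> 2 * ln 2 - ln (3/2) + ln e" by simp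
  show "bump e u \<ge> ln (3/2)"
    using a a1 a2 e by (simp add: v)
qed

text \<open>Take for \<open>g\<close> the second difference of the circle averages of
  \<open>\<phi>\<close> at three radii, a discrete Laplacian. By \<open>ln_kernel_circ_avg\<close>
  its logarithmic potential is the convolution of \<open>\<phi>\<close> with the nonnegative,
  compactly supported bump, normalised by its mass \<open>\<kappa>\<close>: an approximate identity.
  Hence continuity of \<open>\<phi>\<close> is enough and nothing is differentiated.\<close>

lemma log_smoothing:
  fixes \<phi> :: "complex \<Rightarrow> real"
  assumes cont: "continuous_on UNIV \<phi>" and supp: "\<And>z. cmod z > R \<Longrightarrow> \<phi> z = 0" and e: "e > 0"
  shows "\<exists>g B R'. bdd_supp B R' g \<and> (\<forall>w. \<bar>(\<integral>z. ln (cmod (z - w)) * g z \<partial>lborel) - \<phi> w\<bar> \<le> e)"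
proof -
  have comp: "compact (\<phi> ` cball 0 R)"
    using cont by (intro compact_continuous_image) (auto intro: continuous_on_subset)
  then obtain B0 where B0: "\<And>z. z \<in> cball 0 R \<Longrightarrow> \<bar>\<phi> z\<bar> \<le> B0"
    by (metis compact_imp_bounded bounded_iff image_eqI real_norm_def)
  define B where "B = max B0 0"
  have B: "\<bar>\<phi> z\<bar> \<le> B" for z
    using B0[of z] supp[of z] by (cases "cmod z > R") (auto simp: B_def)
  have [measurable]: "\<phi> \<in> borel_measurable borel"
    using cont by (rule borel_measurable_continuous_onI)
  have g: "bdd_supp B R \<phi>" using B supp by (auto simp: bdd_supp_def)
  have "uniformly_continuous_on (cball 0 (R+2)) \<phi>"
    using cont by (intro compact_uniformly_continuous) (auto intro: continuous_on_subset)
  then obtain d where d: "d > 0" "\<And>p w. p \<in> cball 0 (R+2) \<Longrightarrow> w \<in> cball 0 (R+2) \<Longrightarrow> dist p w < d \<Longrightarrow> dist (\<phi> p) (\<phi> w)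
      < e"
    using e unfolding uniformly_continuous_on_def by metis
  \<comment> \<open>The bump has support radius \<open>4 * s\<close>. Below \<open>d\<close> it is
    within the reach of uniform continuity; below 1, two points that close either both lie in the
    ball of radius \<open>R + 2\<close> or both lie where \<open>\<phi>\<close> vanishes.\<close>
  define s where "s = min (d/8) (1/4)"
  have s: "s > 0" "4 * s < d" "4 * s \<le> 1" using d(1) by (auto simp: s_def)
  have near: "\<bar>\<phi> p - \<phi> w\<bar> \<le> e" if "cmod (p - w) \<le> 4 * s" for p w
  proof (cases "cmod p \<le> R + 1 \<or> cmod w \<le> R + 1")
    case True
    have "cmod p \<le> cmod w + 1" "cmod w \<le> cmod p + 1"
      using that s norm_triangle_ineq2[of p w] norm_triangle_ineq2[of w p] by (auto simp: norm_minus_commute)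
    with True have "p \<in> cball 0 (R+2)" "w \<in> cball 0 (R+2)" by auto
    from d(2)[OF this] show ?thesis using that s by (simp add: dist_norm)
  next
    case False
    then show ?thesis using supp e by auto
  qed
  have [measurable]: "bump s \<in> borel_measurable borel" unfolding bump_def[abs_def] by measurable
  have bint: "integrable lborel (bump s)"
  proof (rule Bochner_Integration.integrable_bound[of _ "\<lambda>z. 2 * ln 2 * indicator (cball 0 (4 * s)) z"])
    show "integrable lborel (\<lambda>z. 2 * ln 2 * indicator (cball (0::complex) (4 * s)) z :: real)"
      by (intro integrable_mult_right integrable_real_indicator) (auto simp:
          emeasure_lborel_cball_finite[unfolded infinity_ennreal_def])
    show "AE x in lborel. norm (bump s x) \<le> norm (2 * ln 2 * indicator (cball 0 (4 * s)) x :: real)"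
      using bump_props[OF s(1)] by (intro AE_I2) (auto split: split_indicator)
  qed measurable
  define \<kappa> where "\<kappa> = (\<integral>u. bump s u \<partial>lborel)"
  have "0 < ln (3/2) * measure lborel (cball (complex_of_real (2 * s)) (s/2))"
    using s by (simp add: measure_def emeasure_cball_complex)
  also have "\<dots> = (\<integral>u. ln (3/2) * indicator (cball (complex_of_real (2 * s)) (s/2)) u \<partial>lborel)" by simp
  also have "\<dots> \<le> \<kappa>"
    unfolding \<kappa>_def using bump_props[OF s(1)]
    by (intro integral_mono bint integrable_mult_right integrable_real_indicator)
       (auto simp: emeasure_lborel_cball_finite[unfolded infinity_ennreal_def] split: split_indicator)
  finally have \<kappa>: "\<kappa> > 0" .
  have \<kappa>s: "integrable lborel (\<lambda>p. bump s (p - w))" "(\<integral>p. bump s (p - w) \<partial>lborel) = \<kappa>" for w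
  proof -
    show "(\<integral>p. bump s (p - w) \<partial>lborel) = \<kappa>"
      using integral_lborel_shift[of "bump s" "-w"] by (simp add: \<kappa>_def)
    show "integrable lborel (\<lambda>p. bump s (p - w))"
    proof (rule integrableI_bounded)
      have "(\<integral>\<^sup>+p. ennreal (norm (bump s (p - w))) \<partial>lborel) = (\<integral>\<^sup>+p. ennreal (norm (bump s p)) \<partial>lborel)"
        using nn_integral_lborel_shift[of "\<lambda>p. ennreal (norm (bump s p))" "-w"] by simp
      also have "\<dots> < \<infinity>" using bint by (simp add: integrable_iff_bounded)
      finally show "(\<integral>\<^sup>+p. ennreal (norm (bump s (p - w))) \<partial>lborel) < \<infinity>" .
    qed measurable
  qed
  define g where "g = (\<lambda>z. (circ_avg s \<phi> z - 2 * circ_avg (2 * s) \<phi> z + circ_avg (4 * s) \<phi> z) / \<kappa>)"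
  have ca: "bdd_supp B (R + s) (circ_avg s \<phi>)" "bdd_supp B (R + 2 * s) (circ_avg (2 * s) \<phi>)" "bdd_supp B (R + 4
      * s) (circ_avg (4 * s) \<phi>)"
    using bdd_supp_circ_avg[OF g] s by auto
  have 1: "bdd_supp (4 * B / \<kappa>) (R + 4 * s) g"
    unfolding bdd_supp_def
  proof (intro conjI allI impI)
    show "g \<in> borel_measurable borel" unfolding g_def using ca[THEN bdd_suppD(1)] by measurable
    fix z
    show "\<bar>g z\<bar> \<le> 4 * B / \<kappa>"
      using ca[THEN bdd_suppD(2), of z] \<kappa> by (simp add: g_def divide_right_mono abs_divide)
    show "g z = 0" if "R + 4 * s < cmod z"
      using ca[THEN bdd_suppD(3), of z] that s by (simp add: g_def)
  qed
  moreover have "\<bar>(\<integral>z. ln (cmod (z - w)) * g z \<partial>lborel) - \<phi> w\<bar> \<le> e" for w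
  proof -
    have i1: "integrable lborel (\<lambda>z. ln (cmod (z - w)) * circ_avg r \<phi> z)" if "r > 0" for r
      using integrable_ln_kernel[OF bdd_supp_circ_avg[OF g that]] .
    have i2: "integrable lborel (\<lambda>p. ln (max (cmod (p - w)) r) * \<phi> p)" if "r > 0" for r
    proof (rule Bochner_Integration.integrable_bound[of _ "\<lambda>p. \<bar>ln (cmod (p - w)) * \<phi> p\<bar> + \<bar>ln r\<bar> * (B *
        indicator (cball 0 R) p)"])
      show "integrable lborel (\<lambda>p. \<bar>ln (cmod (p - w)) * \<phi> p\<bar> + \<bar>ln r\<bar> * (B * indicator (cball 0 R) p))"
        by (intro Bochner_Integration.integrable_add integrable_abs integrable_ln_kernel[OF g]
            integrable_mult_right integrable_real_indicator)
           (auto simp: emeasure_lborel_cball_finite[unfolded infinity_ennreal_def])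
      show "AE p in lborel. norm (ln (max (cmod (p - w)) r) * \<phi> p) \<le> norm (\<bar>ln (cmod (p - w)) * \<phi> p\<bar> + \<bar>ln r\<bar> *
          (B * indicator (cball 0 R) p))"
      proof (rule AE_I2)
        fix p
        have "\<bar>ln (max (cmod (p - w)) r) * \<phi> p\<bar> \<le> \<bar>ln (cmod (p - w)) * \<phi> p\<bar> + \<bar>ln r\<bar> * \<bar>\<phi> p\<bar>"
          by (auto simp: max_def abs_mult)
        also have "\<bar>\<phi> p\<bar> \<le> B * indicator (cball 0 R) p" using B[of p] supp[of p] by (auto split:
            split_indicator)
        finally show "norm (ln (max (cmod (p - w)) r) * \<phi> p) \<le> norm (\<bar>ln (cmod (p - w)) * \<phi> p\<bar> + \<bar>ln r\<bar> * (B *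
            indicator (cball 0 R) p))"
          by (auto simp: mult_left_mono)
      qed
    qed measurable
    have "(\<integral>z. ln (cmod (z - w)) * g z \<partial>lborel) =
       (\<integral>z. (ln (cmod (z - w)) * circ_avg s \<phi> z - 2 * (ln (cmod (z - w)) * circ_avg (2 * s) \<phi> z) + ln (cmod (z -
           w)) * circ_avg (4 * s) \<phi> z) / \<kappa> \<partial>lborel)"
      by (intro Bochner_Integration.integral_cong) (auto simp: g_def algebra_simps)
    also have "\<dots> = ((\<integral>z. ln (cmod (z - w)) * circ_avg s \<phi> z \<partial>lborel) - 2 * (\<integral>z. ln (cmod (z - w)) * circ_avg (2
        * s) \<phi> z \<partial>lborel)
       + (\<integral>z. ln (cmod (z - w)) * circ_avg (4 * s) \<phi> z \<partial>lborel)) / \<kappa>"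
      using i1 s by simp
    also have "\<dots> = ((\<integral>p. ln (max (cmod (p - w)) s) * \<phi> p \<partial>lborel) - 2 * (\<integral>p. ln (max (cmod (p - w)) (2 * s)) * \<phi>
        p \<partial>lborel)
       + (\<integral>p. ln (max (cmod (p - w)) (4 * s)) * \<phi> p \<partial>lborel)) / \<kappa>"
      using s by (simp add: ln_kernel_circ_avg[OF g])
    also have "\<dots> = (\<integral>p. (ln (max (cmod (p - w)) s) * \<phi> p - 2 * (ln (max (cmod (p - w)) (2 * s)) * \<phi> p)
       + ln (max (cmod (p - w)) (4 * s)) * \<phi> p) \<partial>lborel) / \<kappa>"
      using i2 s by simp
    also have "\<dots> = (\<integral>p. bump s (p - w) * \<phi> p \<partial>lborel) / \<kappa>"
      by (intro arg_cong2[where f="(/)"] Bochner_Integration.integral_cong) (auto simp: bump_def algebra_simps)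
    finally have eq: "(\<integral>z. ln (cmod (z - w)) * g z \<partial>lborel) = (\<integral>p. bump s (p - w) * \<phi> p \<partial>lborel) / \<kappa>" .
    have i3: "integrable lborel (\<lambda>p. bump s (p - w) * \<phi> p)"
    proof (rule Bochner_Integration.integrable_bound[OF integrable_mult_right[OF \<kappa>s(1), of B]])
      show "AE p in lborel. norm (bump s (p - w) * \<phi> p) \<le> norm (B * bump s (p - w))" for w
        using B bump_props(1)[OF s(1)]
        by (intro AE_I2) (simp add: abs_mult mult.commute mult_mono order_trans[OF _ abs_ge_self])
    qed measurable
    have "\<bar>(\<integral>p. bump s (p - w) * \<phi> p \<partial>lborel) - \<kappa> * \<phi> w\<bar> = \<bar>\<integral>p. bump s (p - w) * (\<phi> p - \<phi> w) \<partial>lborel\<bar>"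
      using i3 \<kappa>s[of w] by (simp add: right_diff_distrib)
    also have "\<dots> \<le> (\<integral>p. \<bar>bump s (p - w) * (\<phi> p - \<phi> w)\<bar> \<partial>lborel)" by (rule integral_abs_bound)
    also have "\<dots> \<le> (\<integral>p. e * bump s (p - w) \<partial>lborel)"
    proof (rule integral_mono)
      show "integrable lborel (\<lambda>p. \<bar>bump s (p - w) * (\<phi> p - \<phi> w)\<bar>)"
        using i3 \<kappa>s(1)[of w] by (auto simp: right_diff_distrib)
      show "integrable lborel (\<lambda>p. e * bump s (p - w))" using \<kappa>s(1) by auto
      fix p
      show "\<bar>bump s (p - w) * (\<phi> p - \<phi> w)\<bar> \<le> e * bump s (p - w)"
        using near[of p w] bump_props(1,2)[OF s(1), of "p - w"]
        by (cases "cmod (p - w) \<le> 4 * s") (auto simp: abs_mult mult.commute[of e] mult_left_mono)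
    qed
    also have "\<dots> = e * \<kappa>" using \<kappa>s[of w] by simp
    finally show ?thesis unfolding eq using \<kappa>
      by (simp add: abs_le_iff field_simps)
  qed
  ultimately show ?thesis by blast
qed

section \<open>Determinants of cyclic blocks and block matrices\<close>

abbreviation nrm :: "nat \<Rightarrow> (nat \<Rightarrow> complex) \<Rightarrow> real" where
  "nrm n v \<equiv> L2_set (\<lambda>i. cmod (v i)) {..<n}"

definition mv :: "complex mat \<Rightarrow> (nat \<Rightarrow> complex) \<Rightarrow> nat \<Rightarrow> complex" where
  "mv A v i = (\<Sum>j<dim_col A. A $$ (i,j) * v j)"

lemma mult_mat_vec_mv:
  assumes "A \<in> carrier_mat n n" "v \<in> carrier_vec n" "i < n"
  shows "(A *\<^sub>v v) $ i = mv A (\<lambda>j. v $ j) i"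
  using assms by (auto simp: mv_def scalar_prod_def lessThan_atLeast0)

lemma nrm_eq_0_iff: "nrm n v = 0 \<longleftrightarrow> (\<forall>i<n. v i = 0)"
  by (auto simp: L2_set_eq_0_iff)

text \<open>The eigenvalues of \<open>Z\<inverse> E\<close> have modulus at most \<open>\<kappa>\<close>, and \<open>det (Z + E) / det Z\<close> is their characteristic product.\<close>

lemma det_perturb:
  assumes Z: "Z \<in> carrier_mat n n" and E: "E \<in> carrier_mat n n" and s: "s > 0" and \<kappa>: "0 \<le> \<kappa>" "\<kappa> < 1"
    and Zl: "\<And>v. s * nrm n v \<le> nrm n (mv Z v)" and Eu: "\<And>v. nrm n (mv E v) \<le> \<kappa> * s * nrm n v"
  shows "cmod (det Z) * (1 - \<kappa>) ^ n \<le> cmod (det (Z + E))"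
    and "cmod (det (Z + E)) \<le> cmod (det Z) * (1 + \<kappa>) ^ n"
proof -
  have dZ: "det Z \<noteq> 0"
  proof
    assume "det Z = 0"
    then obtain v where v: "v \<in> carrier_vec n" "v \<noteq> 0\<^sub>v n" "Z *\<^sub>v v = 0\<^sub>v n"
      using det_0_iff_vec_prod_zero_field[OF Z] by auto
    have "mv Z (\<lambda>j. v $ j) i = 0" if "i < n" for i
      using mult_mat_vec_mv[OF Z v(1) that] v(3) that by simp
    then have "nrm n (mv Z (\<lambda>j. v $ j)) = 0" by (simp add: nrm_eq_0_iff)
    then have "nrm n (\<lambda>j. v $ j) \<le> 0" using Zl[of "\<lambda>j. v $ j"] s by (simp add: mult_le_0_iff)
    then have "nrm n (\<lambda>j. v $ j) = 0" using L2_set_nonneg[of "\<lambda>i. cmod (v $ i)" "{..<n}"] by linarith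
    then have "v = 0\<^sub>v n" using v(1) by (intro eq_vecI) (auto simp: nrm_eq_0_iff)
    then show False using v by simp
  qed
  from det_non_zero_imp_unit[OF Z dZ, of undefined] obtain B where B: "B \<in> carrier_mat n n" "Z * B = 1\<^sub>m n"
    unfolding Units_def ring_mat_def by auto
  define K where "K = - (B * E)"
  have K: "K \<in> carrier_mat n n" using B E by (auto simp: K_def)
  have ZK: "Z * K = - E"
  proof -
    have "Z * K = - (Z * (B * E))" unfolding K_def using Z B(1) E by (simp add: uminus_mult_right_mat)
    also have "Z * (B * E) = (Z * B) * E" using Z B(1) E by (simp add: assoc_mult_mat)
    finally show ?thesis using B(2) E by simp
  qed
  have "Z + E = Z * (1\<^sub>m n - K)"
  proof -
    have "Z * (1\<^sub>m n - K) = Z - Z * K" using mult_minus_distrib_mat[OF Z one_carrier_mat K] Z by simp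
    then show ?thesis unfolding ZK using Z E by (auto intro!: eq_matI)
  qed
  then have d: "det (Z + E) = det Z * det (1\<^sub>m n - K)"
    using det_mult[OF Z, of "1\<^sub>m n - K"] minus_carrier_mat[OF K] by simp
  obtain as where as: "char_poly K = (\<Prod>a\<leftarrow>as. [:- a, 1:])" "length as = n"
    using char_poly_factorized[OF K] by auto
  have "- char_matrix K 1 = 1\<^sub>m n - K"
    using K by (intro eq_matI) (auto simp: char_matrix_def)
  then have "det (1\<^sub>m n - K) = poly (char_poly K) 1"
    using char_poly_matrix[OF K, of 1] by simp
  also have "\<dots> = (\<Prod>a\<leftarrow>as. 1 - a)"
    unfolding as(1) poly_prod_list map_map by (rule arg_cong[where f=prod_list]) simp
  finally have dK: "det (1\<^sub>m n - K) = (\<Prod>a\<leftarrow>as. 1 - a)" .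
  \<comment> \<open>From \<open>K v = a v\<close> and \<open>Z K = - E\<close> follows
    \<open>- E v = a Z v\<close>; comparing norms,
    \<open>cmod a * s * nrm n v \<le> \<kappa> * s * nrm n v\<close>.\<close>
  have ev: "cmod a \<le> \<kappa>" if "a \<in> set as" for a
  proof -
    have "poly (char_poly K) a = 0" unfolding as(1) using that
      by (auto simp: poly_prod_list prod_list_zero_iff)
    then have "eigenvalue K a" using eigenvalue_root_char_poly[OF K] by simp
    then obtain v where v: "v \<in> carrier_vec n" "v \<noteq> 0\<^sub>v n" "K *\<^sub>v v = a \<cdot>\<^sub>v v"
      using K unfolding eigenvalue_def eigenvector_def by auto
    have "(- E) *\<^sub>v v = a \<cdot>\<^sub>v (Z *\<^sub>v v)"
    proof -
      have "(- E) *\<^sub>v v = Z *\<^sub>v (K *\<^sub>v v)" unfolding ZK[symmetric] using Z K v(1) by simp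
      also have "\<dots> = a \<cdot>\<^sub>v (Z *\<^sub>v v)" unfolding v(3) using Z v(1) by (simp add: mult_mat_vec)
      finally show ?thesis .
    qed
    then have "mv (- E) (\<lambda>j. v $ j) i = a * mv Z (\<lambda>j. v $ j) i" if "i < n" for i
      using mult_mat_vec_mv[OF Z v(1) that] mult_mat_vec_mv[of "- E" n v i] E v(1) Z that by simp
    moreover have "mv (- E) (\<lambda>j. v $ j) i = - mv E (\<lambda>j. v $ j) i" if "i < n" for i
      using E that by (simp add: mv_def sum_negf)
    ultimately have "cmod (mv E (\<lambda>j. v $ j) i) = cmod a * cmod (mv Z (\<lambda>j. v $ j) i)" if "i < n" for i
      using that by (metis norm_minus_cancel norm_mult)
    then have "nrm n (mv E (\<lambda>j. v $ j)) = L2_set (\<lambda>i. cmod a * cmod (mv Z (\<lambda>j. v $ j) i)) {..<n}"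
      by (intro L2_set_cong) auto
    also have "\<dots> = cmod a * nrm n (mv Z (\<lambda>j. v $ j))" by (simp add: L2_set_right_distrib)
    finally have "cmod a * (s * nrm n (\<lambda>j. v $ j)) \<le> \<kappa> * s * nrm n (\<lambda>j. v $ j)"
      using mult_left_mono[OF Zl[of "\<lambda>j. v $ j"], of "cmod a"] Eu[of "\<lambda>j. v $ j"] by simp
    moreover have "nrm n (\<lambda>j. v $ j) > 0"
    proof -
      have "nrm n (\<lambda>j. v $ j) \<noteq> 0"
      proof
        assume "nrm n (\<lambda>j. v $ j) = 0"
        then have "v = 0\<^sub>v n" using v(1) by (intro eq_vecI) (auto simp: nrm_eq_0_iff)
        then show False using v by simp
      qed
      then show ?thesis using L2_set_nonneg[of "\<lambda>i. cmod (v $ i)" "{..<n}"] by linarith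
    qed
    ultimately show ?thesis using s by (simp add: mult.assoc[symmetric])
  qed
  have "(1 - \<kappa>) ^ length as \<le> cmod (\<Prod>a\<leftarrow>as. 1 - a) \<and> cmod (\<Prod>a\<leftarrow>as. 1 - a) \<le> (1 + \<kappa>) ^ length as"
    using ev
  proof (induct as)
    case (Cons a as)
    have "1 - \<kappa> \<le> cmod (1 - a)" "cmod (1 - a) \<le> 1 + \<kappa>"
      using Cons(2)[of a] norm_triangle_ineq2[of 1 a] norm_triangle_ineq4[of 1 a] by auto
    with Cons \<kappa> show ?case by (auto simp: norm_mult intro!: mult_mono)
  qed simp
  with as(2) dK have b: "(1 - \<kappa>) ^ n \<le> cmod (det (1\<^sub>m n - K))" "cmod (det (1\<^sub>m n - K)) \<le> (1 + \<kappa>) ^ n" by auto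
  show "cmod (det Z) * (1 - \<kappa>) ^ n \<le> cmod (det (Z + E))" "cmod (det (Z + E)) \<le> cmod (det Z) * (1 + \<kappa>) ^ n"
    unfolding d norm_mult using b by (auto intro!: mult_left_mono)
qed

text \<open>A Jordan block subtracted from \<open>z\<close> is the case of constant
  \<open>\<alpha>\<close>, \<open>\<beta> = 1\<close> and \<open>\<kappa> = 0\<close>; the bottom
  left corner \<open>\<kappa>\<close> closes the chain to a cycle. The three contributions are
  added, so that in dimension 1, where the corner is the diagonal entry, the formulas remain
  correct.\<close>

definition cyc_block :: "nat \<Rightarrow> (nat \<Rightarrow> complex) \<Rightarrow> (nat \<Rightarrow> complex) \<Rightarrow> complex \<Rightarrow> complex mat" where
  "cyc_block n \<alpha> \<beta> \<kappa> = mat n n (\<lambda>(k,k'). (if k = k' then \<alpha> k else 0) - (if k' = Suc k then \<beta> k else 0)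
      + (if Suc k = n \<and> k' = 0 then \<kappa> else 0))"

lemma cyc_block_carrier [simp]: "cyc_block n \<alpha> \<beta> \<kappa> \<in> carrier_mat n n"
  and dim_cyc_block [simp]: "dim_row (cyc_block n \<alpha> \<beta> \<kappa>) = n" "dim_col (cyc_block n \<alpha> \<beta> \<kappa>) = n"
  by (auto simp: cyc_block_def)

text \<open>The last row has only two entries that matter. Deleting the last column leaves an upper
  triangular matrix with diagonal \<open>\<alpha>\<close>, deleting the first a lower triangular one
  with diagonal \<open>- \<beta>\<close>; the sign of that product cancels the sign of the
  cofactor.\<close>

lemma det_cyc_block:
  assumes "n > 0"
  shows "det (cyc_block n \<alpha> \<beta> \<kappa>) = (\<Prod>k<n. \<alpha> k) + \<kappa> * (\<Prod>k<n-1. \<beta> k)"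
proof -
  obtain m where n: "n = Suc m" using assms by (cases n) auto
  let ?A = "cyc_block n \<alpha> \<beta> \<kappa>"
  have "det ?A = (\<Sum>j<n. ?A $$ (m,j) * cofactor ?A m j)"
    by (rule laplace_expansion_row) (simp_all add: n)
  also have "\<dots> = (\<Sum>j<n. (if j = m then \<alpha> m * cofactor ?A m m else 0) + (if j = 0 then \<kappa> * cofactor ?A m 0 else
      0))"
    by (intro sum.cong) (auto simp: cyc_block_def n distrib_right)
  also have "\<dots> = \<alpha> m * cofactor ?A m m + \<kappa> * cofactor ?A m 0"
    unfolding sum.distrib using n by simp
  also have "cofactor ?A m m = (\<Prod>k<m. \<alpha> k)"
  proof -
    have c: "mat_delete ?A m m \<in> carrier_mat m m" by (simp add: n mat_delete_def)
    have "det (mat_delete ?A m m) = prod_list (diag_mat (mat_delete ?A m m))"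
      by (rule det_upper_triangular[OF _ c]) (auto simp: upper_triangular_def mat_delete_def cyc_block_def n)
    also have "\<dots> = (\<Prod>k<m. \<alpha> k)"
      by (auto simp: prod_list_diag_prod n mat_delete_def cyc_block_def lessThan_atLeast0 intro!: prod.cong)
    finally show ?thesis by (simp add: cofactor_def)
  qed
  also have "cofactor ?A m 0 = (\<Prod>k<m. \<beta> k)"
  proof -
    have c: "mat_delete ?A m 0 \<in> carrier_mat m m" by (simp add: n mat_delete_def)
    have "det (mat_delete ?A m 0) = prod_list (diag_mat (mat_delete ?A m 0))"
      by (rule det_lower_triangular[OF _ c]) (auto simp: mat_delete_def cyc_block_def n)
    also have "\<dots> = (\<Prod>k<m. - \<beta> k)"
      by (auto simp: prod_list_diag_prod n mat_delete_def cyc_block_def lessThan_atLeast0 intro!: prod.cong)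
    also have "\<dots> = (-1) ^ m * (\<Prod>k<m. \<beta> k)"
      by (induct m) (auto simp: mult_ac)
    finally show ?thesis by (simp add: cofactor_def power_add[symmetric] flip: mult.assoc)
  qed
  finally show ?thesis by (simp add: n mult.commute)
qed

lemma mv_cyc_block:
  assumes "k < n"
  shows "mv (cyc_block n \<alpha> \<beta> \<kappa>) v k = \<alpha> k * v k - (if Suc k < n then \<beta> k * v (Suc k) else 0)
    + (if Suc k = n then \<kappa> * v 0 else 0)"
proof -
  have "mv (cyc_block n \<alpha> \<beta> \<kappa>) v k = (\<Sum>j<n. ((if j = k then \<alpha> k * v k else 0) - (if j = Suc k then \<beta> k * v (Suc
      k) else 0))
      + (if j = 0 then (if Suc k = n then \<kappa> * v 0 else 0) else 0))"
    unfolding mv_def using assms by (intro sum.cong) (auto simp: cyc_block_def algebra_simps)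
  also have "\<dots> = \<alpha> k * v k - (if Suc k < n then \<beta> k * v (Suc k) else 0) + (if Suc k = n then \<kappa> * v 0 else 0)"
    unfolding sum.distrib sum_subtractf using assms by (simp add: sum.delta')
  finally show ?thesis .
qed

lemma nrm_shift_le: "L2_set (\<lambda>k. if Suc k < n then cmod (v (Suc k)) else 0) {..<n} \<le> nrm n v"
proof (cases n)
  case (Suc m)
  have "(\<Sum>k<Suc m. (if Suc k < Suc m then cmod (v (Suc k)) else 0)\<^sup>2) = (\<Sum>k<m. (cmod (v (Suc k)))\<^sup>2)"
    by simp
  also have "\<dots> \<le> (\<Sum>k<Suc m. (cmod (v k))\<^sup>2)"
    by (subst sum.lessThan_Suc_shift) simp
  finally show ?thesis unfolding L2_set_def Suc by (rule real_sqrt_le_mono)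
qed simp

text \<open>The superdiagonal acts as a shift of norm at most \<open>b\<close>, which the diagonal
  dominates.\<close>

lemma tri_block_lower:
  assumes A: "\<And>k. k < n \<Longrightarrow> A \<le> cmod (\<alpha> k)" and b: "\<And>k. k < n \<Longrightarrow> cmod (\<beta> k) \<le> b" and A0: "A \<ge> 0" "b \<ge> 0"
  shows "(A - b) * nrm n v \<le> nrm n (mv (cyc_block n \<alpha> \<beta> 0) v)"
proof -
  let ?y = "mv (cyc_block n \<alpha> \<beta> 0) v"
  have "A * nrm n v = L2_set (\<lambda>k. A * cmod (v k)) {..<n}"
    using A0 by (simp add: L2_set_right_distrib)
  also have "\<dots> \<le> L2_set (\<lambda>k. cmod (?y k) + b * (if Suc k < n then cmod (v (Suc k)) else 0)) {..<n}"
  proof (rule L2_set_mono)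
    fix k assume k: "k \<in> {..<n}"
    have "A * cmod (v k) \<le> cmod (\<alpha> k * v k)" using A k by (simp add: norm_mult mult_right_mono)
    also have "\<alpha> k * v k = ?y k + (if Suc k < n then \<beta> k * v (Suc k) else 0)" using k by (simp add:
        mv_cyc_block)
    also have "cmod \<dots> \<le> cmod (?y k) + cmod (if Suc k < n then \<beta> k * v (Suc k) else 0)" by (rule
        norm_triangle_ineq)
    also have "cmod (if Suc k < n then \<beta> k * v (Suc k) else 0) \<le> b * (if Suc k < n then cmod (v (Suc k)) else
        0)"
      using b[of k] k by (auto simp: norm_mult intro!: mult_right_mono)
    finally show "A * cmod (v k) \<le> cmod (?y k) + b * (if Suc k < n then cmod (v (Suc k)) else 0)" by simp
  qed (use A0 in auto)
  also have "\<dots> \<le> nrm n ?y + L2_set (\<lambda>k. b * (if Suc k < n then cmod (v (Suc k)) else 0)) {..<n}"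
    by (rule L2_set_triangle_ineq)
  also have "L2_set (\<lambda>k. b * (if Suc k < n then cmod (v (Suc k)) else 0)) {..<n} = b * L2_set (\<lambda>k. if Suc k < n
      then cmod (v (Suc k)) else 0) {..<n}"
    using A0 by (simp add: L2_set_right_distrib)
  also have "\<dots> \<le> b * nrm n v" using A0 by (intro mult_left_mono nrm_shift_le) auto
  finally show ?thesis by (simp add: algebra_simps)
qed

text \<open>The number \<open>a * w ^ (n - 1) + b\<close> is the determinant of the block, so a
  cycle with determinant at least \<open>\<tau>\<close> is well conditioned, with a bound
  independent of \<open>n\<close>. All rows but the last form a contracting recurrence that
  determines \<open>v k\<close> by \<open>v 0\<close> up to an error \<open>M / \<theta>\<close>.
  Inserted in the last row this gives \<open>\<tau> * cmod (v 0) \<le> 2 * M / \<theta>\<close>, and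
  recovering the norm of \<open>v\<close> from \<open>v 0\<close> and the recurrence loses a second
  factor \<open>\<theta>\<close>.\<close>

lemma cyc_block_lower:
  assumes n: "n > 0" and \<theta>: "0 < \<theta>" "\<theta> \<le> 1" and w: "cmod w \<le> 1 - \<theta>" and a: "cmod a \<le> 1"
    and D: "cmod (a * w ^ (n - 1) + b) \<ge> \<tau>" and \<tau>: "0 < \<tau>" "\<tau> \<le> 1"
  shows "\<theta>\<^sup>2 * \<tau> / 3 * nrm n v \<le> nrm n (mv (cyc_block n (\<lambda>k. if Suc k < n then w else a) (\<lambda>_. 1) b) v)"
proof -
  define y where "y = mv (cyc_block n (\<lambda>k. if Suc k < n then w else a) (\<lambda>_. 1) b) v"
  define M where "M = nrm n y"
  have M0: "M \<ge> 0" by (simp add: M_def)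
  have yM: "cmod (y k) \<le> M" if "k < n" for k
    unfolding M_def using that member_le_L2_set[of "{..<n}" k "\<lambda>i. cmod (y i)"] by simp
  have y1: "y k = w * v k - v (Suc k)" if "Suc k < n" for k
    using that by (simp add: y_def mv_cyc_block)
  have y2: "y (n - 1) = a * v (n - 1) + b * v 0"
    using n by (simp add: y_def mv_cyc_block)
  \<comment> \<open>The bound \<open>M / \<theta>\<close> is the fixed point of
    \<open>x \<mapsto> (1 - \<theta>) * x + M\<close>.\<close>
  have deviation: "cmod (v k - w ^ k * v 0) \<le> M / \<theta>" if "k < n" for k
    using that
  proof (induct k)
    case 0 then show ?case using M0 \<theta> by simp
  next
    case (Suc k)
    then have "v (Suc k) - w ^ Suc k * v 0 = w * (v k - w ^ k * v 0) - y k"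
      by (simp add: y1 algebra_simps)
    then have "cmod (v (Suc k) - w ^ Suc k * v 0) \<le> cmod w * cmod (v k - w ^ k * v 0) + cmod (y k)"
      by (metis norm_mult norm_triangle_ineq4)
    also have "\<dots> \<le> (1 - \<theta>) * (M / \<theta>) + M"
      using Suc yM[of k] w \<theta> by (intro add_mono mult_mono) auto
    also have "\<dots> = M / \<theta>" using \<theta> by (simp add: field_simps)
    finally show ?case .
  qed
  have "(a * w ^ (n-1) + b) * v 0 = y (n-1) - a * (v (n-1) - w ^ (n-1) * v 0)"
    unfolding y2 by (simp add: algebra_simps)
  then have "cmod (a * w ^ (n-1) + b) * cmod (v 0) \<le> cmod (y (n-1)) + cmod a * cmod (v (n-1) - w ^ (n-1) * v 0)"
    by (metis norm_mult norm_triangle_ineq4)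
  also have "\<dots> \<le> M + 1 * (M / \<theta>)"
    using yM[of "n-1"] deviation[of "n-1"] a n M0 \<theta> by (intro add_mono mult_mono) auto
  also have "\<dots> \<le> 2 * M / \<theta>"
  proof -
    have "M \<le> M / \<theta>" using M0 \<theta> by (simp add: le_divide_eq mult_left_le)
    then show ?thesis by simp
  qed
  finally have "\<tau> * cmod (v 0) \<le> 2 * M / \<theta>"
    using D mult_right_mono[OF D, of "cmod (v 0)"] by simp
  then have v0: "\<tau> * \<theta> * cmod (v 0) \<le> 2 * M" using \<theta> by (simp add: field_simps)
  have pred: "L2_set (\<lambda>k. cmod (if k = 0 then 0 else u (k-1))) {..<n} \<le> nrm n u" for u :: "nat \<Rightarrow> complex"
  proof -
    obtain m where m: "n = Suc m" using n by (cases n) auto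
    have "(\<Sum>k<n. (cmod (if k = 0 then 0 else u (k-1)))\<^sup>2) = (\<Sum>k<m. (cmod (u k))\<^sup>2)"
      unfolding m by (subst sum.lessThan_Suc_shift) simp
    also have "\<dots> \<le> (\<Sum>k<n. (cmod (u k))\<^sup>2)" unfolding m by simp
    finally show ?thesis unfolding L2_set_def by (rule real_sqrt_le_mono)
  qed
  have "nrm n v \<le> L2_set (\<lambda>k. (if k = 0 then cmod (v 0) else 0) + (cmod (w * (if k = 0 then 0 else v (k - 1))) +
      cmod (if k = 0 then 0 else y (k-1)))) {..<n}"
  proof (rule L2_set_mono)
    fix k assume k: "k \<in> {..<n}"
    show "cmod (v k) \<le> (if k = 0 then cmod (v 0) else 0) + (cmod (w * (if k = 0 then 0 else v (k - 1))) + cmod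
        (if k = 0 then 0 else y (k-1)))"
    proof (cases k)
      case (Suc j)
      then have "v k = w * v j - y j" using k y1[of j] by simp
      then show ?thesis using Suc norm_triangle_ineq4[of "w * v j" "y j"] by simp
    qed simp
  qed simp
  also have "\<dots> \<le> L2_set (\<lambda>k. if k = 0 then cmod (v 0) else 0) {..<n}
     + (L2_set (\<lambda>k. cmod (w * (if k = 0 then 0 else v (k - 1)))) {..<n} + L2_set (\<lambda>k. cmod (if k = 0 then 0 else
         y (k-1))) {..<n})"
    by (intro order_trans[OF L2_set_triangle_ineq] add_left_mono L2_set_triangle_ineq)
  also have "L2_set (\<lambda>k. if k = 0 then cmod (v 0) else 0) {..<n} \<le> cmod (v 0)"
  proof -
    have "L2_set (\<lambda>k. if k = 0 then cmod (v 0) else 0) {..<n} \<le> (\<Sum>k<n. if k = 0 then cmod (v 0) else 0)"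
      by (rule L2_set_le_sum) auto
    then show ?thesis using n by (simp add: sum.delta)
  qed
  also have "L2_set (\<lambda>k. cmod (if k = 0 then 0 else y (k-1))) {..<n} \<le> M"
    unfolding M_def by (rule pred)
  also have "L2_set (\<lambda>k. cmod (w * (if k = 0 then 0 else v (k - 1)))) {..<n}
     = cmod w * L2_set (\<lambda>k. cmod (if k = 0 then 0 else v (k - 1))) {..<n}"
    unfolding norm_mult by (simp add: L2_set_right_distrib)
  also have "\<dots> \<le> (1 - \<theta>) * nrm n v"
    using w pred[of v] \<theta> by (intro mult_mono) auto
  finally have "\<theta> * nrm n v \<le> cmod (v 0) + M" by (simp add: algebra_simps)
  then have "\<theta> * \<tau> * (\<theta> * nrm n v) \<le> \<theta> * \<tau> * (cmod (v 0) + M)"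
    using \<theta> \<tau> by (intro mult_left_mono) auto
  also have "\<dots> \<le> 2 * M + M"
  proof -
    have "\<theta> * \<tau> * M \<le> 1 * M"
      using \<theta> \<tau> M0 by (intro mult_right_mono mult_le_one) auto
    then show ?thesis using v0 by (simp add: algebra_simps)
  qed
  finally show ?thesis unfolding M_def y_def by (simp add: power2_eq_square mult_ac)
qed

section \<open>Row indices as pairs of a block and a position in it\<close>

definition bstart :: "(nat \<Rightarrow> nat) \<Rightarrow> nat \<Rightarrow> nat" where
  "bstart d i = (\<Sum>k<i. d k)"

lemma bstart_simps [simp]: "bstart d 0 = 0" "bstart d (Suc i) = bstart d i + d i"
  by (simp_all add: bstart_def)

lemma bstart_mono: "i \<le> j \<Longrightarrow> bstart d i \<le> bstart d j"
  by (induct rule: dec_induct) auto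

lemma bstart_less: "i < l \<Longrightarrow> k < d i \<Longrightarrow> bstart d i + k < bstart d l"
  using bstart_mono[of "Suc i" l d] by simp

lemma bstart_less_block: "i < i' \<Longrightarrow> k < d i \<Longrightarrow> bstart d i + k < bstart d i' + k'"
  using bstart_less[of i i' k d] by simp

lemma bstart_inject:
  assumes "k < d i" "k' < d i'"
  shows "bstart d i + k = bstart d i' + k' \<longleftrightarrow> i = i' \<and> k = k'"
  using bstart_less_block[of i i' k d k'] bstart_less_block[of i' i k' d k] assms
  by (cases i i' rule: linorder_cases) auto

lemma bstart_ex: "r < bstart d l \<Longrightarrow> \<exists>i<l. \<exists>k<d i. r = bstart d i + k"
proof (induct l)
  case (Suc l)
  show ?case
  proof (cases "r < bstart d l")
    case True
    from Suc(1)[OF True] show ?thesis using less_SucI by blast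
  next
    case False
    then have "r - bstart d l < d l" "r = bstart d l + (r - bstart d l)" using Suc(2) by auto
    then show ?thesis by blast
  qed
qed simp

lemma bstart_cases:
  assumes "r < bstart d l"
  obtains i k where "i < l" "k < d i" "r = bstart d i + k"
  using bstart_ex[OF assms] by blast

lemma sum_bstart:
  fixes f :: "nat \<Rightarrow> 'a::comm_monoid_add"
  shows "(\<Sum>r<bstart d l. f r) = (\<Sum>i<l. \<Sum>k<d i. f (bstart d i + k))"
proof (induct l)
  case (Suc l)
  have "(\<Sum>r<bstart d l + m. f r) = (\<Sum>r<bstart d l. f r) + (\<Sum>k<m. f (bstart d l + k))" for m
    by (induct m) (simp_all add: add.assoc)
  then show ?case using Suc by simp
qed simp

definition block_diag :: "nat \<Rightarrow> (nat \<Rightarrow> complex mat) \<Rightarrow> complex mat" where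
  "block_diag l F = diag_block_mat (map F [0..<l])"

context
  fixes d :: "nat \<Rightarrow> nat" and F :: "nat \<Rightarrow> complex mat" and l :: nat
  assumes F: "\<And>i. i < l \<Longrightarrow> F i \<in> carrier_mat (d i) (d i)"
begin

lemma block_diag_Suc: "block_diag (Suc m) F = four_block_mat (block_diag m F) (0\<^sub>m (dim_row (block_diag m F))
    (dim_col (F m)))
    (0\<^sub>m (dim_row (F m)) (dim_col (block_diag m F))) (F m)"
  by (simp add: block_diag_def diag_block_mat_last Let_def)

lemma block_diag_carrier: "m \<le> l \<Longrightarrow> block_diag m F \<in> carrier_mat (bstart d m) (bstart d m)"
proof (induct m)
  case (Suc m)
  then show ?case unfolding block_diag_Suc using F[of m] by auto
qed (simp add: block_diag_def)

lemma block_diag_index: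
  assumes "m \<le> l" "i < m" "k < d i" "i' < m" "k' < d i'"
  shows "block_diag m F $$ (bstart d i + k, bstart d i' + k') = (if i = i' then F i $$ (k, k') else 0)"
  using assms
proof (induct m)
  case (Suc m)
  have c: "block_diag m F \<in> carrier_mat (bstart d m) (bstart d m)" "F m \<in> carrier_mat (d m) (d m)"
    using Suc(2) block_diag_carrier[of m] F[of m] by auto
  have lt: "bstart d i + k < bstart d m" if "i < m" using that Suc(4) by (rule bstart_less)
  have lt': "bstart d i' + k' < bstart d m" if "i' < m" using that Suc(6) by (rule bstart_less)
  have "i < m \<or> i = m" "i' < m \<or> i' = m" using Suc by auto
  then show ?case
    using c Suc lt lt' bstart_less[of i "Suc m" k d] bstart_less[of i' "Suc m" k' d]
    unfolding block_diag_Suc by (auto simp: index_mat_four_block)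
qed simp

lemma det_block_diag: "m \<le> l \<Longrightarrow> det (block_diag m F) = (\<Prod>i<m. det (F i))"
proof (induct m)
  case (Suc m)
  have c: "block_diag m F \<in> carrier_mat (bstart d m) (bstart d m)" "F m \<in> carrier_mat (d m) (d m)"
    using Suc(2) block_diag_carrier[of m] F[of m] by auto
  show ?case unfolding block_diag_Suc
    using c Suc by (subst det_four_block_mat_upper_right_zero[of _ "bstart d m" _ "d m"]) auto
qed (simp add: block_diag_def)

lemma mv_block_diag:
  assumes "i < l" "k < d i"
  shows "mv (block_diag l F) v (bstart d i + k) = mv (F i) (\<lambda>k'. v (bstart d i + k')) k"
proof -
  have dc: "dim_col (block_diag l F) = bstart d l" "dim_col (F i) = d i" using block_diag_carrier[of l] F[OF
      assms(1)] by auto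
  have "mv (block_diag l F) v (bstart d i + k) = (\<Sum>i'<l. \<Sum>k'<d i'. block_diag l F $$ (bstart d i + k, bstart d
      i' + k') * v (bstart d i' + k'))"
    unfolding mv_def dc by (rule sum_bstart)
  also have "\<dots> = (\<Sum>i'<l. if i' = i then (\<Sum>k'<d i. F i $$ (k, k') * v (bstart d i + k')) else 0)"
    using assms by (intro sum.cong refl) (auto simp: block_diag_index intro!: sum.cong)
  also have "\<dots> = (\<Sum>k'<d i. F i $$ (k, k') * v (bstart d i + k'))" using assms by simp
  finally show ?thesis unfolding mv_def dc .
qed

lemma block_diag_lower:
  assumes s: "s \<ge> 0" and blk: "\<And>i v. i < l \<Longrightarrow> s * nrm (d i) v \<le> nrm (d i) (mv (F i) v)"
  shows "s * nrm (bstart d l) v \<le> nrm (bstart d l) (mv (block_diag l F) v)"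
proof -
  have sq: "(nrm n u)\<^sup>2 = (\<Sum>k<n. (cmod (u k))\<^sup>2)" for n u
    by (simp add: L2_set_def sum_nonneg)
  have "(s * nrm (bstart d l) v)\<^sup>2 = (\<Sum>i<l. (s * nrm (d i) (\<lambda>k. v (bstart d i + k)))\<^sup>2)"
    unfolding power_mult_distrib sq sum_bstart by (simp add: sum_distrib_left)
  also have "\<dots> \<le> (\<Sum>i<l. (nrm (d i) (mv (F i) (\<lambda>k. v (bstart d i + k))))\<^sup>2)"
    using blk s by (intro sum_mono power_mono) auto
  also have "\<dots> = (nrm (bstart d l) (mv (block_diag l F) v))\<^sup>2"
    unfolding sq sum_bstart by (intro sum.cong refl) (simp add: mv_block_diag)
  finally show ?thesis by (rule power2_le_imp_le) simp
qed

end

section \<open>Multilinearity of the determinant in its rows\<close>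

lemma cofactor_cong:
  assumes "A \<in> carrier_mat n n" "B \<in> carrier_mat n n" "r < n" "j < n"
    and "\<And>i j. i < n \<Longrightarrow> j < n \<Longrightarrow> i \<noteq> r \<Longrightarrow> A $$ (i,j) = B $$ (i,j)"
  shows "cofactor A r j = cofactor B r j"
proof -
  have "mat_delete A r j = mat_delete B r j"
    using assms by (intro eq_matI) (auto simp: mat_delete_def)
  then show ?thesis by (simp add: cofactor_def)
qed

lemma det_row_split:
  assumes "A \<in> carrier_mat n n" "B \<in> carrier_mat n n" "C \<in> carrier_mat n n" "r < n"
    and "\<And>i j. i < n \<Longrightarrow> j < n \<Longrightarrow> i \<noteq> r \<Longrightarrow> A $$ (i,j) = C $$ (i,j) \<and> B $$ (i,j) = C $$ (i,j)"
    and "\<And>j. j < n \<Longrightarrow> C $$ (r,j) = A $$ (r,j) + B $$ (r,j)"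
  shows "det C = det A + (det B :: complex)"
proof -
  have c: "cofactor A r j = cofactor C r j" "cofactor B r j = cofactor C r j" if "j < n" for j
    using cofactor_cong[OF assms(1,3,4) that] cofactor_cong[OF assms(2,3,4) that] assms(5) by auto
  show ?thesis
    unfolding laplace_expansion_row[OF assms(1,4)] laplace_expansion_row[OF assms(2,4)] laplace_expansion_row[OF
        assms(3,4)]
      sum.distrib[symmetric]
    using c assms(6) by (intro sum.cong) (auto simp: algebra_simps)
qed

text \<open>Splitting one row doubles the number of determinants. The base matrix \<open>U\<close>
  is arbitrary in the induction, because the second half of each split has row \<open>r\<close> of
  \<open>U\<close> overwritten by that of \<open>V\<close>.\<close>

lemma det_expand_rows:
  fixes U V :: "nat \<Rightarrow> nat \<Rightarrow> complex"
  assumes "finite Q" "Q \<subseteq> {..<n}"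
    and "\<And>Q'. Q' \<subseteq> Q \<Longrightarrow> cmod (det (mat n n (\<lambda>(i,j). if i \<in> Q' then V i j else U i j))) \<le> B"
  shows "cmod (det (mat n n (\<lambda>(i,j). U i j + (if i \<in> Q then V i j else 0)))) \<le> 2 ^ card Q * B"
  using assms
proof (induct Q arbitrary: U rule: finite_induct)
  case empty
  then show ?case using empty(2)[of "{}"] by simp
next
  case (insert r Q)
  let ?M = "\<lambda>U. mat n n (\<lambda>(i,j). U i j + (if i \<in> Q then V i j else 0))"
  have 1: "cmod (det (?M U)) \<le> 2 ^ card Q * B"
    using insert by (intro insert(3)) auto
  have 2: "cmod (det (?M (U(r := V r)))) \<le> 2 ^ card Q * B"
  proof (rule insert(3))
    fix Q' assume Q': "Q' \<subseteq> Q"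
    have "(mat n n (\<lambda>(i,j). if i \<in> Q' then V i j else (U(r := V r)) i j))
       = mat n n (\<lambda>(i,j). if i \<in> Set.insert r Q' then V i j else U i j)"
      by (intro eq_matI) auto
    moreover have "Set.insert r Q' \<subseteq> Set.insert r Q" using Q' by auto
    ultimately show "cmod (det (mat n n (\<lambda>(i,j). if i \<in> Q' then V i j else (U(r := V r)) i j))) \<le> B"
      using insert(5)[of "Set.insert r Q'"] by simp
  qed (use insert in auto)
  have "det (mat n n (\<lambda>(i,j). U i j + (if i \<in> Set.insert r Q then V i j else 0))) = det (?M U) + det (?M (U(r :=
      V r)))"
    using insert by (intro det_row_split[of _ n _ _ r]) auto
  then have "cmod (det (mat n n (\<lambda>(i,j). U i j + (if i \<in> Set.insert r Q then V i j else 0))))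
     \<le> 2 ^ card Q * B + 2 ^ card Q * B"
    using norm_triangle_mono[OF 1 2] by simp
  moreover have "2 ^ card (Set.insert r Q) * B = 2 ^ card Q * B + 2 ^ card Q * B"
    using insert(1,2) by simp
  ultimately show ?case by (simp only:)
qed

definition blk :: "(nat \<Rightarrow> nat) \<Rightarrow> nat \<Rightarrow> nat" where
  "blk d r = (THE i. \<exists>k<d i. r = bstart d i + k)"

lemma blk_bstart [simp]: "k < d i \<Longrightarrow> blk d (bstart d i + k) = i"
  unfolding blk_def by (rule the_equality) (auto simp: bstart_inject)

lemma shifted_block_matrix:
  assumes "N = bstart d l"
  shows "z \<cdot>\<^sub>m 1\<^sub>m N - block_matrix l d c = block_diag l (\<lambda>i. cyc_block (d i) (\<lambda>_. z - c i) (\<lambda>_. 1) 0)"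
    and "block_matrix l d c \<in> carrier_mat N N"
proof -
  let ?J = "\<lambda>i. jordan_block (d i) (c i)"
  have J: "\<And>i. i < l \<Longrightarrow> ?J i \<in> carrier_mat (d i) (d i)" by simp
  have C: "\<And>i. i < l \<Longrightarrow> cyc_block (d i) (\<lambda>_. z - c i) (\<lambda>_. 1) 0 \<in> carrier_mat (d i) (d i)" by simp
  have eq: "block_matrix l d c = block_diag l ?J"
    by (simp add: block_matrix_def jordan_matrix_def block_diag_def comp_def)
  show car: "block_matrix l d c \<in> carrier_mat N N"
    unfolding eq assms using block_diag_carrier[OF J, of l] by simp
  have c2: "block_diag l (\<lambda>i. cyc_block (d i) (\<lambda>_. z - c i) (\<lambda>_. 1) 0) \<in> carrier_mat N N"
    unfolding assms using block_diag_carrier[OF C, of l] by simp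
  show "z \<cdot>\<^sub>m 1\<^sub>m N - block_matrix l d c = block_diag l (\<lambda>i. cyc_block (d i) (\<lambda>_. z - c i) (\<lambda>_. 1) 0)"
  proof (rule eq_matI)
    fix r r' assume "r < dim_row (block_diag l (\<lambda>i. cyc_block (d i) (\<lambda>_. z - c i) (\<lambda>_. 1) 0))"
      "r' < dim_col (block_diag l (\<lambda>i. cyc_block (d i) (\<lambda>_. z - c i) (\<lambda>_. 1) 0))"
    then have rr: "r < N" "r' < N" using c2 by auto
    obtain i k where i: "i < l" "k < d i" "r = bstart d i + k" using rr assms by (auto elim: bstart_cases)
    obtain i' k' where i': "i' < l" "k' < d i'" "r' = bstart d i' + k'" using rr assms by (auto elim:
        bstart_cases)
    have 1: "block_diag l (\<lambda>i. cyc_block (d i) (\<lambda>_. z - c i) (\<lambda>_. 1) 0) $$ (r, r') = (if i = i' then cyc_block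
        (d i) (\<lambda>_. z - c i) (\<lambda>_. 1) 0 $$ (k, k') else 0)"
      unfolding i(3) i'(3) by (rule block_diag_index[OF C]) (use i i' in auto)
    have 2: "block_matrix l d c $$ (r, r') = (if i = i' then ?J i $$ (k, k') else 0)"
      unfolding i(3) i'(3) eq by (rule block_diag_index[OF J]) (use i i' in auto)
    have 3: "r = r' \<longleftrightarrow> i = i' \<and> k = k'" using i i' by (simp add: bstart_inject)
    have "(z \<cdot>\<^sub>m 1\<^sub>m N - block_matrix l d c) $$ (r, r') = (if r = r' then z else 0) - block_matrix l d c $$ (r,
        r')"
      using rr car by auto
    then show "(z \<cdot>\<^sub>m 1\<^sub>m N - block_matrix l d c) $$ (r, r') = block_diag l (\<lambda>i. cyc_block (d i) (\<lambda>_. z - c i)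
        (\<lambda>_. 1) 0) $$ (r, r')"
      unfolding 1 2 3 using i i' by (auto simp: cyc_block_def)
  qed (use car c2 in auto)
qed

section \<open>Well-conditioned modifications of a shifted block matrix\<close>

locale block_split =
  fixes l :: nat and d :: "nat \<Rightarrow> nat" and w :: "nat \<Rightarrow> complex" and S Bad :: "nat set" and \<theta> \<tau> :: real
  assumes d_pos: "\<And>i. i < l \<Longrightarrow> d i > 0"
    and S_sub: "S \<subseteq> {..<l}" and Bad_sub: "Bad \<subseteq> {..<l}" and disj: "S \<inter> Bad = {}"
    and \<theta>: "0 < \<theta>" "\<theta> \<le> 1" and \<tau>: "0 < \<tau>" "\<tau> \<le> 1"
    and w_S: "\<And>i. i \<in> S \<Longrightarrow> cmod (w i) \<le> 1 - \<theta>"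
    and w_rest: "\<And>i. i < l \<Longrightarrow> i \<notin> S \<Longrightarrow> i \<notin> Bad \<Longrightarrow>
       cmod (w i) \<ge> 1 + \<theta> \<or> cmod (w i) \<le> 1 - \<theta> \<and> cmod (w i) ^ d i \<ge> \<tau>"
begin

definition "N = bstart d l"
definition "Q = (\<lambda>i. bstart d i + (d i - 1)) ` S \<union> (\<Union>i\<in>Bad. (\<lambda>k. bstart d i + k) ` {..<d i})"
text \<open>The column that receives the unit vector of row \<open>r\<close>: for a block in
  \<open>S\<close> the first column of the block, so that the entry in its last row is the corner of
  a cycle. On \<open>Q\<close> the map is injective, hence any other assignment of the same columns
  to the rows of \<open>Q\<close> is a permutation of this one.\<close>

definition "f0 r = (if blk d r \<in> S then bstart d (blk d r) else r)"
definition "A0 = block_diag l (\<lambda>i. cyc_block (d i) (\<lambda>_. w i) (\<lambda>_. 1) 0)"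

lemma A0_carrier: "A0 \<in> carrier_mat N N"
  unfolding A0_def N_def by (rule block_diag_carrier[where l=l]) simp_all

lemma finite_SB: "finite S" "finite Bad"
  using S_sub Bad_sub finite_subset by blast+

lemma finite_Q: "finite Q"
  using finite_SB by (auto simp: Q_def)

lemma Q_iff:
  assumes "i < l" "k < d i"
  shows "bstart d i + k \<in> Q \<longleftrightarrow> i \<in> S \<and> Suc k = d i \<or> i \<in> Bad"
proof -
  have 1: "bstart d i + k = bstart d i' + (d i' - 1) \<longleftrightarrow> i = i' \<and> k = d i' - 1" if "i' \<in> S" for i'
    using that S_sub d_pos[of i'] assms by (intro bstart_inject) auto
  have 2: "bstart d i + k = bstart d i' + k' \<longleftrightarrow> i = i' \<and> k = k'" if "k' < d i'" for i' k'
    using that assms by (intro bstart_inject) auto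
  have "bstart d i + k \<in> Q \<longleftrightarrow> (\<exists>i'\<in>S. bstart d i + k = bstart d i' + (d i' - 1)) \<or> (\<exists>i'\<in>Bad. \<exists>k'<d i'. bstart d i
      + k = bstart d i' + k')"
    unfolding Q_def by blast
  also have "(\<exists>i'\<in>S. bstart d i + k = bstart d i' + (d i' - 1)) \<longleftrightarrow> i \<in> S \<and> k = d i - 1"
    using 1 by blast
  also have "(\<exists>i'\<in>Bad. \<exists>k'<d i'. bstart d i + k = bstart d i' + k') \<longleftrightarrow> i \<in> Bad"
    using 2 assms by blast
  finally show ?thesis using assms by auto
qed

lemma Q_sub: "Q \<subseteq> {..<N}"
proof -
  have "bstart d i + (d i - 1) < bstart d l" if "i \<in> S" for i
    using that S_sub d_pos[of i] by (intro bstart_less) auto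
  moreover have "bstart d i + k < bstart d l" if "i \<in> Bad" "k < d i" for i k
    using that Bad_sub by (intro bstart_less) auto
  ultimately show ?thesis unfolding Q_def N_def by auto
qed

lemma f0_bstart: "i < l \<Longrightarrow> k < d i \<Longrightarrow> f0 (bstart d i + k) = (if i \<in> S then bstart d i else bstart d i + k)"
  by (simp add: f0_def)

lemma Q_cases:
  assumes "r \<in> Q"
  obtains i k where "i < l" "k < d i" "r = bstart d i + k" "i \<in> S \<and> Suc k = d i \<or> i \<in> Bad"
proof -
  have "r < bstart d l" using assms Q_sub by (auto simp: N_def)
  then obtain i k where "i < l" "k < d i" "r = bstart d i + k" by (rule bstart_cases)
  then show ?thesis using that Q_iff assms by blast
qed

lemma f0_less: "r < N \<Longrightarrow> f0 r < N"
  unfolding N_def by (erule bstart_cases) (use bstart_less d_pos in \<open>auto simp: f0_bstart intro: bstart_less[of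
      _ l 0, simplified]\<close>)

lemma f0_inj: "inj_on f0 Q"
proof (rule inj_onI)
  fix r r' assume "r \<in> Q" "r' \<in> Q" and eq: "f0 r = f0 r'"
  then obtain i k i' k' where i: "i < l" "k < d i" "r = bstart d i + k" "i \<in> S \<and> Suc k = d i \<or> i \<in> Bad"
    and i': "i' < l" "k' < d i'" "r' = bstart d i' + k'" "i' \<in> S \<and> Suc k' = d i' \<or> i' \<in> Bad"
    by (auto elim!: Q_cases)
  have "bstart d i + (if i \<in> S then 0 else k) = bstart d i' + (if i' \<in> S then 0 else k')"
    using eq i i' by (auto simp: f0_bstart)
  then have "i = i' \<and> (if i \<in> S then 0 else k) = (if i' \<in> S then 0 else k')"
    using i i' by (subst (asm) bstart_inject) auto
  then have "i = i' \<and> k = k'" using i i' disj by (auto split: if_splits)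
  then show "r = r'" using i i' by simp
qed

definition "nbad = (\<Sum>i\<in>Bad. d i)"

lemma card_Q: "card Q = card S + nbad"
proof -
  have "card Q = card ((\<lambda>i. bstart d i + (d i - 1)) ` S) + card (\<Union>i\<in>Bad. (\<lambda>k. bstart d i + k) ` {..<d i})"
    unfolding Q_def
  proof (rule card_Un_disjoint)
    show "(\<lambda>i. bstart d i + (d i - 1)) ` S \<inter> (\<Union>i\<in>Bad. (\<lambda>k. bstart d i + k) ` {..<d i}) = {}"
    proof -
      have False if "i \<in> S" "i' \<in> Bad" "k < d i'" "bstart d i + (d i - 1) = bstart d i' + k" for i i' k
      proof -
        have "d i - 1 < d i" using d_pos[of i] that S_sub by auto
        from bstart_inject[of "d i - 1" d i k i'] this that disj show False by auto
      qed
      then show ?thesis by auto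
    qed
  qed (use finite_SB in auto)
  also have "card ((\<lambda>i. bstart d i + (d i - 1)) ` S) = card S"
  proof (rule card_image, rule inj_onI)
    fix i i' assume "i \<in> S" "i' \<in> S" "bstart d i + (d i - 1) = bstart d i' + (d i' - 1)"
    moreover from this have "d i - 1 < d i" "d i' - 1 < d i'" using d_pos[of i] d_pos[of i'] S_sub by auto
    ultimately show "i = i'" using bstart_inject[of "d i - 1" d i "d i' - 1" i'] by simp
  qed
  also have "card (\<Union>i\<in>Bad. (\<lambda>k. bstart d i + k) ` {..<d i}) = (\<Sum>i\<in>Bad. card ((\<lambda>k. bstart d i + k) ` {..<d i}))"
  proof (rule card_UN_disjoint)
    show "\<forall>i\<in>Bad. \<forall>j\<in>Bad. i \<noteq> j \<longrightarrow> (\<lambda>k. bstart d i + k) ` {..<d i} \<inter> (\<lambda>k. bstart d j + k) ` {..<d j} = {}"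
      by (auto simp: bstart_inject)
  qed (use finite_SB in auto)
  also have "\<dots> = nbad" unfolding nbad_def by (intro sum.cong refl) (simp add: card_image)
  finally show ?thesis .
qed

text \<open>The modulus of the determinant of the blocks that are left untouched.\<close>

definition "prest = (\<Prod>i\<in>{..<l} - S - Bad. cmod (w i) ^ d i)"

text \<open>Row \<open>r\<close> of \<open>Ymat X m \<xi>\<close> is \<open>m r\<close> times row \<open>r\<close> of \<open>X\<close> plus \<open>\<xi> r\<close> times a unit vector: for a block
  in \<open>S\<close> the unit vector closes the block up to a cycle, for a block in \<open>Bad\<close> it sits on the diagonal.\<close>

definition "Ymat X m \<xi> = mat N N (\<lambda>(r,r'). m r * X $$ (r,r') + (if r' = f0 r then \<xi> r else 0))"

text \<open>These are the conditions under which every block of the modified matrix is well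
  conditioned: a cycle has determinant at least \<open>\<tau>\<close>, and in a block of
  \<open>Bad\<close> the diagonal exceeds the superdiagonal by \<open>a - b \<ge> 1\<close>. The
  pair \<open>(a, b)\<close> is \<open>(1, 0)\<close> for the lower bound, where all rows of
  \<open>Q\<close> become unit vectors, and \<open>(2, 1)\<close> for the upper bound, where some
  rows are kept.\<close>

definition admissible :: "(nat \<Rightarrow> complex) \<Rightarrow> (nat \<Rightarrow> complex) \<Rightarrow> real \<Rightarrow> real \<Rightarrow> bool" where
  "admissible m \<xi> a b \<longleftrightarrow> 0 \<le> b \<and> 1 \<le> a - b \<and> (\<forall>r. cmod (m r) \<le> 1) \<and> (\<forall>r. r \<notin> Q \<longrightarrow> m r = 1 \<and> \<xi> r = 0) \<and>
    (\<forall>i\<in>S. \<tau> \<le> cmod (m (bstart d i + (d i - 1)) * w i ^ d i + \<xi> (bstart d i + (d i - 1)))) \<and>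
    (\<forall>i\<in>Bad. \<forall>k<d i. cmod (m (bstart d i + k)) \<le> b \<and> a \<le> cmod (m (bstart d i + k) * w i + \<xi> (bstart d i + k)))"

definition Zblk :: "(nat \<Rightarrow> complex) \<Rightarrow> (nat \<Rightarrow> complex) \<Rightarrow> nat \<Rightarrow> complex mat" where
  "Zblk m \<xi> i = (if i \<in> Bad then cyc_block (d i) (\<lambda>k. m (bstart d i + k) * w i + \<xi> (bstart d i + k)) (\<lambda>k. m
      (bstart d i + k)) 0
     else if i \<in> S then cyc_block (d i) (\<lambda>k. if Suc k < d i then w i else m (bstart d i + (d i - 1)) * w i) (\<lambda>_.
         1) (\<xi> (bstart d i + (d i - 1)))
     else cyc_block (d i) (\<lambda>_. w i) (\<lambda>_. 1) 0)"

lemma Zblk_carrier: "Zblk m \<xi> i \<in> carrier_mat (d i) (d i)"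
  by (simp add: Zblk_def)

text \<open>Scaling row \<open>r\<close> and adding an entry in column \<open>f0 r\<close> stays
  inside the diagonal block of \<open>r\<close>, so the matrix remains block diagonal.\<close>

lemma Ymat_A0:
  assumes "admissible m \<xi> a b"
  shows "Ymat A0 m \<xi> = block_diag l (Zblk m \<xi>)"
proof -
  have c: "block_diag l (Zblk m \<xi>) \<in> carrier_mat N N"
    unfolding N_def by (rule block_diag_carrier[where l=l]) (simp_all add: Zblk_carrier)
  show ?thesis
  proof (rule eq_matI)
    fix r r' assume "r < dim_row (block_diag l (Zblk m \<xi>))" "r' < dim_col (block_diag l (Zblk m \<xi>))"
    then have rr: "r < N" "r' < N" using c by auto
    obtain i k where i: "i < l" "k < d i" "r = bstart d i + k" using rr by (auto simp: N_def elim: bstart_cases)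
    obtain i' k' where i': "i' < l" "k' < d i'" "r' = bstart d i' + k'" using rr by (auto simp: N_def elim:
        bstart_cases)
    have 1: "block_diag l (Zblk m \<xi>) $$ (r, r') = (if i = i' then Zblk m \<xi> i $$ (k, k') else 0)"
      unfolding i(3) i'(3) by (rule block_diag_index[OF Zblk_carrier]) (use i i' in auto)
    have 2: "A0 $$ (r, r') = (if i = i' then cyc_block (d i) (\<lambda>_. w i) (\<lambda>_. 1) 0 $$ (k, k') else 0)"
      unfolding i(3) i'(3) A0_def by (rule block_diag_index[OF cyc_block_carrier]) (use i i' in auto)
    have 3: "r' = f0 r \<longleftrightarrow> i = i' \<and> k' = (if i \<in> S then 0 else k)"
    proof -
      have "f0 r = bstart d i + (if i \<in> S then 0 else k)" using i by (simp add: f0_bstart)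
      moreover have "(if i \<in> S then 0 else k) < d i" using i by auto
      ultimately show ?thesis using bstart_inject[of k' d i' "if i \<in> S then 0 else k" i] i' by auto
    qed
    have m: "m r = 1 \<and> \<xi> r = 0" if "\<not> (i \<in> S \<and> Suc k = d i \<or> i \<in> Bad)"
      using assms that Q_iff[OF i(1,2)] i(3) by (auto simp: admissible_def)
    have last: "bstart d i + (d i - Suc 0) = r" if "Suc k = d i" using that i(3) by auto
    have "Ymat A0 m \<xi> $$ (r,r') = m r * A0 $$ (r,r') + (if r' = f0 r then \<xi> r else 0)"
      using rr by (simp add: Ymat_def)
    also have "\<dots> = (if i = i' then Zblk m \<xi> i $$ (k, k') else 0)"
    proof (cases "i = i'")
      case False then show ?thesis unfolding 2 3 by simp
    next
      case True
      then have k': "k' < d i" using i' by simp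
      consider "i \<in> Bad" | "i \<in> S" "i \<notin> Bad" "Suc k = d i" | "i \<in> S" "i \<notin> Bad" "Suc k < d i" | "i \<notin> S" "i \<notin> Bad"
        using i(2) by linarith
      then show ?thesis
      proof cases
        case 1
        then have "i \<notin> S" using disj by auto
        then show ?thesis unfolding 2 3 Zblk_def using 1 True i k' by (auto simp: cyc_block_def algebra_simps)
      next
        case 2
        then show ?thesis unfolding \<open>A0 $$ (r, r') = _\<close> 3 Zblk_def using True i k' last by (auto simp:
            cyc_block_def algebra_simps)
      next
        case 3
        then have "m r = 1 \<and> \<xi> r = 0" using m by auto
        then show ?thesis unfolding 2 Zblk_def using True i k' 3 by (auto simp: cyc_block_def algebra_simps)
      next
        case 4
        then have "m r = 1 \<and> \<xi> r = 0" using m by auto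
        then show ?thesis unfolding 2 Zblk_def using True i k' 4 by (auto simp: cyc_block_def algebra_simps)
      qed
    qed
    finally show "Ymat A0 m \<xi> $$ (r, r') = block_diag l (Zblk m \<xi>) $$ (r, r')" unfolding 1 .
  qed (use c in \<open>auto simp: Ymat_def\<close>)
qed

text \<open>The bound for a cycle from \<open>cyc_block_lower\<close>. It is below the bounds
  \<open>\<theta>\<close> and \<open>a - b\<close> for the dominated triangular blocks and hence
  serves all blocks.\<close>

definition "smin = \<theta>\<^sup>2 * \<tau> / 3"

lemma smin: "0 < smin" "smin \<le> \<theta>" "smin \<le> 1"
proof -
  have "\<theta>\<^sup>2 * \<tau> \<le> \<theta> * 1"
    unfolding power2_eq_square using \<theta> \<tau> by (intro mult_mono mult_left_le) auto
  then show "0 < smin" "smin \<le> \<theta>" "smin \<le> 1" using \<theta> \<tau> by (auto simp: smin_def)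
qed

lemma Z_lower:
  assumes "admissible m \<xi> a b"
  shows "smin * nrm N v \<le> nrm N (mv (Ymat A0 m \<xi>) v)"
  unfolding Ymat_A0[OF assms] N_def
proof (rule block_diag_lower)
  fix i v assume i: "i < l"
  have mono: "smin * nrm (d i) v \<le> x * nrm (d i) v" if "smin \<le> x" for x
    using that by (intro mult_right_mono) auto
  consider "i \<in> Bad" | "i \<in> S" "i \<notin> Bad" | "i \<notin> S" "i \<notin> Bad" by blast
  then show "smin * nrm (d i) v \<le> nrm (d i) (mv (Zblk m \<xi> i) v)"
  proof cases
    case 1
    have "(a - b) * nrm (d i) v \<le> nrm (d i) (mv (Zblk m \<xi> i) v)"
      unfolding Zblk_def using 1 assms by (simp, intro tri_block_lower) (auto simp: admissible_def)
    moreover have "smin \<le> a - b" using assms smin by (auto simp: admissible_def)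
    ultimately show ?thesis using mono by (meson order_trans)
  next
    case 2
    have "cmod (m (bstart d i + (d i - 1)) * w i) \<le> 1 * 1"
      unfolding norm_mult using assms w_S[OF 2(1)] \<theta> by (intro mult_mono) (auto simp: admissible_def)
    moreover have "w i ^ d i = w i * w i ^ (d i - 1)" using d_pos[OF i] by (simp add: power_eq_if)
    ultimately have "\<theta>\<^sup>2 * \<tau> / 3 * nrm (d i) v \<le> nrm (d i) (mv (cyc_block (d i)
        (\<lambda>k. if Suc k < d i then w i else m (bstart d i + (d i - 1)) * w i) (\<lambda>_. 1) (\<xi> (bstart d i + (d i -
            1)))) v)"
      using assms 2 by (intro cyc_block_lower d_pos[OF i] \<theta> \<tau> w_S) (auto simp: admissible_def mult.assoc)
    then show ?thesis using 2 by (simp add: smin_def Zblk_def)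
  next
    case 3
    from w_rest[OF i 3] show ?thesis
    proof
      assume "cmod (w i) \<ge> 1 + \<theta>"
      then have "((1 + \<theta>) - 1) * nrm (d i) v \<le> nrm (d i) (mv (Zblk m \<xi> i) v)"
        using tri_block_lower[of "d i" "1 + \<theta>" "\<lambda>_. w i" "\<lambda>_. 1" 1 v] 3 \<theta> by (simp add: Zblk_def)
      then show ?thesis using mono[OF smin(2)] by simp
    next
      assume *: "cmod (w i) \<le> 1 - \<theta> \<and> cmod (w i) ^ d i \<ge> \<tau>"
      have "w i ^ d i = w i * w i ^ (d i - 1)" using d_pos[OF i] by (simp add: power_eq_if)
      then have "cmod (w i * w i ^ (d i - 1) + 0) \<ge> \<tau>" using * by (metis add.right_neutral norm_power)
      with * have "\<theta>\<^sup>2 * \<tau> / 3 * nrm (d i) v \<le> nrm (d i) (mv (cyc_block (d i)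
        (\<lambda>k. if Suc k < d i then w i else w i) (\<lambda>_. 1) 0) v)"
        using \<theta> by (intro cyc_block_lower d_pos[OF i] \<theta> \<tau>) auto
      then show ?thesis using 3 by (simp add: smin_def Zblk_def)
    qed
  qed
qed (use smin Zblk_carrier in auto)

text \<open>Blockwise \<open>det_cyc_block\<close>: blocks in \<open>Bad\<close> have no corner and
  contribute their diagonal, a block in \<open>S\<close> contributes \<open>m * w i ^ d i\<close>
  from its diagonal and \<open>\<xi>\<close> from its corner.\<close>

lemma det_Z:
  assumes "admissible m \<xi> a b"
  shows "cmod (det (Ymat A0 m \<xi>)) = prest * (\<Prod>i\<in>S. cmod (m (bstart d i + (d i - 1)) * w i ^ d i + \<xi> (bstart d i
      + (d i - 1))))
     * (\<Prod>i\<in>Bad. \<Prod>k<d i. cmod (m (bstart d i + k) * w i + \<xi> (bstart d i + k)))"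
proof -
  have 1: "{..<l} = ({..<l} - S - Bad) \<union> S \<union> Bad" using S_sub Bad_sub by auto
  have "det (Ymat A0 m \<xi>) = (\<Prod>i<l. det (Zblk m \<xi> i))"
    unfolding Ymat_A0[OF assms] by (rule det_block_diag[where d=d and l=l]) (simp_all add: Zblk_carrier)
  then have "cmod (det (Ymat A0 m \<xi>)) = (\<Prod>i<l. cmod (det (Zblk m \<xi> i)))" by (simp add: prod_norm)
  also have "\<dots> = (\<Prod>i\<in>{..<l} - S - Bad. cmod (det (Zblk m \<xi> i))) * (\<Prod>i\<in>S. cmod (det (Zblk m \<xi> i))) * (\<Prod>i\<in>Bad.
      cmod (det (Zblk m \<xi> i)))"
  proof -
    have "(\<Prod>i<l. cmod (det (Zblk m \<xi> i))) = (\<Prod>i\<in>({..<l} - S - Bad) \<union> S \<union> Bad. cmod (det (Zblk m \<xi> i)))"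
      by (rule prod.cong[OF 1 refl])
    also have "\<dots> = (\<Prod>i\<in>({..<l} - S - Bad) \<union> S. cmod (det (Zblk m \<xi> i))) * (\<Prod>i\<in>Bad. cmod (det (Zblk m \<xi> i)))"
      using finite_SB disj by (intro prod.union_disjoint) auto
    also have "(\<Prod>i\<in>({..<l} - S - Bad) \<union> S. cmod (det (Zblk m \<xi> i)))
       = (\<Prod>i\<in>{..<l} - S - Bad. cmod (det (Zblk m \<xi> i))) * (\<Prod>i\<in>S. cmod (det (Zblk m \<xi> i)))"
      using finite_SB by (intro prod.union_disjoint) auto
    finally show ?thesis .
  qed
  also have "(\<Prod>i\<in>{..<l} - S - Bad. cmod (det (Zblk m \<xi> i))) = prest"
    unfolding prest_def by (intro prod.cong) (auto simp: Zblk_def det_cyc_block d_pos norm_power)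
  also have "(\<Prod>i\<in>S. cmod (det (Zblk m \<xi> i))) = (\<Prod>i\<in>S. cmod (m (bstart d i + (d i - 1)) * w i ^ d i + \<xi> (bstart d
      i + (d i - 1))))"
  proof (intro prod.cong refl arg_cong[where f=cmod])
    fix i assume i: "i \<in> S"
    then have n: "d i > 0" "i \<notin> Bad" using d_pos S_sub disj by auto
    then obtain n where n': "d i = Suc n" by (cases "d i") auto
    have "(\<Prod>k<d i. if Suc k < d i then w i else m (bstart d i + (d i - 1)) * w i) = w i ^ n * (m (bstart d i +
        (d i - 1)) * w i)"
      unfolding n' by simp
    then show "det (Zblk m \<xi> i) = m (bstart d i + (d i - 1)) * w i ^ d i + \<xi> (bstart d i + (d i - 1))"
      using i n by (simp add: Zblk_def det_cyc_block n' mult_ac)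
  qed
  also have "(\<Prod>i\<in>Bad. cmod (det (Zblk m \<xi> i))) = (\<Prod>i\<in>Bad. \<Prod>k<d i. cmod (m (bstart d i + k) * w i + \<xi> (bstart d i
      + k)))"
    using Bad_sub by (intro prod.cong refl) (auto simp: Zblk_def det_cyc_block d_pos prod_norm subset_iff)
  finally show ?thesis .
qed

text \<open>The perturbation of row \<open>r\<close> is scaled by \<open>m r\<close>, of modulus at
  most 1, so its norm does not grow. The relation between \<open>X\<close> and \<open>A0 + H\<close>
  is required only after multiplication by \<open>m r\<close>: rows with \<open>m r = 0\<close> are
  free, which the lower bound exploits.\<close>

lemma det_Ymat_bounds:
  assumes admissible: "admissible m \<xi> a b" and H: "H \<in> carrier_mat N N" and \<kappa>: "0 \<le> \<kappa>" "\<kappa> < 1"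
    and Hb: "\<And>v. nrm N (mv H v) \<le> \<kappa> * smin * nrm N v"
    and X: "X \<in> carrier_mat N N" "\<And>r r'. r < N \<Longrightarrow> r' < N \<Longrightarrow> m r * X $$ (r,r') = m r * (A0 $$ (r,r') + H $$
        (r,r'))"
  shows "cmod (det (Ymat A0 m \<xi>)) * (1 - \<kappa>) ^ N \<le> cmod (det (Ymat X m \<xi>))"
    and "cmod (det (Ymat X m \<xi>)) \<le> cmod (det (Ymat A0 m \<xi>)) * (1 + \<kappa>) ^ N"
proof -
  define E where "E = mat N N (\<lambda>(r,r'). m r * H $$ (r,r'))"
  have Y: "Ymat X m \<xi> = Ymat A0 m \<xi> + E"
    using X A0_carrier by (intro eq_matI) (auto simp: Ymat_def E_def algebra_simps)
  have Eb: "nrm N (mv E v) \<le> \<kappa> * smin * nrm N v" for v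
  proof -
    have "nrm N (mv E v) \<le> nrm N (mv H v)"
    proof (rule L2_set_mono)
      fix r assume "r \<in> {..<N}"
      then have "mv E v r = m r * mv H v r" using H by (auto simp: mv_def E_def sum_distrib_left mult.assoc
          intro!: sum.cong)
      moreover have "cmod (m r) \<le> 1" using admissible by (simp add: admissible_def)
      ultimately show "cmod (mv E v r) \<le> cmod (mv H v r)" by (simp add: norm_mult mult_left_le_one_le)
    qed simp
    then show ?thesis using Hb order_trans by blast
  qed
  have c: "Ymat A0 m \<xi> \<in> carrier_mat N N" "E \<in> carrier_mat N N" by (auto simp: Ymat_def E_def)
  show "cmod (det (Ymat A0 m \<xi>)) * (1 - \<kappa>) ^ N \<le> cmod (det (Ymat X m \<xi>))"
    "cmod (det (Ymat X m \<xi>)) \<le> cmod (det (Ymat A0 m \<xi>)) * (1 + \<kappa>) ^ N"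
    unfolding Y by (rule det_perturb[OF c smin(1) \<kappa> Z_lower[OF admissible] Eb])+
qed

text \<open>With unit vectors in all rows of \<open>Q\<close> the factors of \<open>S\<close> and
  \<open>Bad\<close> in \<open>det_Z\<close> are 1 and only \<open>prest\<close> remains. Rows of
  \<open>X\<close> in \<open>Q\<close> do not occur, so their noise may still be random. The
  bijection \<open>f\<close> is arbitrary because integrating out the rows one at a time ends with
  every assignment of the columns.\<close>

lemma lower_det:
  assumes H: "H \<in> carrier_mat N N" and \<kappa>: "0 \<le> \<kappa>" "\<kappa> < 1"
    and Hb: "\<And>v. nrm N (mv H v) \<le> \<kappa> * smin * nrm N v"
    and X: "X \<in> carrier_mat N N" "\<And>r r'. r < N \<Longrightarrow> r' < N \<Longrightarrow> r \<notin> Q \<Longrightarrow> X $$ (r,r') = A0 $$ (r,r') + H $$ (r,r')"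
    and f: "bij_betw f Q (f0 ` Q)"
  shows "prest * (1 - \<kappa>) ^ N \<le> cmod (det (mat N N (\<lambda>(r,r'). if r \<in> Q then (if r' = f r then 1 else 0) else X $$
      (r,r'))))"
proof -
  define m where "m = (\<lambda>r. if r \<in> Q then 0 else 1 :: complex)"
  define \<xi> where "\<xi> = (\<lambda>r. if r \<in> Q then 1 else 0 :: complex)"
  have inQ: "bstart d i + (d i - Suc 0) \<in> Q" if "i \<in> S" for i using that by (auto simp: Q_def)
  have inQ': "bstart d i + k \<in> Q" if "i \<in> Bad" "k < d i" for i k using that by (auto simp: Q_def)
  have admissible: "admissible m \<xi> 1 0" using \<tau> by (auto simp: admissible_def m_def \<xi>_def inQ inQ')
  have Xm: "m r * X $$ (r,r') = m r * (A0 $$ (r,r') + H $$ (r,r'))" if "r < N" "r' < N" for r r'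
    using X(2)[OF that] by (simp add: m_def)
  have "cmod (det (Ymat A0 m \<xi>)) = prest"
  proof -
    have "(\<Prod>i\<in>Bad. \<Prod>k<d i. cmod (m (bstart d i + k) * w i + \<xi> (bstart d i + k))) = 1"
      by (intro prod.neutral ballI) (simp add: m_def \<xi>_def inQ')
    moreover have "(\<Prod>i\<in>S. cmod (m (bstart d i + (d i - 1)) * w i ^ d i + \<xi> (bstart d i + (d i - 1)))) = 1"
      by (intro prod.neutral ballI) (simp add: m_def \<xi>_def inQ)
    ultimately show ?thesis unfolding det_Z[OF admissible] by simp
  qed
  then have 1: "prest * (1 - \<kappa>) ^ N \<le> cmod (det (Ymat X m \<xi>))"
    using det_Ymat_bounds(1)[OF admissible H \<kappa> Hb X(1) Xm] by simp
  \<comment> \<open>The row permutation with \<open>f0 (p r) = f r\<close> on \<open>Q\<close>: row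
    \<open>r\<close> of the matrix with \<open>f\<close> is row \<open>p r\<close> of the one with
    \<open>f0\<close>, so the determinants differ by a sign at most.\<close>
  define p where "p = (\<lambda>r. if r \<in> Q then inv_into Q f0 (f r) else r)"
  have f0p: "f0 (p r) = f r" if "r \<in> Q" for r
    using that f by (auto simp: p_def bij_betw_def intro!: f_inv_into_f)
  have pQ: "p r \<in> Q" if "r \<in> Q" for r
    using that f by (auto simp: p_def bij_betw_def intro!: inv_into_into)
  have "bij_betw (\<lambda>r. inv_into Q f0 (f r)) Q Q"
    using bij_betw_trans[OF f bij_betw_inv_into[OF inj_on_imp_bij_betw[OF f0_inj]]] by (simp add: comp_def)
  then have "bij_betw p Q Q" by (rule bij_betw_cong[THEN iffD1, rotated]) (simp add: p_def)
  moreover have "bij_betw p ({0..<N} - Q) ({0..<N} - Q)"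
    by (rule bij_betw_cong[THEN iffD1, OF _ bij_betw_id]) (simp add: p_def)
  ultimately have "bij_betw p (Q \<union> ({0..<N} - Q)) (Q \<union> ({0..<N} - Q))"
    by (rule bij_betw_combine) auto
  moreover have "Q \<union> ({0..<N} - Q) = {0..<N}" using Q_sub by auto
  ultimately have perm: "p permutes {0..<N}"
    using Q_sub by (intro bij_imp_permutes) (auto simp: p_def)
  have "mat N N (\<lambda>(r,r'). if r \<in> Q then (if r' = f r then 1 else 0) else X $$ (r,r')) = mat N N (\<lambda>(r,r'). Ymat X
      m \<xi> $$ (p r, r'))"
  proof (rule eq_matI)
    fix r r' assume "r < dim_row (mat N N (\<lambda>(r,r'). Ymat X m \<xi> $$ (p r, r')))" "r' < dim_col (mat N N (\<lambda>(r,r').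
        Ymat X m \<xi> $$ (p r, r')))"
    then have r: "r < N" "r' < N" by auto
    then have "p r < N" using permutes_in_image[OF perm, of r] by simp
    then have "Ymat X m \<xi> $$ (p r, r') = m (p r) * X $$ (p r, r') + (if r' = f0 (p r) then \<xi> (p r) else 0)"
      using r by (simp add: Ymat_def)
    also have "\<dots> = (if r \<in> Q then (if r' = f r then 1 else 0) else X $$ (r,r'))"
      using f0p[of r] pQ[of r] by (auto simp: m_def \<xi>_def p_def)
    finally show "mat N N (\<lambda>(r,r'). if r \<in> Q then (if r' = f r then 1 else 0) else X $$ (r,r')) $$ (r, r')
       = mat N N (\<lambda>(r,r'). Ymat X m \<xi> $$ (p r, r')) $$ (r, r')"
      using r by simp
  qed auto
  then have "cmod (det (mat N N (\<lambda>(r,r'). if r \<in> Q then (if r' = f r then 1 else 0) else X $$ (r,r')))) = cmod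
      (det (Ymat X m \<xi>))"
    using det_permute_rows[of "Ymat X m \<xi>" N p] perm by (auto simp: Ymat_def norm_mult sign_def)
  then show ?thesis using 1 by simp
qed

text \<open>Each row in \<open>Q\<close> is the sum of \<open>U\<close>, the row plus
  \<open>\<zeta>\<close> times a unit vector, and \<open>V\<close>, minus \<open>\<zeta>\<close>
  times that vector. The value \<open>\<zeta>\<close> is such that each of the
  \<open>2 ^ card Q\<close> choices is admissible, whichever rows are kept: the cycles have
  determinant between \<open>\<tau>\<close> and \<open>2 * \<tau>\<close>, the diagonals in
  \<open>Bad\<close> have modulus between 2 and 6.\<close>

lemma upper_det:
  assumes H: "H \<in> carrier_mat N N" and \<kappa>: "0 \<le> \<kappa>" "\<kappa> < 1"
    and Hb: "\<And>v. nrm N (mv H v) \<le> \<kappa> * smin * nrm N v"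
    and wS: "\<And>i. i \<in> S \<Longrightarrow> cmod (w i) ^ d i \<le> \<tau>" and wB: "\<And>i. i \<in> Bad \<Longrightarrow> cmod (w i) \<le> 2"
  shows "cmod (det (A0 + H)) \<le> 2 ^ card Q * (prest * (2 * \<tau>) ^ card S * 6 ^ nbad * (1 + \<kappa>) ^ N)"
proof -
  \<comment> \<open>A number of modulus \<open>\<tau>\<close> in the direction of
    \<open>w i ^ d i\<close>, so that the two add without cancellation.\<close>
  define ph where "ph = (\<lambda>i. if w i ^ d i = 0 then of_real \<tau> else of_real (\<tau> / cmod (w i ^ d i)) * w i ^ d i)"
  have ph: "cmod (ph i) = \<tau>" "cmod (w i ^ d i + ph i) = cmod (w i) ^ d i + \<tau>" for i
  proof -
    show "cmod (ph i) = \<tau>" using \<tau> by (simp add: ph_def norm_mult norm_divide norm_power)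
    show "cmod (w i ^ d i + ph i) = cmod (w i) ^ d i + \<tau>"
    proof (cases "w i ^ d i = 0")
      case True
      then have p: "ph i = of_real \<tau>" by (simp add: ph_def)
      have "cmod (w i) ^ d i = 0" using True by (metis norm_power norm_zero)
      then show ?thesis unfolding p True using \<tau> by simp
    next
      case False
      then have "w i ^ d i + ph i = of_real (1 + \<tau> / cmod (w i ^ d i)) * w i ^ d i" by (simp add: ph_def
          algebra_simps)
      then have "cmod (w i ^ d i + ph i) = \<bar>1 + \<tau> / cmod (w i ^ d i)\<bar> * cmod (w i ^ d i)" by (simp only:
          norm_mult norm_of_real)
      also have "\<dots> = cmod (w i ^ d i) + \<tau>" using \<tau> False by (simp add: field_simps)
      finally show ?thesis by (simp add: norm_power)
    qed
  qed
  \<comment> \<open>Since \<open>cmod (w i) \<le> 2\<close> on \<open>Bad\<close>, adding 4 keeps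
    the diagonal between 2 and 6 in modulus; the superdiagonal is at most 1.\<close>
  define \<zeta> where "\<zeta> = (\<lambda>r. if blk d r \<in> S then ph (blk d r) else 4)"
  let ?X = "A0 + H"
  let ?B = "prest * (2 * \<tau>) ^ card S * 6 ^ nbad * (1 + \<kappa>) ^ N"
  let ?V = "\<lambda>r r'. if r' = f0 r then - \<zeta> r else 0"
  let ?U = "\<lambda>r r'. ?X $$ (r,r') - (if r \<in> Q then ?V r r' else 0)"
  have Xc: "?X \<in> carrier_mat N N" using H A0_carrier by auto
  have bS: "blk d (bstart d i + (d i - Suc 0)) = i" if "i \<in> S" for i
    using that S_sub d_pos[of i] by (intro blk_bstart) auto
  have SBad: "i \<notin> S" if "i \<in> Bad" for i using that disj by auto
  have "cmod (det (mat N N (\<lambda>(r,r'). ?U r r' + (if r \<in> Q then ?V r r' else 0)))) \<le> 2 ^ card Q * ?B"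
  proof (rule det_expand_rows[OF finite_Q Q_sub])
    fix Q' assume Q': "Q' \<subseteq> Q"
    define m where "m = (\<lambda>r. if r \<in> Q' then 0 else 1 :: complex)"
    define \<xi> where "\<xi> = (\<lambda>r. if r \<in> Q' then - \<zeta> r else if r \<in> Q then \<zeta> r else 0)"
    have inQ: "bstart d i + (d i - Suc 0) \<in> Q" if "i \<in> S" for i using that by (auto simp: Q_def)
    have inQ': "bstart d i + k \<in> Q" if "i \<in> Bad" "k < d i" for i k using that by (auto simp: Q_def)
    have Sb: "\<tau> \<le> cmod (m (bstart d i + (d i - 1)) * w i ^ d i + \<xi> (bstart d i + (d i - 1)))"
       "cmod (m (bstart d i + (d i - 1)) * w i ^ d i + \<xi> (bstart d i + (d i - 1))) \<le> 2 * \<tau>" if i: "i \<in> S" for i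
      using ph[of i] wS[OF i] i bS[OF i] inQ[OF i] \<tau> by (auto simp: m_def \<xi>_def \<zeta>_def)
    have w4: "2 \<le> cmod (w i + 4)" "cmod (w i + 4) \<le> 6" if "i \<in> Bad" for i
      using wB[OF that] norm_triangle_ineq[of "w i" 4] norm_triangle_ineq2[of 4 "- w i"] by (auto simp:
          add.commute)
    have Bb: "2 \<le> cmod (m (bstart d i + k) * w i + \<xi> (bstart d i + k))"
       "cmod (m (bstart d i + k) * w i + \<xi> (bstart d i + k)) \<le> 6" if i: "i \<in> Bad" "k < d i" for i k
      using w4[OF i(1)] inQ'[OF i] SBad[OF i(1)] i by (auto simp: m_def \<xi>_def \<zeta>_def)
    have admissible: "admissible m \<xi> 2 1"
      unfolding admissible_def using Sb Bb Q' by (auto simp: m_def \<xi>_def)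
    have Xm: "m r * ?X $$ (r,r') = m r * (A0 $$ (r,r') + H $$ (r,r'))" if "r < N" "r' < N" for r r'
      using that H A0_carrier by simp
    have eq: "mat N N (\<lambda>(r,r'). if r \<in> Q' then ?V r r' else ?U r r') = Ymat ?X m \<xi>"
      using Q' by (intro eq_matI) (auto simp: Ymat_def m_def \<xi>_def)
    have "cmod (det (Ymat ?X m \<xi>)) \<le> cmod (det (Ymat A0 m \<xi>)) * (1 + \<kappa>) ^ N"
      by (rule det_Ymat_bounds(2)[OF admissible H \<kappa> Hb Xc Xm])
    also have "cmod (det (Ymat A0 m \<xi>)) \<le> prest * (2 * \<tau>) ^ card S * 6 ^ nbad"
      unfolding det_Z[OF admissible]
    proof (intro mult_mono mult_nonneg_nonneg)
      show "0 \<le> prest" "0 \<le> prest" by (simp_all add: prest_def prod_nonneg)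
      show "(\<Prod>i\<in>S. cmod (m (bstart d i + (d i - 1)) * w i ^ d i + \<xi> (bstart d i + (d i - 1)))) \<le> (2 * \<tau>) ^ card
          S"
        using prod_mono[of S _ "\<lambda>_. 2 * \<tau>"] Sb by (simp add: prod_constant[symmetric] del: prod_constant)
      have "(\<Prod>i\<in>Bad. \<Prod>k<d i. cmod (m (bstart d i + k) * w i + \<xi> (bstart d i + k))) \<le> (\<Prod>i\<in>Bad. \<Prod>k<d i. 6)"
        using Bb by (intro prod_mono conjI prod_nonneg) auto
      also have "\<dots> = 6 ^ nbad" by (simp add: nbad_def power_sum)
      finally show "(\<Prod>i\<in>Bad. \<Prod>k<d i. cmod (m (bstart d i + k) * w i + \<xi> (bstart d i + k))) \<le> 6 ^ nbad" .
    qed (use \<tau> in \<open>auto intro!: prod_nonneg\<close>)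
    finally show "cmod (det (mat N N (\<lambda>(r,r'). if r \<in> Q' then ?V r r' else ?U r r'))) \<le> ?B"
      unfolding eq using \<kappa> by (simp add: mult_right_mono)
  qed
  also have "mat N N (\<lambda>(r,r'). ?U r r' + (if r \<in> Q then ?V r r' else 0)) = ?X"
    by (rule eq_matI) (use carrier_matD[OF H] carrier_matD[OF A0_carrier] in auto)
  finally show ?thesis .
qed

end

section \<open>Negative moments of determinants with Gaussian rows\<close>

lemma borel_measurable_det:
  fixes F :: "'a \<Rightarrow> nat \<Rightarrow> nat \<Rightarrow> complex"
  assumes "\<And>i j. i < n \<Longrightarrow> j < n \<Longrightarrow> (\<lambda>x. F x i j) \<in> borel_measurable M"
  shows "(\<lambda>x. det (mat n n (\<lambda>(i,j). F x i j))) \<in> borel_measurable M"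
proof -
  have pl: "p i < n" if "p permutes {0..<n}" "i < n" for p i
    using permutes_in_image[OF that(1), of i] that(2) by simp
  have "det (mat n n (\<lambda>(i,j). F x i j)) = (\<Sum>p\<in>{p. p permutes {0..<n}}. signof p * (\<Prod>i = 0..<n. F x i (p i)))"
      for x
    unfolding det_def by (auto intro!: sum.cong prod.cong simp: pl)
  moreover have "(\<lambda>x. \<Sum>p\<in>{p. p permutes {0..<n}}. signof p * (\<Prod>i = 0..<n. F x i (p i))) \<in> borel_measurable M"
    using assms by (intro borel_measurable_sum borel_measurable_times borel_measurable_prod
        borel_measurable_const) (auto simp: pl)
  ultimately show ?thesis by simp
qed

text \<open>The value at 0 is infinite, since \<open>0 powr (-1/2) = 0\<close> would destroy
  monotonicity at singular matrices. The exponent -1/2 exceeds -1, so the function is integrable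
  against a bounded density on the line.\<close>

definition qf :: "complex \<Rightarrow> ennreal" where
  "qf x = (if x = 0 then \<top> else ennreal (cmod x powr (-1/2)))"

lemma borel_measurable_qf [measurable]: "qf \<in> borel_measurable borel"
  unfolding qf_def[abs_def] by measurable

lemma qf_mult: "s \<noteq> 0 \<Longrightarrow> qf (s * x) = ennreal (cmod s powr (-1/2)) * qf x"
  by (auto simp: qf_def norm_mult powr_mult ennreal_mult ennreal_mult_top)

lemma qf_antimono: "cmod x \<le> cmod y \<Longrightarrow> qf y \<le> qf x"
  by (auto simp: qf_def intro!: ennreal_leI powr_mono2')

lemma qf_le: "0 < B \<Longrightarrow> B \<le> cmod x \<Longrightarrow> qf x \<le> ennreal (B powr (-1/2))"
  by (auto simp: qf_def intro!: ennreal_leI powr_mono2')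

definition stdn :: "real measure" where
  "stdn = density lborel (\<lambda>x. ennreal (std_normal_density x))"

lemma sets_stdn [simp, measurable_cong]: "sets stdn = sets borel"
  and space_stdn [simp]: "space stdn = UNIV"
  by (simp_all add: stdn_def)

lemma prob_space_stdn: "prob_space stdn"
  unfolding stdn_def using prob_space_normal_density[of 1 0] by simp

lemma product_prob_space_stdn: "product_prob_space (\<lambda>_. stdn)"
proof -
  interpret prob_space stdn by (rule prob_space_stdn)
  show ?thesis by standard
qed

lemma nn_integral_powr_half:
  assumes "\<sigma> > 0"
  shows "(\<integral>\<^sup>+x. ennreal (indicator {-\<sigma>..\<sigma>} x * \<bar>x\<bar> powr (-1/2)) \<partial>lborel) \<le> ennreal (4 * \<sigma> powr (1/2))"
proof -
  let ?f = "\<lambda>x::real. ennreal (indicator {0..\<sigma>} x * x powr (-1/2))"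
  have "((\<lambda>x. x powr (-1/2)) has_integral (\<sigma> powr (-1/2 + 1) / (-1/2 + 1))) {0..\<sigma>}"
    using assms by (intro has_integral_powr_from_0) auto
  moreover have "(\<lambda>x. indicator {0..\<sigma>} x * x powr (-1/2)) = (\<lambda>x. if x \<in> {0..\<sigma>} then x powr (-1/2) else 0)"
    by (auto simp: fun_eq_iff indicator_def)
  ultimately have "((\<lambda>x. indicator {0..\<sigma>} x * x powr (-1/2)) has_integral (2 * \<sigma> powr (1/2))) UNIV"
    using has_integral_restrict_UNIV[of "{0..\<sigma>}" "\<lambda>x. x powr (-1/2)" "2 * \<sigma> powr (1/2)"] by (simp add:
        mult.commute)
  then have 1: "(\<integral>\<^sup>+x. ?f x \<partial>lborel) = ennreal (2 * \<sigma> powr (1/2))"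
    by (intro nn_integral_has_integral_lborel) auto
  have 2: "(\<integral>\<^sup>+x. ?f (- x) \<partial>lborel) = (\<integral>\<^sup>+x. ?f x \<partial>lborel)"
    using nn_integral_real_affine[of ?f "-1" 0] by simp
  have "(\<integral>\<^sup>+x. ennreal (indicator {-\<sigma>..\<sigma>} x * \<bar>x\<bar> powr (-1/2)) \<partial>lborel) \<le> (\<integral>\<^sup>+x. ?f x + ?f (- x) \<partial>lborel)"
    by (intro nn_integral_mono) (auto simp: indicator_def abs_if)
  also have "\<dots> = (\<integral>\<^sup>+x. ?f x \<partial>lborel) + (\<integral>\<^sup>+x. ?f (- x) \<partial>lborel)"
    by (rule nn_integral_add) measurable
  also have "\<dots> = ennreal (4 * \<sigma> powr (1/2))"
    unfolding 2 1 by (simp flip: ennreal_plus)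
  finally show ?thesis .
qed

text \<open>The bound does not depend on the mean. On the interval from \<open>- \<sigma>\<close> to
  \<open>\<sigma>\<close> the density is at most \<open>1 / (2 * \<sigma>)\<close>, which
  contributes \<open>2 * \<sigma> powr (-1/2)\<close>; outside, the power itself is at most
  \<open>\<sigma> powr (-1/2)\<close>.\<close>

lemma normal_negative_moment:
  assumes \<sigma>: "\<sigma> > 0"
  shows "(\<integral>\<^sup>+x. qf (of_real x) * ennreal (normal_density m \<sigma> x) \<partial>lborel) \<le> ennreal (3 * \<sigma> powr (-1/2))"
proof -
  interpret prob_space "density lborel (\<lambda>x. ennreal (normal_density m \<sigma> x))"
    by (rule prob_space_normal_density[OF \<sigma>])
  have one: "(\<integral>\<^sup>+x. ennreal (normal_density m \<sigma> x) \<partial>lborel) = 1"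
    using emeasure_space_1 by (simp add: emeasure_density)
  have nd: "normal_density m \<sigma> x \<le> 1 / (2 * \<sigma>)" for x
  proof -
    have "2 * \<sigma> \<le> sqrt (2 * pi * \<sigma>\<^sup>2)"
    proof (rule real_le_rsqrt)
      have "4 * \<sigma>\<^sup>2 \<le> 2 * pi * \<sigma>\<^sup>2" using pi_gt3 by (intro mult_right_mono) auto
      then show "(2 * \<sigma>)\<^sup>2 \<le> 2 * pi * \<sigma>\<^sup>2" by (simp add: power_mult_distrib)
    qed
    then have "1 / sqrt (2 * pi * \<sigma>\<^sup>2) * exp (-(x - m)\<^sup>2 / (2 * \<sigma>\<^sup>2)) \<le> 1 / (2 * \<sigma>) * 1"
      using \<sigma> by (intro mult_mono) (auto intro!: divide_left_mono)
    then show ?thesis by (simp add: normal_density_def)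
  qed
  let ?g = "\<lambda>x. ennreal (indicator {-\<sigma>..\<sigma>} x * \<bar>x\<bar> powr (-1/2))"
  have "(\<integral>\<^sup>+x. qf (of_real x) * ennreal (normal_density m \<sigma> x) \<partial>lborel)
     \<le> (\<integral>\<^sup>+x. ennreal (1 / (2 * \<sigma>)) * ?g x + ennreal (\<sigma> powr (-1/2)) * ennreal (normal_density m \<sigma> x) \<partial>lborel)"
  proof (rule nn_integral_mono_AE)
    have "AE x in lborel. x \<noteq> (0::real)" by (rule AE_lborel_singleton)
    then show "AE x in lborel. qf (of_real x) * ennreal (normal_density m \<sigma> x)
      \<le> ennreal (1 / (2 * \<sigma>)) * ?g x + ennreal (\<sigma> powr (-1/2)) * ennreal (normal_density m \<sigma> x)"
    proof eventually_elim
      case (elim x)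
      have n0: "0 \<le> normal_density m \<sigma> x" by (rule normal_density_nonneg)
      have "\<bar>x\<bar> powr (-1/2) * normal_density m \<sigma> x \<le> 1 / (2 * \<sigma>) * (indicator {-\<sigma>..\<sigma>} x * \<bar>x\<bar> powr (-1/2)) + \<sigma>
          powr (-1/2) * normal_density m \<sigma> x"
      proof (cases "\<bar>x\<bar> \<le> \<sigma>")
        case True
        then have "indicator {-\<sigma>..\<sigma>} x = (1::real)" by (auto simp: indicator_def)
        moreover have "\<bar>x\<bar> powr (-1/2) * normal_density m \<sigma> x \<le> \<bar>x\<bar> powr (-1/2) * (1 / (2 * \<sigma>))"
          using nd by (intro mult_left_mono) auto
        ultimately show ?thesis using n0 by (simp add: mult.commute add_increasing2)
      next
        case False
        then have "\<bar>x\<bar> powr (-1/2) \<le> \<sigma> powr (-1/2)" using \<sigma> by (intro powr_mono2') auto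
        then have "\<bar>x\<bar> powr (-1/2) * normal_density m \<sigma> x \<le> \<sigma> powr (-1/2) * normal_density m \<sigma> x"
          using n0 by (rule mult_right_mono)
        moreover have "0 \<le> 1 / (2 * \<sigma>) * (indicator {-\<sigma>..\<sigma>} x * \<bar>x\<bar> powr (-1/2))" using \<sigma> by simp
        ultimately show ?thesis by linarith
      qed
      moreover have "qf (of_real x) = ennreal (\<bar>x\<bar> powr (-1/2))" using elim by (simp add: qf_def)
      ultimately show ?case using n0 \<sigma>
        by (simp add: ennreal_mult[symmetric] ennreal_plus[symmetric] ennreal_leI del: ennreal_plus)
    qed
  qed
  also have "\<dots> = ennreal (1 / (2 * \<sigma>)) * (\<integral>\<^sup>+x. ?g x \<partial>lborel) + ennreal (\<sigma> powr (-1/2)) * (\<integral>\<^sup>+x. ennreal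
      (normal_density m \<sigma> x) \<partial>lborel)"
  proof -
    have m: "?g \<in> borel_measurable lborel" "(\<lambda>x. ennreal (normal_density m \<sigma> x)) \<in> borel_measurable lborel" by
        measurable
    show ?thesis
      by (subst nn_integral_add[OF borel_measurable_times_ennreal[OF borel_measurable_const m(1)]
          borel_measurable_times_ennreal[OF borel_measurable_const m(2)]])
        (simp only: nn_integral_cmult[OF m(1)] nn_integral_cmult[OF m(2)])
  qed
  also have "\<dots> \<le> ennreal (1 / (2 * \<sigma>)) * ennreal (4 * \<sigma> powr (1/2)) + ennreal (\<sigma> powr (-1/2)) * 1"
    unfolding one by (intro add_mono mult_left_mono nn_integral_powr_half \<sigma> order_refl) auto
  also have "\<dots> = ennreal (1 / (2 * \<sigma>) * (4 * \<sigma> powr (1/2)) + \<sigma> powr (-1/2))"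
    using \<sigma> by (simp add: ennreal_mult[symmetric] ennreal_plus[symmetric] del: ennreal_plus)
  also have "1 / (2 * \<sigma>) * (4 * \<sigma> powr (1/2)) = 2 * \<sigma> powr (-1/2)"
  proof -
    have "\<sigma> powr (1/2) = \<sigma> * \<sigma> powr (-1/2)" using \<sigma> powr_add[of \<sigma> 1 "-1/2"] by simp
    then show ?thesis using \<sigma> by simp
  qed
  finally show ?thesis by simp
qed

lemma linear_form_negative_moment:
  fixes b :: "'i \<Rightarrow> real"
  assumes J: "finite J" and pos: "(\<Sum>j\<in>J. (b j)\<^sup>2) > 0"
  shows "(\<integral>\<^sup>+x. qf (of_real (m + (\<Sum>j\<in>J. b j * x j))) \<partial>PiM J (\<lambda>_. stdn)) \<le> ennreal (3 * (\<Sum>j\<in>J. (b j)\<^sup>2) powr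
      (-1/4))"
proof -
  interpret product_prob_space "\<lambda>_::'i. stdn" by (rule product_prob_space_stdn)
  interpret Pr: prob_space "PiM J (\<lambda>_::'i. stdn)" by (rule prob_space_PiM) (rule prob_space_stdn)
  \<comment> \<open>Vanishing coefficients are dropped, because a summand without variance has no
    normal density.\<close>
  define K where "K = {j\<in>J. b j \<noteq> 0}"
  have K: "finite K" "K \<subseteq> J" using J by (auto simp: K_def)
  have sK: "(\<Sum>j\<in>K. (b j)\<^sup>2) = (\<Sum>j\<in>J. (b j)\<^sup>2)" "(\<Sum>j\<in>K. b j * x j) = (\<Sum>j\<in>J. b j * x j)" for x
    using J by (auto simp: K_def intro!: sum.mono_neutral_left)
  have Kne: "K \<noteq> {}" using pos sK(1) by auto
  have distr1: "distr (PiM J (\<lambda>_. stdn)) borel (\<lambda>x. x j) = stdn" if "j \<in> J" for j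
  proof -
    have "distr (PiM J (\<lambda>_. stdn)) stdn (\<lambda>x. x j) = stdn"
      by (rule distr_PiM_component[OF prob_space_stdn that])
    then show ?thesis by (simp cong: distr_cong)
  qed
  have ind: "Pr.indep_vars (\<lambda>_. borel) (\<lambda>j x. x j) J"
  proof (subst Pr.indep_vars_iff_distr_eq_PiM')
    show "J \<noteq> {}" using Kne K by auto
    show "(\<lambda>x. x j) \<in> PiM J (\<lambda>_. stdn) \<rightarrow>\<^sub>M borel" if "j \<in> J" for j using that by measurable
    have "distr (PiM J (\<lambda>_. stdn)) (PiM J (\<lambda>_. borel)) (\<lambda>x. \<lambda>j\<in>J. x j) = distr (PiM J (\<lambda>_. stdn)) (PiM J (\<lambda>_.
        stdn)) (\<lambda>x. x)"
      by (intro distr_cong) (auto simp: space_PiM PiE_def extensional_restrict intro!: sets_PiM_cong)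
    also have "\<dots> = PiM J (\<lambda>_. stdn)" by simp
    also have "\<dots> = PiM J (\<lambda>j. distr (PiM J (\<lambda>_. stdn)) borel (\<lambda>x. x j))"
      by (intro PiM_cong refl) (simp add: distr1)
    finally show "distr (PiM J (\<lambda>_. stdn)) (PiM J (\<lambda>_. borel)) (\<lambda>x. \<lambda>j\<in>J. x j) = PiM J (\<lambda>j. distr (PiM J (\<lambda>_.
        stdn)) borel (\<lambda>x. x j))" .
  qed
  have indK: "Pr.indep_vars (\<lambda>_. borel) (\<lambda>j x. b j * x j) K"
    by (rule Pr.indep_vars_compose2[OF Pr.indep_vars_subset[OF ind K(2)], where Y="\<lambda>j y. b j * y"]) simp
  have dist: "distributed (PiM J (\<lambda>_. stdn)) lborel (\<lambda>x. b j * x j) (normal_density 0 \<bar>b j\<bar>)" if "j \<in> K" for j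
  proof -
    have j: "j \<in> J" "b j \<noteq> 0" using that by (auto simp: K_def)
    have "distributed (PiM J (\<lambda>_. stdn)) lborel (\<lambda>x. x j) (normal_density 0 1)"
      unfolding distributed_def using distr1[OF j(1)] j(1) by (auto simp: stdn_def cong: distr_cong)
    from Pr.normal_density_affine[OF this _ j(2), of 0] show ?thesis by simp
  qed
  define \<sigma> where "\<sigma> = sqrt (\<Sum>j\<in>J. (b j)\<^sup>2)"
  have \<sigma>: "\<sigma> > 0" using pos by (simp add: \<sigma>_def)
  have "distributed (PiM J (\<lambda>_. stdn)) lborel (\<lambda>x. \<Sum>j\<in>K. b j * x j) (normal_density (\<Sum>j\<in>K. 0) (sqrt (\<Sum>j\<in>K. \<bar>b
      j\<bar>\<^sup>2)))"
    using dist by (intro Pr.sum_indep_normal[OF K(1) Kne indK]) (auto simp: K_def)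
  then have "distributed (PiM J (\<lambda>_. stdn)) lborel (\<lambda>x. \<Sum>j\<in>J. b j * x j) (normal_density 0 \<sigma>)"
    by (simp add: sK \<sigma>_def)
  from Pr.normal_density_affine[OF this \<sigma>, of 1 m]
  have D: "distributed (PiM J (\<lambda>_. stdn)) lborel (\<lambda>x. m + (\<Sum>j\<in>J. b j * x j)) (normal_density m \<sigma>)" by simp
  have "(\<integral>\<^sup>+x. qf (of_real (m + (\<Sum>j\<in>J. b j * x j))) \<partial>PiM J (\<lambda>_. stdn))
     = (\<integral>\<^sup>+y. ennreal (normal_density m \<sigma> y) * qf (of_real y) \<partial>lborel)"
    by (rule distributed_nn_integral[OF D, symmetric]) measurable
  also have "\<dots> \<le> ennreal (3 * \<sigma> powr (-1/2))"
    using normal_negative_moment[OF \<sigma>, of m] by (simp add: mult.commute)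
  also have "\<sigma> powr (-1/2) = (\<Sum>j\<in>J. (b j)\<^sup>2) powr (-1/4)"
    using pos by (simp add: \<sigma>_def powr_half_sqrt[symmetric] powr_powr)
  finally show ?thesis .
qed

lemma powr_tangent:
  assumes "u > 0"
  shows "u powr (-1/4) \<ge> (1::real) - (u - 1) / 4"
proof -
  have "1 - (u - 1) / 4 \<le> 1 + (-1/4 * ln u)"
    using ln_le_minus_one[OF assms] by (simp add: field_simps)
  also have "\<dots> \<le> exp (-1/4 * ln u)" by (rule exp_ge_add_one_self)
  finally show ?thesis using assms by (simp add: powr_def)
qed

text \<open>Jensen's inequality for the convex function \<open>u powr (-1/4)\<close>, by summing its
  tangent at the mean \<open>M\<close>; passing from the mean to the sum gives the factor
  \<open>card T powr (-1/4)\<close>.\<close>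

lemma sum_powr_quarter_le:
  fixes x :: "'i \<Rightarrow> real"
  assumes T: "finite T" "T \<noteq> {}" and pos: "\<And>j. j \<in> T \<Longrightarrow> x j > 0"
  shows "(\<Sum>j\<in>T. x j) powr (-1/4) \<le> real (card T) powr (-1/4) / real (card T) * (\<Sum>j\<in>T. x j powr (-1/4))"
proof -
  define n where "n = real (card T)"
  have n: "n > 0" using T by (simp add: n_def card_gt_0_iff)
  define M where "M = (\<Sum>j\<in>T. x j) / n"
  have M: "M > 0" using T pos n by (simp add: M_def sum_pos)
  have "(\<Sum>j\<in>T. M powr (-1/4) * (1 - (x j / M - 1) / 4)) \<le> (\<Sum>j\<in>T. x j powr (-1/4))"
  proof (rule sum_mono)
    fix j assume j: "j \<in> T"
    have "M powr (-1/4) * (1 - (x j / M - 1) / 4) \<le> M powr (-1/4) * (x j / M) powr (-1/4)"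
      using powr_tangent[of "x j / M"] pos[OF j] M by (intro mult_left_mono) auto
    also have "\<dots> = x j powr (-1/4)" using pos[OF j] M by (simp add: powr_mult[symmetric])
    finally show "M powr (-1/4) * (1 - (x j / M - 1) / 4) \<le> x j powr (-1/4)" .
  qed
  also have "(\<Sum>j\<in>T. M powr (-1/4) * (1 - (x j / M - 1) / 4)) = M powr (-1/4) * (n - ((\<Sum>j\<in>T. x j) / M - n) / 4)"
    by (simp add: sum_distrib_left[symmetric] sum_subtractf sum_divide_distrib[symmetric] n_def)
  also have "(\<Sum>j\<in>T. x j) / M = n"
  proof -
    have "(\<Sum>j\<in>T. x j) > 0" by (rule sum_pos[OF T]) (rule pos)
    then show ?thesis using n by (simp add: M_def)
  qed
  finally have "M powr (-1/4) * n \<le> (\<Sum>j\<in>T. x j powr (-1/4))" by simp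
  then have 1: "M powr (-1/4) \<le> (\<Sum>j\<in>T. x j powr (-1/4)) / n" using n by (simp add: field_simps)
  have "(\<Sum>j\<in>T. x j) = n * M" using n by (simp add: M_def)
  then have "(\<Sum>j\<in>T. x j) powr (-1/4) = n powr (-1/4) * M powr (-1/4)" using n M by (simp add: powr_mult)
  also have "\<dots> \<le> n powr (-1/4) * ((\<Sum>j\<in>T. x j powr (-1/4)) / n)" using 1 by (intro mult_left_mono) auto
  finally show ?thesis by (simp add: n_def)
qed

text \<open>The integral is controlled by the variance, hence by
  \<open>\<Sum>j\<in>T. (cmod (\<beta> j))\<^sup>2\<close>, and Jensen's inequality turns this into
  a sum of the same functional \<open>qf\<close> at the coefficients. When these are cofactors, the
  estimate can be iterated. The factor \<open>card T powr (-1/4)\<close> is what accumulates to a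
  factorial. If a coefficient in \<open>T\<close> vanishes, the right side is infinite.\<close>

lemma row_negative_moment:
  fixes \<beta> :: "'i \<Rightarrow> complex"
  assumes J: "finite J" and T: "T \<subseteq> J" "T \<noteq> {}"
  shows "(\<integral>\<^sup>+x. qf (\<alpha> + (\<Sum>j\<in>J. \<beta> j * of_real (x j))) \<partial>PiM J (\<lambda>_. stdn))
     \<le> ennreal (4 * (real (card T) powr (-1/4) / real (card T))) * (\<Sum>j\<in>T. qf (\<beta> j))"
proof (cases "\<exists>j\<in>T. \<beta> j = 0")
  case True
  then have "(\<Sum>j\<in>T. qf (\<beta> j)) = \<top>"
  proof -
    obtain j where j: "j \<in> T" "\<beta> j = 0" using True by auto
    then have "qf (\<beta> j) \<le> (\<Sum>j\<in>T. qf (\<beta> j))"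
      using finite_subset[OF T(1) J] by (intro member_le_sum) auto
    then show ?thesis using j by (simp add: qf_def top_unique)
  qed
  moreover have "ennreal (4 * (real (card T) powr (-1/4) / real (card T))) * \<top> = \<top>"
    using finite_subset[OF T(1) J] T(2) by (simp add: ennreal_mult_eq_top_iff card_gt_0_iff)
  ultimately show ?thesis by (simp only: top_greatest)
next
  case False
  have fT: "finite T" using T(1) J by (rule finite_subset)
  define V where "V = (\<Sum>j\<in>T. (cmod (\<beta> j))\<^sup>2)"
  have V: "V > 0" unfolding V_def using False T fT by (intro sum_pos) auto
  have VJ: "V \<le> (\<Sum>j\<in>J. (cmod (\<beta> j))\<^sup>2)" unfolding V_def using J T by (intro sum_mono2) auto
  have main: "(\<integral>\<^sup>+x. qf (\<alpha> + (\<Sum>j\<in>J. \<beta> j * of_real (x j))) \<partial>PiM J (\<lambda>_. stdn)) \<le> ennreal (3 * (V / 2) powr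
      (-1/4))"
    if b: "V / 2 \<le> (\<Sum>j\<in>J. (b j)\<^sup>2)" and le: "\<And>x. \<bar>m + (\<Sum>j\<in>J. b j * x j)\<bar> \<le> cmod (\<alpha> + (\<Sum>j\<in>J. \<beta> j * of_real (x
        j)))"
    for b :: "'i \<Rightarrow> real" and m :: real
  proof -
    have "(\<integral>\<^sup>+x. qf (\<alpha> + (\<Sum>j\<in>J. \<beta> j * of_real (x j))) \<partial>PiM J (\<lambda>_. stdn))
      \<le> (\<integral>\<^sup>+x. qf (of_real (m + (\<Sum>j\<in>J. b j * x j))) \<partial>PiM J (\<lambda>_. stdn))"
      using le by (intro nn_integral_mono qf_antimono) (simp only: norm_of_real)
    also have "\<dots> \<le> ennreal (3 * (\<Sum>j\<in>J. (b j)\<^sup>2) powr (-1/4))"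
      using b V by (intro linear_form_negative_moment J) linarith
    also have "\<dots> \<le> ennreal (3 * (V / 2) powr (-1/4))"
      using b V by (intro ennreal_leI mult_left_mono powr_mono2') auto
    finally show ?thesis .
  qed
  have split: "(\<Sum>j\<in>J. (cmod (\<beta> j))\<^sup>2) = (\<Sum>j\<in>J. (Re (\<beta> j))\<^sup>2) + (\<Sum>j\<in>J. (Im (\<beta> j))\<^sup>2)"
    by (simp add: cmod_power2 sum.distrib)
  have re: "\<bar>Re \<alpha> + (\<Sum>j\<in>J. Re (\<beta> j) * x j)\<bar> \<le> cmod (\<alpha> + (\<Sum>j\<in>J. \<beta> j * of_real (x j)))" for x
    using abs_Re_le_cmod[of "\<alpha> + (\<Sum>j\<in>J. \<beta> j * of_real (x j))"] by simp
  have im: "\<bar>Im \<alpha> + (\<Sum>j\<in>J. Im (\<beta> j) * x j)\<bar> \<le> cmod (\<alpha> + (\<Sum>j\<in>J. \<beta> j * of_real (x j)))" for x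
    using abs_Im_le_cmod[of "\<alpha> + (\<Sum>j\<in>J. \<beta> j * of_real (x j))"] by simp
  \<comment> \<open>The noise is real but the coefficients are complex: the real or the imaginary
    part of the linear form carries at least half of the variance, and each is a lower bound for the
    modulus.\<close>
  have "V / 2 \<le> (\<Sum>j\<in>J. (Re (\<beta> j))\<^sup>2) \<or> V / 2 \<le> (\<Sum>j\<in>J. (Im (\<beta> j))\<^sup>2)"
    using VJ split by linarith
  then have "(\<integral>\<^sup>+x. qf (\<alpha> + (\<Sum>j\<in>J. \<beta> j * of_real (x j))) \<partial>PiM J (\<lambda>_. stdn)) \<le> ennreal (3 * (V / 2) powr (-1/4))"
    using main[OF _ re] main[OF _ im] by blast
  also have "\<dots> \<le> ennreal (4 * V powr (-1/4))"
  proof (rule ennreal_leI)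
    have "(V / 2) powr (-1/4) = V powr (-1/4) * (1/2) powr (-1/4)"
      using V powr_mult[of V "1/2" "-1/4"] by simp
    \<comment> \<open>Halving the variance raises the constant from 3 to at most 4, as
      \<open>2 powr (1/4) \<le> 4/3\<close>.\<close>
    moreover have "(1/2::real) powr (-1/4) \<le> 4/3"
    proof -
      have "((1/2::real) powr (-1/4)) ^ 4 = ((1/2) powr (-1/4)) powr (real 4)" by (rule powr_realpow[symmetric])
          simp
      also have "\<dots> = (1/2) powr (-1)" unfolding powr_powr by simp
      also have "\<dots> = 2" by (simp add: powr_minus)
      finally have "((1/2::real) powr (-1/4)) ^ 4 = 2" .
      moreover have "(4/3::real)^4 \<ge> 2" by (simp add: power4_eq_xxxx)
      ultimately show ?thesis by (metis power_mono_iff powr_ge_zero zero_le_divide_iff zero_le_numeral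
          zero_less_numeral)
    qed
    ultimately have "(V / 2) powr (-1/4) \<le> V powr (-1/4) * (4/3)" by (simp only: mult_left_mono powr_ge_zero)
    then show "3 * (V / 2) powr (-1/4) \<le> 4 * V powr (-1/4)" by simp
  qed
  also have "\<dots> \<le> ennreal (4 * (real (card T) powr (-1/4) / real (card T) * (\<Sum>j\<in>T. ((cmod (\<beta> j))\<^sup>2) powr
      (-1/4))))"
    unfolding V_def using False fT T by (intro ennreal_leI mult_left_mono sum_powr_quarter_le) auto
  also have "(\<Sum>j\<in>T. ((cmod (\<beta> j))\<^sup>2) powr (-1/4)) = (\<Sum>j\<in>T. cmod (\<beta> j) powr (-1/2))"
  proof (intro sum.cong refl)
    fix j assume "j \<in> T"
    then have "cmod (\<beta> j) > 0" using False by auto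
    then have "(cmod (\<beta> j))\<^sup>2 = cmod (\<beta> j) powr 2" by simp
    then show "((cmod (\<beta> j))\<^sup>2) powr (-1/4) = cmod (\<beta> j) powr (-1/2)" unfolding powr_powr by (simp only:
        powr_powr) simp
  qed
  also have "ennreal (4 * (real (card T) powr (-1/4) / real (card T) * (\<Sum>j\<in>T. cmod (\<beta> j) powr (-1/2))))
     = ennreal (4 * (real (card T) powr (-1/4) / real (card T))) * ennreal (\<Sum>j\<in>T. cmod (\<beta> j) powr (-1/2))"
    by (subst ennreal_mult[symmetric]) (auto intro!: sum_nonneg simp: mult_ac)
  also have "ennreal (\<Sum>j\<in>T. cmod (\<beta> j) powr (-1/2)) = (\<Sum>j\<in>T. qf (\<beta> j))"
    using False by (subst sum_ennreal[symmetric]) (auto simp: qf_def intro!: sum.cong)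
  finally show ?thesis .
qed

section \<open>Integrating out the noisy rows one by one\<close>

definition noisy_rows :: "nat \<Rightarrow> complex mat \<Rightarrow> complex \<Rightarrow> nat set \<Rightarrow> (nat \<times> nat \<Rightarrow> real) \<Rightarrow> complex mat" where
  "noisy_rows n A s Q x = mat n n (\<lambda>(i,j). A $$ (i,j) + (if i \<in> Q then s * of_real (x (i,j)) else 0))"

lemma noisy_rows_carrier [simp]: "noisy_rows n A s Q x \<in> carrier_mat n n"
  by (simp add: noisy_rows_def)

lemma measurable_det_noisy_rows [measurable]:
  assumes "Q \<subseteq> {..<n}"
  shows "(\<lambda>x. det (noisy_rows n A s Q x)) \<in> borel_measurable (PiM (Q \<times> {..<n}) (\<lambda>_. stdn))"
  unfolding noisy_rows_def
proof (rule borel_measurable_det)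
  fix i j assume "i < n" "j < n"
  then show "(\<lambda>x. A $$ (i,j) + (if i \<in> Q then s * of_real (x (i,j)) else 0)) \<in> borel_measurable (PiM (Q \<times>
      {..<n}) (\<lambda>_. stdn))"
    by (cases "i \<in> Q") (auto intro!: borel_measurable_add borel_measurable_times borel_measurable_of_real)
qed

definition unit_row :: "nat \<Rightarrow> complex mat \<Rightarrow> nat \<Rightarrow> nat \<Rightarrow> complex mat" where
  "unit_row n A r j = mat n n (\<lambda>(i,j'). if i = r then (if j' = j then 1 else 0) else A $$ (i,j'))"

lemma det_unit_row:
  assumes "r < n" "j < n" "A \<in> carrier_mat n n"
  shows "det (unit_row n A r j) = cofactor A r j"
proof -
  have c: "unit_row n A r j \<in> carrier_mat n n" by (simp add: unit_row_def)
  have "mat_delete (unit_row n A r j) r j' = mat_delete A r j'" if "j' < n" for j'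
    using assms that by (intro eq_matI) (auto simp: mat_delete_def unit_row_def)
  then have cof: "cofactor (unit_row n A r j) r j' = cofactor A r j'" if "j' < n" for j'
    using that by (simp add: cofactor_def)
  have row: "unit_row n A r j $$ (r,j') = (if j' = j then 1 else 0)" if "j' < n" for j'
    using assms that by (simp add: unit_row_def)
  have "det (unit_row n A r j) = (\<Sum>j'<n. unit_row n A r j $$ (r,j') * cofactor (unit_row n A r j) r j')"
    by (rule laplace_expansion_row[OF c assms(1)])
  also have "\<dots> = (\<Sum>j'<n. if j' = j then cofactor A r j else 0)"
    using assms by (intro sum.cong refl) (auto simp: row cof)
  finally show ?thesis using assms by simp
qed

text \<open>Given the other rows, the determinant is affine in row \<open>r\<close>, with
  \<open>s\<close> times the cofactors as coefficients. A cofactor is the determinant with row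
  \<open>r\<close> replaced by a unit vector in a column \<open>j\<close>, so after
  \<open>row_negative_moment\<close> the induction continues with \<open>T - {j}\<close>. Choosing
  columns in \<open>T\<close> only means that the final determinants are exactly those of bijections
  from \<open>Q\<close> to \<open>T\<close>, for which a lower bound is at hand. With
  \<open>k + 1\<close> columns left, the sum of \<open>k + 1\<close> terms against the prefactor
  gains \<open>(k + 1) powr (-1/4)\<close>; the product is the factorial.\<close>

lemma rows_negative_moment:
  assumes s: "s \<noteq> 0" and B: "B > 0"
    and "finite Q" "Q \<subseteq> {..<n}" "T \<subseteq> {..<n}" "card T = card Q" "A \<in> carrier_mat n n"
    and "\<And>f. bij_betw f Q T \<Longrightarrow> B \<le> cmod (det (mat n n (\<lambda>(i,j). if i \<in> Q then (if j = f i then 1 else 0) else A $$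
        (i,j))))"
  shows "(\<integral>\<^sup>+x. qf (det (noisy_rows n A s Q x)) \<partial>PiM (Q \<times> {..<n}) (\<lambda>_. stdn))
    \<le> ennreal (4 ^ card Q * (cmod s powr (-1/2)) ^ card Q * fact (card Q) powr (-1/4) * B powr (-1/2))"
  using assms(3-)
proof (induct Q arbitrary: A T rule: finite_induct)
  case empty
  interpret product_prob_space "\<lambda>_::nat \<times> nat. stdn" by (rule product_prob_space_stdn)
  have T: "T = {}" using empty finite_subset[of T "{..<n}"] by simp
  have "bij_betw id {} T" by (simp add: T)
  from empty(5)[OF this] have "B \<le> cmod (det (mat n n (\<lambda>(i,j). A $$ (i,j))))" by simp
  moreover have "(\<integral>\<^sup>+x. qf (det (noisy_rows n A s {} x)) \<partial>PiM {} (\<lambda>_. stdn)) = qf (det (noisy_rows n A s {} (\<lambda>_.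
      undefined)))"
    by (rule nn_integral_empty) simp
  ultimately show ?case
    using qf_le[OF B] by (simp only: Sigma_empty1 card.empty) (simp add: noisy_rows_def)
next
  case (insert r Q)
  interpret product_prob_space "\<lambda>_::nat \<times> nat. stdn" by (rule product_prob_space_stdn)
  have r: "r < n" "r \<notin> Q" "Q \<subseteq> {..<n}" using insert by auto
  have fT: "finite T" using insert finite_subset[of T "{..<n}"] by simp
  have Tne: "T \<noteq> {}" using insert by auto
  define k where "k = card Q"
  have cT: "card T = Suc k" using insert by (simp add: k_def)
  let ?I = "Q \<times> {..<n}" and ?J = "{r} \<times> {..<n}"
  let ?K = "4 ^ k * (cmod s powr (-1/2)) ^ k * fact k powr (-1/4) * B powr (-1/2)"
  let ?c = "4 * (real (Suc k) powr (-1/4) / real (Suc k))"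
  have IJ: "?I \<inter> ?J = {}" "finite ?I" "finite ?J" "Set.insert r Q \<times> {..<n} = ?I \<union> ?J"
    using insert r by auto
  have meas: "(\<lambda>x. qf (det (noisy_rows n A s (Set.insert r Q) x))) \<in> borel_measurable (PiM (?I \<union> ?J) (\<lambda>_.
      stdn))"
    unfolding IJ(4)[symmetric] using insert by measurable
  have inner: "(\<integral>\<^sup>+y. qf (det (noisy_rows n A s (Set.insert r Q) (merge ?I ?J (x, y)))) \<partial>PiM ?J (\<lambda>_. stdn))
     \<le> ennreal ?c * (\<Sum>j\<in>T. ennreal (cmod s powr (-1/2)) * qf (det (noisy_rows n (unit_row n A r j) s Q x)))" for
         x
  proof -
    let ?cof = "\<lambda>j. cofactor (noisy_rows n A s Q x) r j"
    have cof: "?cof j = det (noisy_rows n (unit_row n A r j) s Q x)" if "j < n" for j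
    proof -
      have "unit_row n (noisy_rows n A s Q x) r j = noisy_rows n (unit_row n A r j) s Q x"
        using r by (intro eq_matI) (auto simp: unit_row_def noisy_rows_def)
      then show ?thesis using det_unit_row[OF r(1) that, of "noisy_rows n A s Q x"] by simp
    qed
    have d: "det (noisy_rows n A s (Set.insert r Q) (merge ?I ?J (x, y))) = det (noisy_rows n A s Q x) + (\<Sum>p\<in>?J.
        (s * ?cof (snd p)) * of_real (y p))" for y
    proof -
      let ?X = "noisy_rows n A s (Set.insert r Q) (merge ?I ?J (x, y))"
      have e: "?X $$ (i,j) = noisy_rows n A s Q x $$ (i,j) + (if i = r then s * of_real (y (r,j)) else 0)" if "i
          < n" "j < n" for i j
        using that r by (auto simp: noisy_rows_def merge_def)
      have "mat_delete ?X r j = mat_delete (noisy_rows n A s Q x) r j" if "j < n" for j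
        using that r by (intro eq_matI) (auto simp: mat_delete_def noisy_rows_def merge_def)
      then have c: "cofactor ?X r j = ?cof j" if "j < n" for j using that by (simp add: cofactor_def)
      have "det ?X = (\<Sum>j<n. ?X $$ (r,j) * cofactor ?X r j)"
        by (rule laplace_expansion_row[OF _ r(1)]) simp
      also have "\<dots> = (\<Sum>j<n. noisy_rows n A s Q x $$ (r,j) * ?cof j + (s * ?cof j) * of_real (y (r,j)))"
        using r by (intro sum.cong refl) (simp add: e c algebra_simps)
      also have "\<dots> = det (noisy_rows n A s Q x) + (\<Sum>j<n. (s * ?cof j) * of_real (y (r,j)))"
        by (simp add: sum.distrib laplace_expansion_row[OF _ r(1), of "noisy_rows n A s Q x"])
      also have "(\<Sum>j<n. (s * ?cof j) * of_real (y (r,j))) = (\<Sum>p\<in>?J. (s * ?cof (snd p)) * of_real (y p))"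
        by (rule sum.reindex_bij_witness[of _ snd "\<lambda>j. (r,j)"]) auto
      finally show ?thesis .
    qed
    have cJ: "card ({r} \<times> T) = Suc k" using cT by (simp add: card_cartesian_product_singleton)
    have "(\<integral>\<^sup>+y. qf (det (noisy_rows n A s (Set.insert r Q) (merge ?I ?J (x, y)))) \<partial>PiM ?J (\<lambda>_. stdn))
      \<le> ennreal ?c * (\<Sum>p\<in>{r} \<times> T. qf (s * ?cof (snd p)))"
      unfolding d using row_negative_moment[of ?J "{r} \<times> T" "det (noisy_rows n A s Q x)" "\<lambda>p. s * ?cof (snd p)"]
          insert Tne cJ
      by auto
    also have "(\<Sum>p\<in>{r} \<times> T. qf (s * ?cof (snd p))) = (\<Sum>j\<in>T. qf (s * ?cof j))"
      by (rule sum.reindex_bij_witness[of _ "\<lambda>j. (r,j)" snd]) auto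
    also have "\<dots> = (\<Sum>j\<in>T. ennreal (cmod s powr (-1/2)) * qf (det (noisy_rows n (unit_row n A r j) s Q x)))"
      using insert(5) by (intro sum.cong refl) (auto simp: qf_mult[OF s] cof)
    finally show ?thesis .
  qed
  have IH: "(\<integral>\<^sup>+x. qf (det (noisy_rows n (unit_row n A r j) s Q x)) \<partial>PiM ?I (\<lambda>_. stdn)) \<le> ennreal ?K" if j: "j \<in>
      T" for j
    unfolding k_def
  proof (rule insert(3)[where T="T - {j}"])
    show "Q \<subseteq> {..<n}" "T - {j} \<subseteq> {..<n}" "card (T - {j}) = card Q" "unit_row n A r j \<in> carrier_mat n n"
      using r insert j fT cT by (auto simp: unit_row_def k_def)
    fix f assume f: "bij_betw f Q (T - {j})"
    have "bij_betw (f(r := j)) (Set.insert r Q) (Set.insert j (T - {j}))"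
      using f r by (auto simp: bij_betw_def inj_on_def)
    moreover have "Set.insert j (T - {j}) = T" using j by auto
    ultimately have "B \<le> cmod (det (mat n n (\<lambda>(i,j'). if i \<in> Set.insert r Q then (if j' = (f(r := j)) i then 1
        else 0) else A $$ (i,j'))))"
      using insert(8) by simp
    also have "mat n n (\<lambda>(i,j'). if i \<in> Set.insert r Q then (if j' = (f(r := j)) i then 1 else 0) else A $$
        (i,j'))
       = mat n n (\<lambda>(i,j'). if i \<in> Q then (if j' = f i then 1 else 0) else unit_row n A r j $$ (i,j'))"
      using r by (intro eq_matI) (auto simp: unit_row_def)
    finally show "B \<le> cmod (det (mat n n (\<lambda>(i,j'). if i \<in> Q then (if j' = f i then 1 else 0) else unit_row n A r
        j $$ (i,j'))))" .
  qed
  have "(\<integral>\<^sup>+x. qf (det (noisy_rows n A s (Set.insert r Q) x)) \<partial>PiM (Set.insert r Q \<times> {..<n}) (\<lambda>_. stdn))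
    = (\<integral>\<^sup>+x. (\<integral>\<^sup>+y. qf (det (noisy_rows n A s (Set.insert r Q) (merge ?I ?J (x, y)))) \<partial>PiM ?J (\<lambda>_. stdn)) \<partial>PiM
        ?I (\<lambda>_. stdn))"
    unfolding IJ(4) by (rule product_nn_integral_fold[OF IJ(1-3) meas])
  also have "\<dots> \<le> (\<integral>\<^sup>+x. ennreal ?c * (\<Sum>j\<in>T. ennreal (cmod s powr (-1/2)) * qf (det (noisy_rows n (unit_row n A r
      j) s Q x))) \<partial>PiM ?I (\<lambda>_. stdn))"
    by (intro nn_integral_mono inner)
  also have "\<dots> = ennreal ?c * (\<Sum>j\<in>T. ennreal (cmod s powr (-1/2)) * (\<integral>\<^sup>+x. qf (det (noisy_rows n (unit_row n A r
      j) s Q x)) \<partial>PiM ?I (\<lambda>_. stdn)))"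
    using r(3) by (simp add: nn_integral_cmult nn_integral_sum)
  also have "\<dots> \<le> ennreal ?c * (\<Sum>j\<in>T. ennreal (cmod s powr (-1/2)) * ennreal ?K)"
    by (intro mult_left_mono sum_mono IH) auto
  also have "\<dots> = ennreal (?c * (real (Suc k) * (cmod s powr (-1/2) * ?K)))"
    using B by (simp add: cT ennreal_mult[symmetric] ennreal_of_nat_eq_real_of_nat del: of_nat_Suc)
  also have "?c * (real (Suc k) * (cmod s powr (-1/2) * ?K))
     = 4 ^ Suc k * (cmod s powr (-1/2)) ^ Suc k * (real (Suc k) powr (-1/4) * fact k powr (-1/4)) * B powr
         (-1/2)"
    by (simp del: of_nat_Suc)
  also have "real (Suc k) powr (-1/4) * fact k powr (-1/4) = fact (Suc k) powr (-1/4)"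
    by (simp add: powr_mult)
  finally show ?case using insert by (simp add: k_def)
qed

section \<open>The norm of a Gaussian matrix\<close>

definition bil :: "nat \<Rightarrow> (nat \<times> nat \<Rightarrow> real) \<Rightarrow> (nat \<Rightarrow> real) \<Rightarrow> (nat \<Rightarrow> real) \<Rightarrow> real" where
  "bil n x u v = (\<Sum>p\<in>{..<n}\<times>{..<n}. (u (fst p) * v (snd p)) * x p)"

text \<open>A net of the unit ball with coordinates in multiples of \<open>1 / n\<^sup>2\<close>.
  Its logarithmic size is of order \<open>n * ln n\<close> rather than \<open>n\<close>; this is
  affordable because \<open>t\<^sup>2\<close> will be \<open>n powr (1 + \<eta>)\<close>.\<close>

definition grid :: "nat \<Rightarrow> (nat \<Rightarrow> real) set" where
  "grid n = {u \<in> PiE {..<n} (\<lambda>_. (\<lambda>k. real_of_int k / (real n)\<^sup>2) ` {- (int n)\<^sup>2..(int n)\<^sup>2}). (\<Sum>i<n. (u i)\<^sup>2) \<le>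
      1}"

text \<open>An exponential-moment form of the event that the matrix \<open>x\<close> has norm of order \<open>t\<close>; the second condition
  controls the error of rounding unit vectors to the grid.\<close>

definition good :: "nat \<Rightarrow> real \<Rightarrow> (nat \<times> nat \<Rightarrow> real) \<Rightarrow> bool" where
  "good n t x \<longleftrightarrow> (\<Sum>q\<in>grid n \<times> grid n. exp (t * bil n x (fst q) (snd q))) \<le> exp (t\<^sup>2)
     \<and> (\<Sum>p\<in>{..<n}\<times>{..<n}. (x p)\<^sup>2) \<le> real n ^ 3"

lemma finite_grid: "finite (grid n)"
  unfolding grid_def by (rule finite_subset[OF Collect_subset]) (auto intro: finite_PiE)

lemma card_grid: "card (grid n) \<le> (2 * n\<^sup>2 + 1) ^ n"
proof -
  let ?P = "PiE {..<n} (\<lambda>_. (\<lambda>k. real_of_int k / (real n)\<^sup>2) ` {- (int n)\<^sup>2..(int n)\<^sup>2})"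
  have "card (grid n) \<le> card ?P"
    unfolding grid_def by (intro card_mono finite_PiE) auto
  also have "\<dots> = card ((\<lambda>k. real_of_int k / (real n)\<^sup>2) ` {- (int n)\<^sup>2..(int n)\<^sup>2}) ^ n"
    by (simp add: card_PiE)
  also have "\<dots> \<le> card {- (int n)\<^sup>2..(int n)\<^sup>2} ^ n"
    by (intro power_mono card_image_le) auto
  also have "card {- (int n)\<^sup>2..(int n)\<^sup>2} = 2 * n\<^sup>2 + 1"
    by (simp add: nat_eq_iff)
  finally show ?thesis .
qed

lemma bil_eq: "bil n x u v = (\<Sum>i<n. u i * (\<Sum>j<n. x (i,j) * v j))"
  unfolding bil_def sum_distrib_left
  by (simp add: sum.cartesian_product' mult_ac)

lemma real_mat_HS:
  "L2_set (\<lambda>i. \<Sum>j<n. x (i,j) * v j) {..<n} \<le> sqrt (\<Sum>p\<in>{..<n}\<times>{..<n}. (x p)\<^sup>2) * L2_set v {..<n}"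
proof -
  have "(\<Sum>i<n. (\<Sum>j<n. x (i,j) * v j)\<^sup>2) \<le> (\<Sum>i<n. (\<Sum>j<n. (x (i,j))\<^sup>2) * (\<Sum>j<n. (v j)\<^sup>2))"
    by (intro sum_mono Cauchy_Schwarz_ineq_sum)
  also have "\<dots> = (\<Sum>p\<in>{..<n}\<times>{..<n}. (x p)\<^sup>2) * (\<Sum>j<n. (v j)\<^sup>2)"
    by (simp add: sum_distrib_right sum.cartesian_product')
  finally have "sqrt (\<Sum>i<n. (\<Sum>j<n. x (i,j) * v j)\<^sup>2) \<le> sqrt ((\<Sum>p\<in>{..<n}\<times>{..<n}. (x p)\<^sup>2) * (\<Sum>j<n. (v j)\<^sup>2))"
    by (rule real_sqrt_le_mono)
  then show ?thesis by (simp add: L2_set_def real_sqrt_mult)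
qed

lemma bil_bound:
  "\<bar>bil n x u v\<bar> \<le> L2_set u {..<n} * (sqrt (\<Sum>p\<in>{..<n}\<times>{..<n}. (x p)\<^sup>2) * L2_set v {..<n})"
proof -
  have "\<bar>bil n x u v\<bar> \<le> (\<Sum>i<n. \<bar>u i\<bar> * \<bar>\<Sum>j<n. x (i,j) * v j\<bar>)"
    unfolding bil_eq by (rule order_trans[OF sum_abs]) (simp add: abs_mult)
  also have "\<dots> \<le> L2_set u {..<n} * L2_set (\<lambda>i. \<Sum>j<n. x (i,j) * v j) {..<n}"
    by (rule L2_set_mult_ineq)
  also have "\<dots> \<le> L2_set u {..<n} * (sqrt (\<Sum>p\<in>{..<n}\<times>{..<n}. (x p)\<^sup>2) * L2_set v {..<n})"
    by (intro mult_left_mono real_mat_HS) simp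
  finally show ?thesis .
qed

lemma grid_round:
  assumes n: "n > 0" and u: "L2_set u {..<n} \<le> 1"
  shows "\<exists>u'\<in>grid n. L2_set (\<lambda>i. u i - u' i) {..<n} \<le> sqrt (real n) / (real n)\<^sup>2"
proof -
  define K where "K = (real n)\<^sup>2"
  have K: "K > 0" using n by (simp add: K_def)
  \<comment> \<open>Rounding towards 0 shrinks every coordinate, so the rounded vector stays in the
    unit ball.\<close>
  define r where "r = (\<lambda>y::real. if y \<ge> 0 then \<lfloor>y * K\<rfloor> else - \<lfloor>- y * K\<rfloor>)"
  have r: "\<bar>real_of_int (r y) / K\<bar> \<le> \<bar>y\<bar>" "\<bar>y - real_of_int (r y) / K\<bar> \<le> 1 / K" for y
  proof -
    have "\<bar>real_of_int (r y)\<bar> \<le> \<bar>y\<bar> * K \<and> \<bar>y * K - real_of_int (r y)\<bar> \<le> 1"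
    proof (cases "y \<ge> 0")
      case True
      then have "0 \<le> y * K" using K by simp
      then have "0 \<le> \<lfloor>y * K\<rfloor>" by simp
      then show ?thesis using True by (simp add: r_def) linarith
    next
      case False
      then have "0 \<le> - y * K" using K by (simp add: mult_le_0_iff)
      then have "0 \<le> \<lfloor>- y * K\<rfloor>" by (simp only: zero_le_floor)
      then show ?thesis using False unfolding r_def by simp linarith
    qed
    then have a: "\<bar>real_of_int (r y)\<bar> \<le> \<bar>y\<bar> * K" "\<bar>y * K - real_of_int (r y)\<bar> \<le> 1" by auto
    show "\<bar>real_of_int (r y) / K\<bar> \<le> \<bar>y\<bar>" using a(1) K by (simp add: abs_divide divide_le_eq)
    have "y - real_of_int (r y) / K = (y * K - real_of_int (r y)) / K" using K by (simp add: field_simps)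
    then show "\<bar>y - real_of_int (r y) / K\<bar> \<le> 1 / K" using a(2) K by (simp add: abs_divide divide_right_mono)
  qed
  define u' where "u' = (\<lambda>i\<in>{..<n}. real_of_int (r (u i)) / K)"
  have u1: "\<bar>u i\<bar> \<le> 1" if "i < n" for i
  proof -
    have "L2_set (\<lambda>i. \<bar>u i\<bar>) {..<n} = L2_set u {..<n}" by (simp add: L2_set_def)
    then show ?thesis using member_le_L2_set[of "{..<n}" i "\<lambda>i. \<bar>u i\<bar>"] that u by simp
  qed
  have "u' \<in> PiE {..<n} (\<lambda>_. (\<lambda>k. real_of_int k / (real n)\<^sup>2) ` {- (int n)\<^sup>2..(int n)\<^sup>2})"
  proof (rule PiE_I)
    fix i assume i: "i \<in> {..<n}"
    have "\<bar>real_of_int (r (u i)) / K\<bar> \<le> 1" using i by (intro order_trans[OF r(1) u1]) simp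
    then have "\<bar>real_of_int (r (u i))\<bar> / K \<le> 1" using K by (simp add: abs_divide)
    then have "\<bar>real_of_int (r (u i))\<bar> \<le> real_of_int ((int n)\<^sup>2)" using K by (simp add: K_def divide_le_eq)
    then have "\<bar>r (u i)\<bar> \<le> (int n)\<^sup>2" by linarith
    then show "u' i \<in> (\<lambda>k. real_of_int k / (real n)\<^sup>2) ` {- (int n)\<^sup>2..(int n)\<^sup>2}"
      using i by (auto simp: u'_def K_def abs_le_iff)
  qed (simp add: u'_def)
  moreover have "(\<Sum>i<n. (u' i)\<^sup>2) \<le> 1"
  proof -
    have "(\<Sum>i<n. (u' i)\<^sup>2) \<le> (\<Sum>i<n. (u i)\<^sup>2)"
      using r(1) by (intro sum_mono) (auto simp: u'_def abs_le_square_iff[symmetric])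
    also have "\<dots> \<le> 1" using u by (simp add: L2_set_def)
    finally show ?thesis .
  qed
  ultimately have "u' \<in> grid n" by (simp add: grid_def)
  moreover have "L2_set (\<lambda>i. u i - u' i) {..<n} \<le> sqrt (real n) / (real n)\<^sup>2"
  proof -
    have "(\<Sum>i<n. (u i - u' i)\<^sup>2) \<le> (\<Sum>i<n. (1 / K)\<^sup>2)"
      using r(2) K by (intro sum_mono) (auto simp: u'_def abs_le_square_iff[symmetric])
    also have "\<dots> = real n * (1 / K)\<^sup>2" by simp
    finally have "L2_set (\<lambda>i. u i - u' i) {..<n} \<le> sqrt (real n * (1 / K)\<^sup>2)"
      unfolding L2_set_def by (rule real_sqrt_le_mono)
    then show ?thesis using K by (simp add: real_sqrt_mult K_def)
  qed
  ultimately show ?thesis by blast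
qed

text \<open>For a unit vector \<open>v\<close> the norm of \<open>x v\<close> is
  \<open>bil n x u v\<close> with \<open>u\<close> in the direction of \<open>x v\<close>. On the
  grid the form is at most \<open>t\<close>, since a single term of the exponential sum is at most
  \<open>exp (t\<^sup>2)\<close>. Rounding \<open>u\<close> and then \<open>v\<close> costs at most
  \<open>sqrt n / n\<^sup>2\<close> times the Hilbert-Schmidt norm \<open>sqrt (n ^ 3)\<close>, that
  is 1, each time.\<close>

lemma good_real_norm:
  assumes n: "n > 0" and t: "t > 0" and g: "good n t x"
  shows "L2_set (\<lambda>i. \<Sum>j<n. x (i,j) * v j) {..<n} \<le> (t + 2) * L2_set v {..<n}"
proof -
  define H where "H = sqrt (\<Sum>p\<in>{..<n}\<times>{..<n}. (x p)\<^sup>2)"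
  have H0: "H \<ge> 0" by (simp add: H_def sum_nonneg)
  have eps: "sqrt (real n) / (real n)\<^sup>2 * H \<le> 1"
  proof -
    have "H \<le> sqrt (real n ^ 3)" unfolding H_def using g by (intro real_sqrt_le_mono) (simp add: good_def)
    then have "sqrt (real n) / (real n)\<^sup>2 * H \<le> sqrt (real n) / (real n)\<^sup>2 * sqrt (real n ^ 3)"
      by (intro mult_left_mono) auto
    also have "sqrt (real n) * sqrt (real n ^ 3) = (real n)\<^sup>2"
    proof -
      have "real n * real n ^ 3 = ((real n)\<^sup>2)\<^sup>2" by (simp add: power2_eq_square power3_eq_cube)
      then have "sqrt (real n) * sqrt (real n ^ 3) = sqrt (((real n)\<^sup>2)\<^sup>2)" by (simp only:
          real_sqrt_mult[symmetric])
      also have "\<dots> = (real n)\<^sup>2" by (subst real_sqrt_abs) simp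
      finally show ?thesis .
    qed
    then have "sqrt (real n) / (real n)\<^sup>2 * sqrt (real n ^ 3) = 1" using n by (simp add: field_simps)
    finally show ?thesis .
  qed
  have gr: "bil n x u w \<le> t" if "u \<in> grid n" "w \<in> grid n" for u w
  proof -
    have "exp (t * bil n x u w) \<le> (\<Sum>q\<in>grid n \<times> grid n. exp (t * bil n x (fst q) (snd q)))"
      using member_le_sum[of "(u,w)" "grid n \<times> grid n" "\<lambda>q. exp (t * bil n x (fst q) (snd q))"] that finite_grid
          by simp
    also have "\<dots> \<le> exp (t\<^sup>2)" using g by (simp add: good_def)
    finally show ?thesis using t by (simp add: power2_eq_square)
  qed
  have unit: "L2_set (\<lambda>i. \<Sum>j<n. x (i,j) * v j) {..<n} \<le> t + 2" if v: "L2_set v {..<n} = 1" for v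
  proof (cases "L2_set (\<lambda>i. \<Sum>j<n. x (i,j) * v j) {..<n} = 0")
    case True
    then show ?thesis using t by (simp only:)
  next
    case False
    define y where "y = (\<lambda>i. \<Sum>j<n. x (i,j) * v j)"
    define Y where "Y = L2_set y {..<n}"
    have Y: "Y > 0" using False L2_set_nonneg[of y "{..<n}"] unfolding Y_def y_def by linarith
    define u where "u = (\<lambda>i. y i / Y)"
    have Lu: "L2_set u {..<n} = 1"
    proof -
      have "L2_set u {..<n} = L2_set (\<lambda>i. (1 / Y) * y i) {..<n}" by (simp add: u_def)
      also have "\<dots> = (1 / Y) * L2_set y {..<n}" using Y by (simp only: L2_set_right_distrib zero_le_divide_1_iff
          less_imp_le)
      finally show ?thesis using Y by (simp add: Y_def)
    qed
    obtain u' where u': "u' \<in> grid n" "L2_set (\<lambda>i. u i - u' i) {..<n} \<le> sqrt (real n) / (real n)\<^sup>2"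
      using grid_round[OF n, of u] Lu by auto
    obtain v' where v': "v' \<in> grid n" "L2_set (\<lambda>i. v i - v' i) {..<n} \<le> sqrt (real n) / (real n)\<^sup>2"
      using grid_round[OF n, of v] v by auto
    have "Y * Y = (\<Sum>i<n. (y i)\<^sup>2)" by (simp add: Y_def L2_set_def sum_nonneg)
    moreover have "bil n x u v = (\<Sum>i<n. u i * y i)" by (simp only: bil_eq y_def)
    moreover have "\<dots> = (\<Sum>i<n. (y i)\<^sup>2) / Y" by (simp add: u_def power2_eq_square sum_divide_distrib)
    ultimately have "bil n x u v = Y" using Y by (simp add: divide_eq_eq)
    moreover have "bil n x u v = bil n x u' v' + bil n x (\<lambda>i. u i - u' i) v + bil n x u' (\<lambda>i. v i - v' i)"
      unfolding bil_def sum.distrib[symmetric] by (intro sum.cong refl) (simp add: algebra_simps)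
    moreover have "bil n x (\<lambda>i. u i - u' i) v \<le> 1"
    proof -
      have "\<bar>bil n x (\<lambda>i. u i - u' i) v\<bar> \<le> L2_set (\<lambda>i. u i - u' i) {..<n} * (H * 1)"
        using bil_bound[of n x "\<lambda>i. u i - u' i" v] v by (simp only: H_def)
      also have "\<dots> \<le> sqrt (real n) / (real n)\<^sup>2 * (H * 1)" using u'(2) H0 by (intro mult_right_mono) auto
      finally show ?thesis using eps by simp
    qed
    moreover have "bil n x u' (\<lambda>i. v i - v' i) \<le> 1"
    proof -
      have Lu': "L2_set u' {..<n} \<le> 1" using u'(1) by (simp add: grid_def L2_set_def)
      have "\<bar>bil n x u' (\<lambda>i. v i - v' i)\<bar> \<le> L2_set u' {..<n} * (H * L2_set (\<lambda>i. v i - v' i) {..<n})"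
        using bil_bound[of n x u' "\<lambda>i. v i - v' i"] by (simp only: H_def)
      also have "\<dots> \<le> 1 * (H * (sqrt (real n) / (real n)\<^sup>2))" using Lu' v'(2) H0 by (intro mult_mono) auto
      finally show ?thesis using eps by (simp add: mult.commute)
    qed
    moreover have "bil n x u' v' \<le> t" by (rule gr[OF u'(1) v'(1)])
    ultimately show ?thesis unfolding Y_def y_def by linarith
  qed
  show ?thesis
  proof (cases "L2_set v {..<n} = 0")
    case True
    then have "\<forall>j<n. v j = 0" by (simp add: L2_set_eq_0_iff)
    then show ?thesis using True by (simp add: L2_set_def)
  next
    case False
    define V where "V = L2_set v {..<n}"
    have V: "V > 0" using False L2_set_nonneg[of v "{..<n}"] unfolding V_def by linarith
    have "L2_set (\<lambda>j. (1 / V) * v j) {..<n} = (1 / V) * V"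
      unfolding V_def[symmetric] using V by (simp only: L2_set_right_distrib[symmetric] zero_le_divide_1_iff
          less_imp_le V_def)
    then have "L2_set (\<lambda>i. \<Sum>j<n. x (i,j) * ((1 / V) * v j)) {..<n} \<le> t + 2" using V by (intro unit) simp
    also have "(\<lambda>i. \<Sum>j<n. x (i,j) * ((1 / V) * v j)) = (\<lambda>i. (1 / V) * (\<Sum>j<n. x (i,j) * v j))"
      by (simp add: sum_distrib_left mult_ac)
    also have "L2_set (\<lambda>i. (1 / V) * (\<Sum>j<n. x (i,j) * v j)) {..<n} = (1 / V) * L2_set (\<lambda>i. \<Sum>j<n. x (i,j) * v j)
        {..<n}"
      using V by (simp only: L2_set_right_distrib zero_le_divide_1_iff less_imp_le)
    finally show ?thesis using V unfolding V_def[symmetric] by (simp add: field_simps)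
  qed
qed

text \<open>A real matrix acts on real and imaginary parts separately.\<close>

lemma good_norm:
  assumes n: "n > 0" and t: "t > 0" and g: "good n t x"
  shows "nrm n (\<lambda>i. \<Sum>j<n. of_real (x (i,j)) * v j) \<le> (t + 2) * nrm n v"
proof -
  have r: "(\<Sum>i<n. (\<Sum>j<n. x (i,j) * u j)\<^sup>2) \<le> (t + 2)\<^sup>2 * (\<Sum>j<n. (u j)\<^sup>2)" for u
  proof -
    have "(L2_set (\<lambda>i. \<Sum>j<n. x (i,j) * u j) {..<n})\<^sup>2 \<le> ((t + 2) * L2_set u {..<n})\<^sup>2"
      by (intro power_mono good_real_norm[OF n t g]) simp
    then show ?thesis by (simp add: L2_set_def sum_nonneg power_mult_distrib)
  qed
  have "(\<Sum>i<n. (cmod (\<Sum>j<n. of_real (x (i,j)) * v j))\<^sup>2)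
     = (\<Sum>i<n. (\<Sum>j<n. x (i,j) * Re (v j))\<^sup>2) + (\<Sum>i<n. (\<Sum>j<n. x (i,j) * Im (v j))\<^sup>2)"
    by (simp add: cmod_power2 sum.distrib)
  also have "\<dots> \<le> (t + 2)\<^sup>2 * (\<Sum>j<n. (Re (v j))\<^sup>2) + (t + 2)\<^sup>2 * (\<Sum>j<n. (Im (v j))\<^sup>2)"
    by (intro add_mono r)
  also have "\<dots> = (t + 2)\<^sup>2 * (\<Sum>j<n. (cmod (v j))\<^sup>2)"
    by (simp add: cmod_power2 sum.distrib algebra_simps)
  finally have "sqrt (\<Sum>i<n. (cmod (\<Sum>j<n. of_real (x (i,j)) * v j))\<^sup>2) \<le> sqrt ((t + 2)\<^sup>2 * (\<Sum>j<n. (cmod (v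
      j))\<^sup>2))"
    by (rule real_sqrt_le_mono)
  then show ?thesis using t by (simp add: L2_set_def real_sqrt_mult)
qed

section \<open>The probability that the norm bound fails\<close>

lemma stdn_mgf: "(\<integral>\<^sup>+y. ennreal (exp (s * y)) \<partial>stdn) = ennreal (exp (s\<^sup>2 / 2))"
proof -
  interpret prob_space "density lborel (\<lambda>x. ennreal (normal_density s 1 x))"
    by (rule prob_space_normal_density) simp
  have one: "(\<integral>\<^sup>+x. ennreal (normal_density s 1 x) \<partial>lborel) = 1"
    using emeasure_space_1 by (simp add: emeasure_density)
  have "(\<integral>\<^sup>+y. ennreal (exp (s * y)) \<partial>stdn) = (\<integral>\<^sup>+y. ennreal (std_normal_density y) * ennreal (exp (s * y))
      \<partial>lborel)"
    unfolding stdn_def by (rule nn_integral_density) measurable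
  also have "\<dots> = (\<integral>\<^sup>+y. ennreal (exp (s\<^sup>2 / 2)) * ennreal (normal_density s 1 y) \<partial>lborel)"
  proof (intro nn_integral_cong)
    fix y :: real
    have "- y\<^sup>2 / 2 + s * y = s\<^sup>2 / 2 + - (y - s)\<^sup>2 / 2" by (simp add: power2_eq_square field_simps)
    then have "exp (- y\<^sup>2 / 2) * exp (s * y) = exp (s\<^sup>2 / 2) * exp (- (y - s)\<^sup>2 / 2)" by (simp only:
        exp_add[symmetric])
    then have "std_normal_density y * exp (s * y) = exp (s\<^sup>2 / 2) * normal_density s 1 y"
      by (simp add: normal_density_def field_simps)
    then show "ennreal (std_normal_density y) * ennreal (exp (s * y)) = ennreal (exp (s\<^sup>2 / 2)) * ennreal
        (normal_density s 1 y)"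
      by (simp add: ennreal_mult[symmetric])
  qed
  also have "\<dots> = ennreal (exp (s\<^sup>2 / 2)) * (\<integral>\<^sup>+y. ennreal (normal_density s 1 y) \<partial>lborel)"
    by (rule nn_integral_cmult) measurable
  finally show ?thesis by (simp add: one)
qed

lemma stdn_second_moment: "(\<integral>\<^sup>+y. ennreal (y\<^sup>2) \<partial>stdn) = 1"
proof -
  have "has_bochner_integral lborel (\<lambda>x. std_normal_density x * x ^ (2 * 1)) (fact (2 * 1) / (2 ^ 1 * fact 1))"
    by (rule std_normal_moment_even)
  then have h: "has_bochner_integral lborel (\<lambda>x. std_normal_density x * x\<^sup>2) 1" by simp
  have "(\<integral>\<^sup>+y. ennreal (y\<^sup>2) \<partial>stdn) = (\<integral>\<^sup>+y. ennreal (std_normal_density y) * ennreal (y\<^sup>2) \<partial>lborel)"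
    unfolding stdn_def by (rule nn_integral_density) measurable
  also have "\<dots> = (\<integral>\<^sup>+y. ennreal (std_normal_density y * y\<^sup>2) \<partial>lborel)"
    by (intro nn_integral_cong) (simp add: ennreal_mult)
  also have "\<dots> = ennreal 1"
    using h by (subst nn_integral_eq_integral) (auto simp: has_bochner_integral_iff)
  finally show ?thesis by simp
qed

abbreviation gauss :: "nat \<Rightarrow> (nat \<times> nat \<Rightarrow> real) measure" where
  "gauss n \<equiv> PiM ({..<n} \<times> {..<n}) (\<lambda>_. stdn)"

lemma prob_space_gauss: "prob_space (gauss n)"
  by (rule prob_space_PiM) (rule prob_space_stdn)

lemma good_measurable [measurable]: "Measurable.pred (gauss n) (good n t)"
proof -
  have [measurable]: "(\<lambda>x. bil n x u v) \<in> borel_measurable (gauss n)" for u v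
    unfolding bil_def by measurable
  show ?thesis unfolding good_def[abs_def] by measurable
qed

lemma bil_mgf:
  assumes "u \<in> grid n" "v \<in> grid n"
  shows "(\<integral>\<^sup>+x. ennreal (exp (t * bil n x u v)) \<partial>gauss n) \<le> ennreal (exp (t\<^sup>2 / 2))"
proof -
  interpret product_prob_space "\<lambda>_::nat \<times> nat. stdn" by (rule product_prob_space_stdn)
  let ?I = "{..<n} \<times> {..<n}"
  let ?a = "\<lambda>p. t * (u (fst p) * v (snd p))"
  have "(\<integral>\<^sup>+x. ennreal (exp (t * bil n x u v)) \<partial>gauss n) = (\<integral>\<^sup>+x. (\<Prod>p\<in>?I. ennreal (exp (?a p * x p))) \<partial>gauss n)"
    by (simp add: bil_def sum_distrib_left exp_sum prod_ennreal mult.assoc)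
  also have "\<dots> = (\<Prod>p\<in>?I. \<integral>\<^sup>+y. ennreal (exp (?a p * y)) \<partial>stdn)"
    by (rule product_nn_integral_prod) auto
  also have "\<dots> = ennreal (exp (\<Sum>p\<in>?I. (?a p)\<^sup>2 / 2))"
    by (simp add: stdn_mgf prod_ennreal exp_sum)
  also have "(\<Sum>p\<in>?I. (?a p)\<^sup>2 / 2) = t\<^sup>2 / 2 * ((\<Sum>i<n. (u i)\<^sup>2) * (\<Sum>j<n. (v j)\<^sup>2))"
  proof -
    have "(\<Sum>p\<in>?I. (?a p)\<^sup>2 / 2) = (\<Sum>p\<in>?I. t\<^sup>2 / 2 * ((u (fst p))\<^sup>2 * (v (snd p))\<^sup>2))"
      by (simp add: power_mult_distrib)
    also have "\<dots> = t\<^sup>2 / 2 * (\<Sum>p\<in>?I. (u (fst p))\<^sup>2 * (v (snd p))\<^sup>2)" by (rule sum_distrib_left[symmetric])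
    also have "(\<Sum>p\<in>?I. (u (fst p))\<^sup>2 * (v (snd p))\<^sup>2) = (\<Sum>i<n. (u i)\<^sup>2) * (\<Sum>j<n. (v j)\<^sup>2)"
      unfolding sum_product by (simp add: sum.cartesian_product')
    finally show ?thesis .
  qed
  also have "ennreal (exp \<dots>) \<le> ennreal (exp (t\<^sup>2 / 2))"
  proof -
    have "(\<Sum>i<n. (u i)\<^sup>2) * (\<Sum>j<n. (v j)\<^sup>2) \<le> 1 * 1"
      using assms by (intro mult_mono) (auto simp: grid_def sum_nonneg)
    then show ?thesis by (intro ennreal_leI) (simp add: mult_left_le)
  qed
  finally show ?thesis .
qed

text \<open>Markov's inequality for each half of \<open>good\<close>: the exponential sum has mean
  at most the squared size of the grid times \<open>exp (t\<^sup>2 / 2)\<close>, against the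
  threshold \<open>exp (t\<^sup>2)\<close>; the sum of squares has mean \<open>n\<^sup>2\<close>,
  against \<open>n ^ 3\<close>.\<close>

lemma prob_not_good:
  assumes n: "n > 0"
  shows "emeasure (gauss n) {x\<in>space (gauss n). \<not> good n t x}
     \<le> ennreal ((2 * (real n)\<^sup>2 + 1) ^ (2 * n) * exp (- t\<^sup>2 / 2) + 1 / real n)"
proof -
  interpret product_prob_space "\<lambda>_::nat \<times> nat. stdn" by (rule product_prob_space_stdn)
  let ?I = "{..<n} \<times> {..<n}" and ?W = "\<lambda>x. \<Sum>q\<in>grid n \<times> grid n. exp (t * bil n x (fst q) (snd q))"
  let ?H = "\<lambda>x. \<Sum>p\<in>{..<n} \<times> {..<n}. (x p)\<^sup>2 :: real"
  have [measurable]: "(\<lambda>x. bil n x u v) \<in> borel_measurable (gauss n)" for u v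
    unfolding bil_def by measurable
  have W: "(\<integral>\<^sup>+x. ennreal (?W x) \<partial>gauss n) \<le> ennreal ((2 * (real n)\<^sup>2 + 1) ^ (2 * n) * exp (t\<^sup>2 / 2))"
  proof -
    have "(\<integral>\<^sup>+x. ennreal (?W x) \<partial>gauss n) = (\<integral>\<^sup>+x. (\<Sum>q\<in>grid n \<times> grid n. ennreal (exp (t * bil n x (fst q) (snd
        q)))) \<partial>gauss n)"
      by (simp add: sum_ennreal)
    also have "\<dots> = (\<Sum>q\<in>grid n \<times> grid n. \<integral>\<^sup>+x. ennreal (exp (t * bil n x (fst q) (snd q))) \<partial>gauss n)"
      by (rule nn_integral_sum) measurable
    also have "\<dots> \<le> (\<Sum>q\<in>grid n \<times> grid n. ennreal (exp (t\<^sup>2 / 2)))"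
      by (intro sum_mono bil_mgf) auto
    also have "\<dots> = ennreal (real (card (grid n) * card (grid n)) * exp (t\<^sup>2 / 2))"
      by (simp add: card_cartesian_product ennreal_mult ennreal_of_nat_eq_real_of_nat)
    also have "\<dots> \<le> ennreal ((2 * (real n)\<^sup>2 + 1) ^ (2 * n) * exp (t\<^sup>2 / 2))"
    proof (intro ennreal_leI mult_right_mono)
      have "card (grid n) * card (grid n) \<le> (2 * n\<^sup>2 + 1) ^ n * (2 * n\<^sup>2 + 1) ^ n"
        by (intro mult_mono card_grid) auto
      also have "\<dots> = (2 * n\<^sup>2 + 1) ^ (2 * n)" by (simp add: power_add[symmetric] mult_2)
      finally have "real (card (grid n) * card (grid n)) \<le> real ((2 * n\<^sup>2 + 1) ^ (2 * n))" by (simp only: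
          of_nat_le_iff)
      then show "real (card (grid n) * card (grid n)) \<le> (2 * (real n)\<^sup>2 + 1) ^ (2 * n)" by (simp add:
          add.commute)
    qed simp
    finally show ?thesis .
  qed
  have H: "(\<integral>\<^sup>+x. ennreal (?H x) \<partial>gauss n) = ennreal ((real n)\<^sup>2)"
  proof -
    have c: "(\<integral>\<^sup>+x. ennreal ((x p)\<^sup>2) \<partial>gauss n) = 1" if "p \<in> ?I" for p
    proof -
      have "(\<integral>\<^sup>+x. ennreal ((x p)\<^sup>2) \<partial>gauss n) = (\<integral>\<^sup>+y. ennreal (y\<^sup>2) \<partial>distr (gauss n) stdn (\<lambda>x. x p))"
        using that by (subst nn_integral_distr) auto
      also have "distr (gauss n) stdn (\<lambda>x. x p) = stdn" by (rule distr_PiM_component[OF prob_space_stdn that])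
      finally show ?thesis by (simp add: stdn_second_moment)
    qed
    have "(\<integral>\<^sup>+x. ennreal (?H x) \<partial>gauss n) = (\<integral>\<^sup>+x. (\<Sum>p\<in>?I. ennreal ((x p)\<^sup>2)) \<partial>gauss n)"
      by (simp add: sum_ennreal)
    also have "\<dots> = (\<Sum>p\<in>?I. \<integral>\<^sup>+x. ennreal ((x p)\<^sup>2) \<partial>gauss n)"
      by (rule nn_integral_sum) measurable
    also have "\<dots> = (\<Sum>p\<in>?I. 1)" by (intro sum.cong refl c)
    finally show ?thesis by (simp add: power2_eq_square ennreal_of_nat_eq_real_of_nat ennreal_mult)
  qed
  have "{x\<in>space (gauss n). \<not> good n t x} \<subseteq> {x\<in>space (gauss n). 1 \<le> ennreal (exp (- t\<^sup>2)) * ennreal (?W x)}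
     \<union> {x\<in>space (gauss n). 1 \<le> ennreal (1 / real n ^ 3) * ennreal (?H x)}"
  proof (rule subsetI)
    fix x assume "x \<in> {x\<in>space (gauss n). \<not> good n t x}"
    then have "x \<in> space (gauss n)" and *: "exp (t\<^sup>2) < ?W x \<or> real n ^ 3 < ?H x" by (auto simp: good_def
        not_le)
    from * show "x \<in> {x\<in>space (gauss n). 1 \<le> ennreal (exp (- t\<^sup>2)) * ennreal (?W x)}
     \<union> {x\<in>space (gauss n). 1 \<le> ennreal (1 / real n ^ 3) * ennreal (?H x)}"
    proof
      assume "exp (t\<^sup>2) < ?W x"
      then have "1 \<le> exp (- t\<^sup>2) * ?W x" by (simp add: exp_minus field_simps)
      then have "1 \<le> ennreal (exp (- t\<^sup>2) * ?W x)" using ennreal_leI by fastforce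
      then show ?thesis using \<open>x \<in> space _\<close> by (simp add: ennreal_mult sum_nonneg)
    next
      assume "real n ^ 3 < ?H x"
      then have "1 \<le> 1 / real n ^ 3 * ?H x" using n by (simp add: field_simps)
      then have "1 \<le> ennreal (1 / real n ^ 3 * ?H x)" using ennreal_leI by fastforce
      moreover have "ennreal (1 / real n ^ 3 * ?H x) = ennreal (1 / real n ^ 3) * ennreal (?H x)"
        by (rule ennreal_mult) (simp_all add: sum_nonneg)
      ultimately have "1 \<le> ennreal (1 / real n ^ 3) * ennreal (?H x)" by (simp only:)
      then show ?thesis using \<open>x \<in> space _\<close> by blast
    qed
  qed
  then have "emeasure (gauss n) {x\<in>space (gauss n). \<not> good n t x}
     \<le> emeasure (gauss n) ({x\<in>space (gauss n). 1 \<le> ennreal (exp (- t\<^sup>2)) * ennreal (?W x)}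
     \<union> {x\<in>space (gauss n). 1 \<le> ennreal (1 / real n ^ 3) * ennreal (?H x)})"
    by (rule emeasure_mono) measurable
  also have "\<dots> \<le> emeasure (gauss n) {x\<in>space (gauss n). 1 \<le> ennreal (exp (- t\<^sup>2)) * ennreal (?W x)}
     + emeasure (gauss n) {x\<in>space (gauss n). 1 \<le> ennreal (1 / real n ^ 3) * ennreal (?H x)}"
    by (rule emeasure_subadditive) measurable
  also have "\<dots> \<le> ennreal (exp (- t\<^sup>2)) * (\<integral>\<^sup>+x. ennreal (?W x) \<partial>gauss n) + ennreal (1 / real n ^ 3) * (\<integral>\<^sup>+x.
      ennreal (?H x) \<partial>gauss n)"
  proof (intro add_mono)
    show "emeasure (gauss n) {x\<in>space (gauss n). 1 \<le> ennreal (exp (- t\<^sup>2)) * ennreal (?W x)} \<le> ennreal (exp (-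
        t\<^sup>2)) * (\<integral>\<^sup>+x. ennreal (?W x) \<partial>gauss n)"
      using nn_integral_Markov_inequality[of "\<lambda>x. ennreal (?W x)" "space (gauss n)" "gauss n" "ennreal (exp (-
          t\<^sup>2))"]
      by (simp add: nn_set_integral_space)
    show "emeasure (gauss n) {x\<in>space (gauss n). 1 \<le> ennreal (1 / real n ^ 3) * ennreal (?H x)} \<le> ennreal (1 /
        real n ^ 3) * (\<integral>\<^sup>+x. ennreal (?H x) \<partial>gauss n)"
      using nn_integral_Markov_inequality[of "\<lambda>x. ennreal (?H x)" "space (gauss n)" "gauss n" "ennreal (1 / real
          n ^ 3)"]
      by (simp add: nn_set_integral_space)
  qed
  also have "\<dots> \<le> ennreal (exp (- t\<^sup>2)) * ennreal ((2 * (real n)\<^sup>2 + 1) ^ (2 * n) * exp (t\<^sup>2 / 2)) + ennreal (1 /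
      real n ^ 3) * ennreal ((real n)\<^sup>2)"
    unfolding H using W by (intro add_mono mult_left_mono) auto
  also have "\<dots> = ennreal (exp (- t\<^sup>2) * ((2 * (real n)\<^sup>2 + 1) ^ (2 * n) * exp (t\<^sup>2 / 2)) + 1 / real n ^ 3 *
      (real n)\<^sup>2)"
    by (simp add: ennreal_mult[symmetric] ennreal_plus[symmetric] del: ennreal_plus)
  also have "exp (- t\<^sup>2) * ((2 * (real n)\<^sup>2 + 1) ^ (2 * n) * exp (t\<^sup>2 / 2)) = (2 * (real n)\<^sup>2 + 1) ^ (2 * n) *
      exp (- t\<^sup>2 / 2)"
  proof -
    have "exp (- t\<^sup>2) * exp (t\<^sup>2 / 2) = exp (- t\<^sup>2 / 2)" by (simp flip: exp_add)
    then show ?thesis by (metis mult.left_commute)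
  qed
  also have "1 / real n ^ 3 * (real n)\<^sup>2 = 1 / real n" using n by (simp add: power2_eq_square power3_eq_cube)
  finally show ?thesis .
qed

section \<open>Bounds at a fixed spectral parameter\<close>

lemma ln_fact_lower: "real k * ln (real k) - real k \<le> ln (fact k)"
proof (induct k)
  case (Suc k)
  show ?case
  proof (cases "k = 0")
    case False
    then have k: "real k > 0" by simp
    have "real (Suc k) = real k * (1 + 1 / real k)" using k by (simp add: distrib_left)
    then have "ln (real (Suc k)) = ln (real k * (1 + 1 / real k))" by (simp only:)
    also have "\<dots> = ln (real k) + ln (1 + 1 / real k)"
    proof -
      have "1 + 1 / real k > 0" using k by (simp add: add_pos_pos)
      then show ?thesis using k by (intro ln_mult_pos)
    qed
    also have "ln (1 + 1 / real k) \<le> 1 / real k" using k by (intro ln_add_one_self_le_self) simp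
    finally have "real k * ln (real (Suc k)) \<le> real k * (ln (real k) + 1 / real k)" using k by (intro
        mult_left_mono) auto
    also have "\<dots> = real k * ln (real k) + 1" using k by (simp add: field_simps)
    finally have "real k * ln (real (Suc k)) \<le> real k * ln (real k) + 1" .
    moreover have "ln (fact (Suc k)) = ln (real (Suc k)) + ln (fact k)" using fact_gt_zero by (simp add: ln_mult
        del: of_nat_Suc)
    ultimately show ?thesis using Suc by (simp add: algebra_simps)
  qed simp
qed simp

text \<open>Measures how far \<open>sqrt (s!)\<close>, the gain of \<open>s\<close> Gaussian rows,
  falls short of the factor \<open>n powr (s / 2)\<close> contained in \<open>thr ^ s\<close>. By
  \<open>ln y \<le> y\<close> at a square root the defect is at most of order
  \<open>sqrt (l * n)\<close>, which is \<open>o(n)\<close> when \<open>l\<close> is.\<close>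

lemma entropy_bound:
  assumes "0 < s" "s \<le> (l::real)" "0 < n"
  shows "s * ln (n / s) \<le> 2 * sqrt (l * n)"
proof -
  define y where "y = sqrt (n / s)"
  have y: "y > 0" using assms by (simp add: y_def)
  have "ln (n / s) = ln (y\<^sup>2)" using assms by (simp add: y_def)
  also have "\<dots> = 2 * ln y" using y by (simp add: ln_realpow)
  also have "ln y \<le> y" using ln_le_minus_one[OF y] by simp
  finally have "s * ln (n / s) \<le> s * (2 * y)" using assms by (intro mult_left_mono) auto
  also have "\<dots> = 2 * sqrt (s * n)"
  proof -
    have "s * y = sqrt (s * n)"
      unfolding y_def using assms by (simp add: real_sqrt_divide real_sqrt_mult real_div_sqrt field_simps)
    then show ?thesis by simp
  qed
  also have "\<dots> \<le> 2 * sqrt (l * n)" using assms by (simp add: mult_right_mono)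
  finally show ?thesis .
qed

lemma ln_one_minus_half: "0 \<le> (\<kappa>::real) \<Longrightarrow> \<kappa> \<le> 1/2 \<Longrightarrow> - 2 * \<kappa> \<le> ln (1 - \<kappa>)"
proof -
  assume k: "0 \<le> \<kappa>" "\<kappa> \<le> 1/2"
  have "ln (1 / (1 - \<kappa>)) \<le> 1 / (1 - \<kappa>) - 1" using k by (intro ln_le_minus_one) auto
  also have "\<dots> = \<kappa> / (1 - \<kappa>)" using k by (simp add: field_simps)
  also have "\<dots> \<le> \<kappa> / (1/2)" using k by (intro divide_left_mono) auto
  finally show ?thesis using k by (simp add: ln_div)
qed

text \<open>The parameters at one dimension \<open>n\<close>: \<open>\<delta>\<close> is the noise
  level, \<open>t\<close> the level of the norm event, \<open>\<theta>\<close> the half-width of the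
  annuli of exceptional blocks, and \<open>\<tau>\<close> the threshold for small determinants,
  larger than \<open>thr\<close> by \<open>n powr (3 * \<eta>)\<close>. The condition
  \<open>small\<close> says that on the norm event the noise is at most \<open>\<kappa>\<close>
  times the lower bound \<open>smin\<close> of the modified matrix.\<close>

locale core =
  fixes l :: nat and d :: "nat \<Rightarrow> nat" and c :: "nat \<Rightarrow> complex" and n :: nat
    and \<gamma> \<eta> t \<kappa> \<theta> \<tau> \<delta> :: real
  assumes d_pos: "\<And>i. i < l \<Longrightarrow> d i > 0" and n: "n = bstart d l" and n3: "n \<ge> 3"
    and \<delta>_def: "\<delta> = real n powr (-\<gamma>)" and \<tau>_def: "\<tau> = real n powr (-\<gamma> + 1/2 + 3 * \<eta>)"
    and \<theta>_def: "\<theta> = real n powr (-\<eta>)" and \<theta>_half: "\<theta> \<le> 1/2"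
    and \<gamma>: "\<gamma> > 1/2 + 3 * \<eta>" and \<eta>: "\<eta> > 0" and t: "t > 0" and \<kappa>: "0 \<le> \<kappa>" "\<kappa> \<le> 1/2"
    and small: "\<delta> * (t + 2) \<le> \<kappa> * (\<theta>\<^sup>2 * \<tau> / 3)"
begin

text \<open>\<open>thr\<close> is \<open>r i ^ d i\<close>, so \<open>target z / n\<close> is the potential of the circle mixture. Only the bottom row of a
  block in \<open>Sm z\<close> is modified, all rows of a block in \<open>Bad z\<close>; \<open>Lam\<close> is the resulting loss.\<close>

definition "thr = \<delta> * sqrt (real n)"
definition "w z i = z - c i"
definition "Bad z = {i\<in>{..<l}. 1 - \<theta> < cmod (z - c i) \<and> cmod (z - c i) < 1 + \<theta>}"
definition "Sm z = {i\<in>{..<l}. cmod (z - c i) \<le> 1 - \<theta> \<and> cmod (z - c i) ^ d i < \<tau>}"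
definition "target z = (\<Sum>i<l. ln (max (cmod (z - c i) ^ d i) thr))"
definition "nb z = (\<Sum>i\<in>Bad z. real (d i))"
text \<open>The first term is the ratio of \<open>\<tau>\<close> to \<open>thr\<close> for each
  small block. In the second, \<open>\<gamma> * ln n\<close> per row pays for the noise level
  \<open>\<delta>\<close> of rows of exceptional blocks, which bring no \<open>thr\<close>. The
  square root is the entropy defect, \<open>2 * \<kappa> * n\<close> comes from
  \<open>det_perturb\<close>, and the constants 10 collect numerical factors per modified
  row.\<close>

definition "Lam z = 3 * \<eta> * ln (real n) * real (card (Sm z)) + (10 + \<gamma>) * ln (real n) * nb z
   + 10 * real l + sqrt (real l * real n) + 2 * \<kappa> * real n"
definition "Xmat z x = mat n n (\<lambda>(i,j). block_diag l (\<lambda>i. cyc_block (d i) (\<lambda>_. z - c i) (\<lambda>_. 1) 0) $$ (i,j) -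
    of_real \<delta> * of_real (x (i,j)))"

lemma ln_n: "ln (real n) \<ge> 1"
proof -
  have "exp 1 \<le> (3::real)" by (rule exp_le)
  also have "3 \<le> real n" using n3 by simp
  finally have "ln (exp 1) \<le> ln (real n)" using n3 by (subst ln_le_cancel_iff) auto
  then show ?thesis by simp
qed

lemma params: "\<delta> > 0" "0 < \<tau>" "\<tau> \<le> 1" "0 < \<theta>" "\<theta> \<le> 1" "0 < thr" "thr \<le> \<tau>" "thr \<le> 1"
  "ln \<delta> = - \<gamma> * ln (real n)" "ln thr = (1/2 - \<gamma>) * ln (real n)" "ln \<tau> = (1/2 - \<gamma> + 3 * \<eta>) * ln (real n)"
proof -
  have n1: "real n > 1" using n3 by simp
  then have n0: "real n > 0" by simp
  have thr: "thr = real n powr (1/2 - \<gamma>)"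
    unfolding thr_def by (subst \<delta>_def) (use n0 in \<open>simp add: powr_half_sqrt[symmetric] powr_add[symmetric]\<close>)
  show "\<delta> > 0" "0 < \<tau>" "0 < \<theta>" using n0 by (auto simp: \<delta>_def \<tau>_def \<theta>_def)
  show "0 < thr" unfolding thr using n0 by simp
  show "\<theta> \<le> 1" using \<theta>_half by simp
  show "ln \<delta> = - \<gamma> * ln (real n)" using n0 by (simp add: \<delta>_def ln_powr)
  show "ln thr = (1/2 - \<gamma>) * ln (real n)" using n0 by (simp add: thr ln_powr)
  show "ln \<tau> = (1/2 - \<gamma> + 3 * \<eta>) * ln (real n)" using n0 by (simp add: \<tau>_def ln_powr algebra_simps)
  show "thr \<le> \<tau>" unfolding thr \<tau>_def using n1 \<eta> by (intro powr_mono) auto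
  show "\<tau> \<le> 1"
  proof -
    have "\<tau> \<le> real n powr 0" unfolding \<tau>_def using n1 \<gamma> by (intro powr_mono) auto
    then show ?thesis using n0 by simp
  qed
  with \<open>thr \<le> \<tau>\<close> show "thr \<le> 1" by simp
qed

lemma block_split: "block_split l d (w z) (Sm z) (Bad z) \<theta> \<tau>"
proof
  show "0 < d i" if "i < l" for i using that by (rule d_pos)
  show "Sm z \<inter> Bad z = {}" by (auto simp: Sm_def Bad_def)
  show "cmod (w z i) \<ge> 1 + \<theta> \<or> cmod (w z i) \<le> 1 - \<theta> \<and> cmod (w z i) ^ d i \<ge> \<tau>"
    if "i < l" "i \<notin> Sm z" "i \<notin> Bad z" for i
    using that by (auto simp: Sm_def Bad_def w_def not_less)
qed (use params in \<open>auto simp: Sm_def Bad_def w_def\<close>)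

context
  fixes z :: complex
begin

interpretation block_split l d "w z" "Sm z" "Bad z" \<theta> \<tau> by (rule block_split)

lemma N_eq: "N = n" by (simp add: N_def n)

lemma A0_eq: "A0 = block_diag l (\<lambda>i. cyc_block (d i) (\<lambda>_. z - c i) (\<lambda>_. 1) 0)"
  by (simp add: A0_def w_def)

lemma nb_eq: "nb z = real nbad" by (simp add: nb_def nbad_def)

text \<open>On untouched blocks the maximum with \<open>thr\<close> in \<open>target\<close> is
  attained by the determinant, so their contribution to the target is exactly
  \<open>ln prest\<close>.\<close>

lemma rest_ge: "i \<in> {..<l} - Sm z - Bad z \<Longrightarrow> thr \<le> cmod (z - c i) ^ d i"
proof -
  assume i: "i \<in> {..<l} - Sm z - Bad z"
  then consider "1 \<le> cmod (z - c i)" | "\<tau> \<le> cmod (z - c i) ^ d i"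
    using w_rest[of i] params by (auto simp: w_def)
  then show ?thesis
  proof cases
    case 1
    then have "1 \<le> cmod (z - c i) ^ d i" by (rule one_le_power)
    then show ?thesis using params by linarith
  next
    case 2 then show ?thesis using params by linarith
  qed
qed

lemma prest_pos: "prest > 0"
  unfolding prest_def w_def using rest_ge params by (intro prod_pos) (auto intro: order.strict_trans2)

lemma target_split: "target z = ln prest + (\<Sum>i\<in>Sm z. ln (max (cmod (z - c i) ^ d i) thr)) + (\<Sum>i\<in>Bad z. ln (max
    (cmod (z - c i) ^ d i) thr))"
proof -
  let ?f = "\<lambda>i. ln (max (cmod (z - c i) ^ d i) thr)"
  have 1: "{..<l} = ({..<l} - Sm z - Bad z) \<union> Sm z \<union> Bad z" using S_sub Bad_sub by auto
  have "target z = (\<Sum>i\<in>({..<l} - Sm z - Bad z) \<union> Sm z \<union> Bad z. ?f i)"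
    unfolding target_def by (rule sum.cong[OF 1 refl])
  also have "\<dots> = (\<Sum>i\<in>({..<l} - Sm z - Bad z) \<union> Sm z. ?f i) + (\<Sum>i\<in>Bad z. ?f i)"
    using finite_SB disj by (intro sum.union_disjoint) auto
  also have "(\<Sum>i\<in>({..<l} - Sm z - Bad z) \<union> Sm z. ?f i) = (\<Sum>i\<in>{..<l} - Sm z - Bad z. ?f i) + (\<Sum>i\<in>Sm z. ?f i)"
    using finite_SB by (intro sum.union_disjoint) auto
  also have "(\<Sum>i\<in>{..<l} - Sm z - Bad z. ?f i) = (\<Sum>i\<in>{..<l} - Sm z - Bad z. ln (cmod (z - c i) ^ d i))"
    using rest_ge by (intro sum.cong refl) (auto simp: max_absorb1)
  also have "\<dots> = ln prest"
  proof -
    have "0 < cmod (z - c i) ^ d i" if "i \<in> {..<l} - Sm z - Bad z" for i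
      using rest_ge[OF that] params(6) by linarith
    then have "cmod (z - c i) ^ d i \<noteq> 0" if "i \<in> {..<l} - Sm z - Bad z" for i
      using that by (metis less_irrefl)
    then show ?thesis unfolding prest_def w_def by (intro ln_prod[symmetric]) simp_all
  qed
  finally show ?thesis .
qed

lemma target_S: "real (card (Sm z)) * ln thr \<le> (\<Sum>i\<in>Sm z. ln (max (cmod (z - c i) ^ d i) thr))"
  "(\<Sum>i\<in>Sm z. ln (max (cmod (z - c i) ^ d i) thr)) \<le> real (card (Sm z)) * ln \<tau>"
proof -
  have "(\<Sum>i\<in>Sm z. ln thr) \<le> (\<Sum>i\<in>Sm z. ln (max (cmod (z - c i) ^ d i) thr))"
    using params(6) by (intro sum_mono ln_mono) auto
  then show "real (card (Sm z)) * ln thr \<le> (\<Sum>i\<in>Sm z. ln (max (cmod (z - c i) ^ d i) thr))" by simp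
  have "(\<Sum>i\<in>Sm z. ln (max (cmod (z - c i) ^ d i) thr)) \<le> (\<Sum>i\<in>Sm z. ln \<tau>)"
    using params(2,6,7) by (intro sum_mono ln_mono) (auto simp: Sm_def)
  then show "(\<Sum>i\<in>Sm z. ln (max (cmod (z - c i) ^ d i) thr)) \<le> real (card (Sm z)) * ln \<tau>" by simp
qed

lemma target_Bad: "- nb z \<le> (\<Sum>i\<in>Bad z. ln (max (cmod (z - c i) ^ d i) thr))"
  "(\<Sum>i\<in>Bad z. ln (max (cmod (z - c i) ^ d i) thr)) \<le> nb z"
proof -
  have l2: "ln 2 \<le> (1::real)" using ln_le_minus_one[of 2] by simp
  have a: "ln (max (cmod (z - c i) ^ d i) thr) \<le> real (d i)" "- real (d i) \<le> ln (max (cmod (z - c i) ^ d i)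
      thr)" if i: "i \<in> Bad z" for i
  proof -
    have b: "1/2 \<le> cmod (z - c i)" "cmod (z - c i) \<le> 2" using i \<theta>_half by (auto simp: Bad_def)
    have "max (cmod (z - c i) ^ d i) thr \<le> 2 ^ d i"
    proof -
      have "cmod (z - c i) ^ d i \<le> 2 ^ d i" using b by (intro power_mono) auto
      moreover have "(1::real) \<le> 2 ^ d i" by simp
      ultimately show ?thesis using params(8) by (intro max.boundedI) linarith+
    qed
    then have "ln (max (cmod (z - c i) ^ d i) thr) \<le> ln (2 ^ d i)" using params(6) by (intro ln_mono) auto
    also have "\<dots> = real (d i) * ln 2" by (simp add: ln_realpow)
    also have "\<dots> \<le> real (d i)" using l2 by (simp add: mult_left_le)
    finally show "ln (max (cmod (z - c i) ^ d i) thr) \<le> real (d i)" .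
    have "(1/2) ^ d i \<le> max (cmod (z - c i) ^ d i) thr" using b by (intro max.coboundedI1 power_mono) auto
    then have "ln ((1/2) ^ d i) \<le> ln (max (cmod (z - c i) ^ d i) thr)" by (intro ln_mono) auto
    moreover have "ln ((1/2::real) ^ d i) = - (real (d i) * ln 2)" by (simp add: ln_realpow ln_div)
    moreover have "real (d i) * ln 2 \<le> real (d i)" using l2 by (simp add: mult_left_le)
    ultimately show "- real (d i) \<le> ln (max (cmod (z - c i) ^ d i) thr)" by linarith
  qed
  show "(\<Sum>i\<in>Bad z. ln (max (cmod (z - c i) ^ d i) thr)) \<le> nb z" unfolding nb_def using a by (intro sum_mono)
  show "- nb z \<le> (\<Sum>i\<in>Bad z. ln (max (cmod (z - c i) ^ d i) thr))"
    unfolding nb_def sum_negf[symmetric] using a by (intro sum_mono)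
qed

lemma nb_nonneg: "nb z \<ge> 0" by (simp add: nb_def sum_nonneg)

lemma card_Sm: "real (card (Sm z)) \<le> real l"
proof -
  have "card (Sm z) \<le> card {..<l}" using S_sub by (intro card_mono) auto
  then show ?thesis by simp
qed

lemma nb_ln: "nb z \<le> ln (real n) * nb z" using ln_n nb_nonneg by (simp add: mult_left_le mult_le_cancel_right1)

definition "noise x = mat n n (\<lambda>(i,j). - of_real \<delta> * of_real (x (i,j)) :: complex)"

lemma noise_bound:
  assumes "good n t x"
  shows "nrm N (mv (noise x) v) \<le> \<kappa> * smin * nrm N v"
proof -
  have "nrm n (mv (noise x) v) = L2_set (\<lambda>i. \<delta> * cmod (\<Sum>j<n. of_real (x (i,j)) * v j)) {..<n}"
  proof (rule L2_set_cong[OF refl])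
    fix i assume "i \<in> {..<n}"
    then have "mv (noise x) v i = - of_real \<delta> * (\<Sum>j<n. of_real (x (i,j)) * v j)"
      by (auto simp: mv_def noise_def sum_distrib_left mult.assoc intro!: sum.cong)
    then show "cmod (mv (noise x) v i) = \<delta> * cmod (\<Sum>j<n. of_real (x (i,j)) * v j)"
      using params by (simp only: norm_mult norm_minus_cancel norm_of_real abs_of_pos)
  qed
  also have "\<dots> = \<delta> * nrm n (\<lambda>i. \<Sum>j<n. of_real (x (i,j)) * v j)" using params by (simp add: L2_set_right_distrib)
  also have "\<dots> \<le> \<delta> * ((t + 2) * nrm n v)" using params n3 by (intro mult_left_mono good_norm assms t) auto
  also have "\<dots> = \<delta> * (t + 2) * nrm n v" by simp
  also have "\<dots> \<le> \<kappa> * smin * nrm n v" unfolding smin_def by (intro mult_right_mono small) simp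
  finally show ?thesis by (simp add: N_eq)
qed

text \<open>Taking logarithms in \<open>upper_det\<close>. Each small block enters with
  \<open>2 * \<tau>\<close> where the target has at least \<open>thr\<close>, which costs
  \<open>3 * \<eta> * ln n\<close> up to a constant.\<close>

lemma upper_core:
  assumes g: "good n t x"
  shows "cmod (det (Xmat z x)) \<le> exp (target z + Lam z)"
proof -
  have A0c: "A0 \<in> carrier_mat n n" using A0_carrier by (simp add: N_eq)
  have X: "Xmat z x = A0 + noise x"
    by (rule eq_matI) (use A0c in \<open>auto simp: Xmat_def A0_eq noise_def\<close>)
  let ?s = "card (Sm z)"
  have "cmod (det (Xmat z x)) \<le> 2 ^ card Q * (prest * (2 * \<tau>) ^ ?s * 6 ^ nbad * (1 + \<kappa>) ^ N)"
    unfolding X using \<kappa>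
  proof (intro upper_det[OF _ _ _ noise_bound[OF g]])
    show "noise x \<in> carrier_mat N N" by (simp add: noise_def N_eq)
    show "cmod (w z i) ^ d i \<le> \<tau>" if "i \<in> Sm z" for i using that by (simp add: Sm_def w_def)
    show "cmod (w z i) \<le> 2" if "i \<in> Bad z" for i using that \<theta>_half by (simp add: Bad_def w_def)
  qed auto
  also have "\<dots> = exp (ln \<dots>)"
    using prest_pos params \<kappa> by (intro exp_ln[symmetric] mult_pos_pos zero_less_power) auto
  also have "ln (2 ^ card Q * (prest * (2 * \<tau>) ^ ?s * 6 ^ nbad * (1 + \<kappa>) ^ N))
     = real (card Q) * ln 2 + (ln prest + real ?s * (ln 2 + ln \<tau>) + real nbad * ln 6 + real N * ln (1 + \<kappa>))"
    using prest_pos params \<kappa> by (simp add: ln_mult ln_realpow distrib_left)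
  also have "exp \<dots> \<le> exp (target z + Lam z)"
  proof -
    have l2: "ln 2 \<le> (1::real)" using ln_le_minus_one[of 2] by simp
    have l6: "ln 6 \<le> (5::real)" using ln_le_minus_one[of 6] by simp
    have k: "real N * ln (1 + \<kappa>) \<le> \<kappa> * real n"
      using mult_left_mono[OF ln_add_one_self_le_self[OF \<kappa>(1)], of "real n"] by (simp add: N_eq mult.commute)
    have cq: "real (card Q) = real ?s + nb z" by (simp add: card_Q nb_eq)
    have q: "real (card Q) * ln 2 \<le> real ?s + nb z" unfolding cq using l2 nb_nonneg by (intro mult_left_le) auto
    have s: "real ?s * ln 2 \<le> real ?s" using l2 by (intro mult_left_le) auto
    have b: "real nbad * ln 6 \<le> 5 * nb z" using mult_left_mono[OF l6, of "real nbad"] by (simp add: nb_eq)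
    have tt: "real ?s * ln \<tau> = real ?s * ln thr + 3 * \<eta> * ln (real n) * real ?s" by (simp add: params
        algebra_simps)
    have "8 * nb z \<le> (10 + \<gamma>) * (ln (real n) * nb z)"
    proof -
      have "8 * nb z \<le> (10 + \<gamma>) * nb z" using nb_nonneg \<gamma> \<eta> by (intro mult_right_mono) auto
      also have "\<dots> \<le> (10 + \<gamma>) * (ln (real n) * nb z)" using nb_ln \<gamma> \<eta> by (intro mult_left_mono) auto
      finally show ?thesis .
    qed
    moreover have "0 \<le> \<kappa> * real n" using \<kappa> by simp
    moreover have "0 \<le> sqrt (real l * real n)" by simp
    moreover have "0 \<le> real l" by simp
    moreover have "Lam z = 3 * \<eta> * ln (real n) * real ?s + (10 + \<gamma>) * (ln (real n) * nb z)
        + 10 * real l + sqrt (real l * real n) + 2 * (\<kappa> * real n)"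
      by (simp add: Lam_def)
    moreover have "real ?s * (ln 2 + ln \<tau>) = real ?s * ln 2 + real ?s * ln \<tau>" by (simp add: distrib_left)
    ultimately have "real (card Q) * ln 2 + (ln prest + real ?s * (ln 2 + ln \<tau>) + real nbad * ln 6 + real N * ln
        (1 + \<kappa>)) \<le> target z + Lam z"
      using k q s b tt card_Sm target_split target_S(1) target_Bad(1) nb_nonneg by linarith
    then show ?thesis by simp
  qed
  finally show ?thesis .
qed

text \<open>Twice the logarithms are compared. For each small block, \<open>\<delta>\<close>
  accounts for the \<open>- \<gamma> * ln n\<close> in \<open>ln thr\<close>, and the factorial for
  the \<open>ln n / 2\<close>: its power -1/4 is the power -1/2 of \<open>sqrt (q!)\<close>. What
  the factorial lacks is bounded by \<open>entropy_bound\<close>.\<close>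

lemma const_bound:
  "4 ^ card Q * (cmod (- of_real \<delta>) powr (-1/2)) ^ card Q * fact (card Q) powr (-1/4) * (prest * (1 - \<kappa>) ^ N)
      powr (-1/2)
     \<le> exp (- (target z - Lam z) / 2)"
proof -
  let ?q = "card Q" and ?s = "card (Sm z)"
  have B: "prest * (1 - \<kappa>) ^ N > 0" using prest_pos \<kappa> by simp
  have pos: "0 < 4 ^ ?q * (\<delta> powr (-1/2)) ^ ?q * fact ?q powr (-1/4) * (prest * (1 - \<kappa>) ^ N) powr (-1/2)"
  proof -
    have "0 < (prest * (1 - \<kappa>) ^ N) powr (-1/2)" using B by (metis powr_gt_zero less_irrefl)
    then show ?thesis using params(1) by (intro mult_pos_pos zero_less_power) simp_all
  qed
  have lnK: "ln (4 ^ ?q * (\<delta> powr (-1/2)) ^ ?q * fact ?q powr (-1/4) * (prest * (1 - \<kappa>) ^ N) powr (-1/2))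
     = real ?q * ln 4 - real ?q * ln \<delta> / 2 - ln (fact ?q) / 4 - (ln prest + real N * ln (1 - \<kappa>)) / 2"
  proof -
    have "1 - \<kappa> > 0" using \<kappa> by simp
    then have "ln (prest * (1 - \<kappa>) ^ N) = ln prest + real N * ln (1 - \<kappa>)"
      using prest_pos by (simp add: ln_mult ln_realpow)
    moreover have "\<kappa> \<noteq> 1" using \<kappa> by simp
    ultimately show ?thesis using B params prest_pos by (simp add: ln_mult ln_realpow ln_powr)
  qed
  have cq: "real ?q = real ?s + nb z" by (simp add: card_Q nb_eq)
  have l4: "ln 4 \<le> (3::real)" using ln_le_minus_one[of 4] by simp
  \<comment> \<open>Only the factorial of the number of small blocks is used; rows of exceptional
    blocks are paid for in \<open>Lam\<close>.\<close>
  have "fact ?s \<le> (fact ?q :: real)" by (intro fact_mono) (simp add: card_Q)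
  then have "ln (fact ?s) \<le> ln (fact ?q :: real)" by (intro ln_mono) auto
  then have f: "real ?s * ln (real ?s) - real ?s \<le> ln (fact ?q)" using ln_fact_lower[of ?s] by linarith
  have k: "- (2 * \<kappa> * real n) \<le> real N * ln (1 - \<kappa>)"
    using mult_left_mono[OF ln_one_minus_half[OF \<kappa>], of "real n"] by (simp add: N_eq mult.commute
        mult.left_commute)
  have ent: "real ?s * ln (real n) - real ?s * ln (real ?s) \<le> 2 * sqrt (real l * real n)"
  proof (cases "?s = 0")
    case False
    then have "real ?s * ln (real n / real ?s) \<le> 2 * sqrt (real l * real n)" using card_Sm n3 by (intro
        entropy_bound) auto
    then show ?thesis using False n3 by (simp add: ln_div algebra_simps)
  qed simp
  have q4: "real ?q * ln 4 \<le> 3 * real ?s + 3 * nb z" unfolding cq using mult_left_mono[OF l4, of "real ?s + nb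
      z"] nb_nonneg by (simp add: algebra_simps)
  define G1 where "G1 = \<gamma> * (ln (real n) * real ?s)"
  define G2 where "G2 = \<gamma> * (ln (real n) * nb z)"
  define E where "E = 3 * \<eta> * ln (real n) * real ?s"
  define SL where "SL = real ?s * ln (real n)"
  define BB where "BB = ln (real n) * nb z"
  define KN where "KN = \<kappa> * real n"
  have qd: "real ?q * ln \<delta> = - G1 - G2" by (simp add: G1_def G2_def cq params algebra_simps)
  have st: "real ?s * ln \<tau> = SL / 2 - G1 + E"
    by (simp add: SL_def G1_def E_def params algebra_simps)
  have "real ?q * ln 4 - real ?q * ln \<delta> / 2 - ln (fact ?q) / 4 - (ln prest + real N * ln (1 - \<kappa>)) / 2 \<le> -
      (target z - Lam z) / 2"
  proof -
    have La: "Lam z = E + 10 * BB + G2 + 10 * real l + sqrt (real l * real n) + 2 * KN"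
      by (simp add: Lam_def E_def BB_def G2_def KN_def algebra_simps)
    have "0 \<le> real l" by simp
    moreover have "- (2 * KN) \<le> real N * ln (1 - \<kappa>)" using k by (simp add: KN_def mult.assoc)
    moreover have "SL - real ?s * ln (real ?s) \<le> 2 * sqrt (real l * real n)" using ent by (simp add: SL_def)
    moreover have "nb z \<le> BB" using nb_ln by (simp add: BB_def)
    moreover define SS where "SS = (\<Sum>i\<in>Sm z. ln (max (cmod (z - c i) ^ d i) thr))"
    moreover define SB where "SB = (\<Sum>i\<in>Bad z. ln (max (cmod (z - c i) ^ d i) thr))"
    moreover have "target z = ln prest + SS + SB" "SS \<le> real ?s * ln \<tau>" "SB \<le> nb z"
      unfolding SS_def SB_def by (rule target_split target_S(2) target_Bad(2))+
    moreover note f q4 qd st card_Sm nb_nonneg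
    ultimately show ?thesis unfolding La SS_def[symmetric] SB_def[symmetric]
      by (simp add: field_simps)
  qed
  then have "exp (ln (4 ^ ?q * (\<delta> powr (-1/2)) ^ ?q * fact ?q powr (-1/4) * (prest * (1 - \<kappa>) ^ N) powr (-1/2)))
      \<le> exp (- (target z - Lam z) / 2)"
    unfolding lnK by (simp only: exp_le_cancel_iff)
  then have "4 ^ ?q * (\<delta> powr (-1/2)) ^ ?q * fact ?q powr (-1/4) * (prest * (1 - \<kappa>) ^ N) powr (-1/2) \<le> exp (-
      (target z - Lam z) / 2)"
    unfolding exp_ln[OF pos] .
  moreover have "cmod (- of_real \<delta>) = \<delta>" using params by simp
  ultimately show ?thesis by (simp only:)
qed

lemma Xmat_measurable: "(\<lambda>x. det (Xmat z x)) \<in> borel_measurable (gauss n)"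
  unfolding Xmat_def by (rule borel_measurable_det) measurable

text \<open>The event \<open>good\<close> involves all rows, so it is not independent of those to be
  integrated out. With the rows outside \<open>Q\<close> fixed, either no completion is good and the
  inner integral vanishes, or one good completion \<open>y0\<close> shows that these rows have small
  noise. Since \<open>lower_det\<close> only reads rows outside \<open>Q\<close>, this suffices; the
  indicator is then dropped and the rows in \<open>Q\<close> are integrated over their full Gaussian
  law.\<close>

lemma lower_core:
  "(\<integral>\<^sup>+x. qf (det (Xmat z x)) * indicator {x. good n t x} x \<partial>gauss n) \<le> ennreal (exp (- (target z - Lam z) /
      2))"
proof -
  interpret product_prob_space "\<lambda>_::nat \<times> nat. stdn" by (rule product_prob_space_stdn)
  let ?R = "({..<n} - Q) \<times> {..<n}" and ?Q = "Q \<times> {..<n}"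
  let ?K = "exp (- (target z - Lam z) / 2)"
  let ?F = "\<lambda>x. qf (det (Xmat z x)) * indicator {x. good n t x} x"
  have Qn: "Q \<subseteq> {..<n}" using Q_sub by (simp add: N_eq)
  have un: "?R \<union> ?Q = {..<n} \<times> {..<n}" using Qn by auto
  have [measurable]: "(\<lambda>x. det (Xmat z x)) \<in> borel_measurable (gauss n)" by (rule Xmat_measurable)
  have m: "?F \<in> borel_measurable (PiM (?R \<union> ?Q) (\<lambda>_. stdn))"
    unfolding un by measurable
  have inner: "(\<integral>\<^sup>+y. ?F (merge ?R ?Q (x, y)) \<partial>PiM ?Q (\<lambda>_. stdn)) \<le> ennreal ?K" for x
  proof (cases "\<exists>y. good n t (merge ?R ?Q (x, y))")
    case False
    then show ?thesis by simp
  next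
    case True
    then obtain y0 where y0: "good n t (merge ?R ?Q (x, y0))" by blast
    define A where "A = mat n n (\<lambda>(i,j). A0 $$ (i,j) + (if i \<in> Q then 0 else - of_real \<delta> * of_real (x (i,j))))"
    have Xe: "Xmat z (merge ?R ?Q (x, y)) = noisy_rows n A (- of_real \<delta>) Q y" for y
      by (intro eq_matI) (auto simp: Xmat_def noisy_rows_def A_def A0_eq merge_def)
    have "(\<integral>\<^sup>+y. ?F (merge ?R ?Q (x, y)) \<partial>PiM ?Q (\<lambda>_. stdn)) \<le> (\<integral>\<^sup>+y. qf (det (noisy_rows n A (- of_real \<delta>) Q
        y)) \<partial>PiM ?Q (\<lambda>_. stdn))"
      unfolding Xe by (intro nn_integral_mono) (simp split: split_indicator)
    also have "\<dots> \<le> ennreal (4 ^ card Q * (cmod (- of_real \<delta>) powr (-1/2)) ^ card Q * fact (card Q) powr (-1/4) *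
        (prest * (1 - \<kappa>) ^ N) powr (-1/2))"
    proof (rule rows_negative_moment[where T = "f0 ` Q"])
      show "- complex_of_real \<delta> \<noteq> 0" using params by simp
      show "0 < prest * (1 - \<kappa>) ^ N" using prest_pos \<kappa> by simp
      show "finite Q" by (rule finite_Q)
      show "Q \<subseteq> {..<n}" by (rule Qn)
      show "f0 ` Q \<subseteq> {..<n}" using f0_less Qn by (auto simp: N_eq)
      show "card (f0 ` Q) = card Q" by (rule card_image[OF f0_inj])
      show "A \<in> carrier_mat n n" by (simp add: A_def)
      fix f assume f: "bij_betw f Q (f0 ` Q)"
      have "prest * (1 - \<kappa>) ^ N \<le> cmod (det (mat N N (\<lambda>(r,r'). if r \<in> Q then (if r' = f r then 1 else 0) else A
          $$ (r,r'))))"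
      proof (rule lower_det[OF _ _ _ noise_bound[OF y0] _ _ f])
        show "noise (merge ?R ?Q (x, y0)) \<in> carrier_mat N N" by (simp add: noise_def N_eq)
        show "A \<in> carrier_mat N N" by (simp add: A_def N_eq)
        show "A $$ (r,r') = A0 $$ (r,r') + noise (merge ?R ?Q (x, y0)) $$ (r,r')" if "r < N" "r' < N" "r \<notin> Q"
            for r r'
          using that by (simp add: A_def noise_def N_eq merge_def)
      qed (use \<kappa> in auto)
      then show "prest * (1 - \<kappa>) ^ N \<le> cmod (det (mat n n (\<lambda>(i,j). if i \<in> Q then (if j = f i then 1 else 0) else
          A $$ (i,j))))"
        by (simp add: N_eq)
    qed
    also have "\<dots> \<le> ennreal ?K" by (intro ennreal_leI const_bound)
    finally show ?thesis .
  qed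
  have "(\<integral>\<^sup>+x. ?F x \<partial>gauss n) = (\<integral>\<^sup>+x. ?F x \<partial>PiM (?R \<union> ?Q) (\<lambda>_. stdn))" by (simp only: un)
  also have "\<dots> = (\<integral>\<^sup>+x. (\<integral>\<^sup>+y. ?F (merge ?R ?Q (x, y)) \<partial>PiM ?Q (\<lambda>_. stdn)) \<partial>PiM ?R (\<lambda>_. stdn))"
    using finite_Q by (intro product_nn_integral_fold m) auto
  also have "\<dots> \<le> (\<integral>\<^sup>+x. ennreal ?K \<partial>PiM ?R (\<lambda>_. stdn))" by (intro nn_integral_mono inner)
  also have "\<dots> = ennreal ?K"
  proof -
    interpret R: prob_space "PiM ?R (\<lambda>_. stdn)" by (rule prob_space_PiM) (rule prob_space_stdn)
    show ?thesis by (simp add: R.emeasure_space_1)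
  qed
  finally show ?thesis .
qed

end

end

section \<open>Averaging over the spectral parameter\<close>

lemma mult_exp_neg_le: "x * exp (- x) \<le> (1::real)"
proof -
  have "x \<le> exp x" using exp_ge_add_one_self[of x] by linarith
  then show ?thesis by (simp add: exp_minus field_simps)
qed

context core
begin

text \<open>Displays the entries as affine in \<open>z\<close> and in the noise, from which joint
  measurability of the determinant is immediate.\<close>

lemma Xmat_alt: "Xmat z x = mat n n (\<lambda>(i,j). (if i = j then z else 0) - block_matrix l d c $$ (i,j) - of_real \<delta>
    * of_real (x (i,j)))"
proof -
  note sb = shifted_block_matrix(1)[OF n, of z c] shifted_block_matrix(2)[OF n, of c]
  show ?thesis
    unfolding Xmat_def sb(1)[symmetric]
    using sb(2) by (intro eq_matI) auto
qed

lemma det_Xmat_joint_measurable: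
  "(\<lambda>(x, z). det (Xmat z x)) \<in> borel_measurable (gauss n \<Otimes>\<^sub>M (lborel :: complex measure))"
proof -
  have "(\<lambda>(x, z). det (Xmat z x)) = (\<lambda>p. det (mat n n (\<lambda>(i,j). (if i = j then snd p else 0) - block_matrix l d c
      $$ (i,j)
      - of_real \<delta> * of_real (fst p (i,j)))))"
  proof
    fix p :: "(nat \<times> nat \<Rightarrow> real) \<times> complex"
    show "(case p of (x, z) \<Rightarrow> det (Xmat z x)) = det (mat n n (\<lambda>(i,j). (if i = j then snd p else 0) -
        block_matrix l d c $$ (i,j)
      - of_real \<delta> * of_real (fst p (i,j))))"
      by (cases p) (simp only: prod.case Xmat_alt fst_conv snd_conv)
  qed
  also have "\<dots> \<in> borel_measurable (gauss n \<Otimes>\<^sub>M (lborel :: complex measure))"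
    by (rule borel_measurable_det) measurable
  finally show ?thesis .
qed

lemma target_measurable [measurable]: "target \<in> borel_measurable borel"
  unfolding target_def[abs_def] by measurable

lemma Sm_measurable: "{z. i \<in> Sm z} \<in> sets borel"
proof -
  have "{z. i \<in> Sm z} = (if i < l then {z \<in> space borel. cmod (z - c i) \<le> 1 - \<theta> \<and> cmod (z - c i) ^ d i < \<tau>} else
      {})"
    by (auto simp: Sm_def)
  moreover have "{z \<in> space borel. cmod (z - c i) \<le> 1 - \<theta> \<and> cmod (z - c i) ^ d i < \<tau>} \<in> sets borel" by
      measurable
  ultimately show ?thesis by (cases "i < l") (simp_all only: if_True if_False sets.empty_sets)
qed

lemma Bad_measurable: "{z. i \<in> Bad z} \<in> sets borel"
proof -
  have "{z. i \<in> Bad z} = (if i < l then {z \<in> space borel. 1 - \<theta> < cmod (z - c i) \<and> cmod (z - c i) < 1 + \<theta>} else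
      {})"
    by (auto simp: Bad_def)
  moreover have "{z \<in> space borel. 1 - \<theta> < cmod (z - c i) \<and> cmod (z - c i) < 1 + \<theta>} \<in> sets borel" by measurable
  ultimately show ?thesis by (cases "i < l") (simp_all only: if_True if_False sets.empty_sets)
qed

lemma Lam_sum: "Lam z = (\<Sum>i<l. 3 * \<eta> * ln (real n) * indicator {z. i \<in> Sm z} z)
   + (\<Sum>i<l. (10 + \<gamma>) * ln (real n) * real (d i) * indicator {z. i \<in> Bad z} z) + (10 * real l + sqrt (real l *
       real n) + 2 * \<kappa> * real n)"
proof -
  have S: "Sm z \<subseteq> {..<l}" and B: "Bad z \<subseteq> {..<l}" by (auto simp: Sm_def Bad_def)
  have "(\<Sum>i<l. 3 * \<eta> * ln (real n) * indicator {z. i \<in> Sm z} z) = (\<Sum>i\<in>Sm z. 3 * \<eta> * ln (real n))"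
    using S by (intro sum.mono_neutral_cong_right) auto
  moreover have "(\<Sum>i<l. (10 + \<gamma>) * ln (real n) * real (d i) * indicator {z. i \<in> Bad z} z) = (\<Sum>i\<in>Bad z. (10 + \<gamma>)
      * ln (real n) * real (d i))"
    using B by (intro sum.mono_neutral_cong_right) auto
  moreover have "{i. i < l \<and> i \<in> Sm z} = Sm z" "{i. i < l \<and> i \<in> Bad z} = Bad z" using S B by auto
  ultimately show ?thesis by (simp add: Lam_def nb_def sum_distrib_left mult.assoc)
qed

lemma Lam_nonneg: "Lam z \<ge> 0"
  unfolding Lam_def using ln_n \<eta> \<gamma> \<kappa> nb_nonneg by (intro add_nonneg_nonneg mult_nonneg_nonneg) auto

lemma Lam_measurable [measurable]: "Lam \<in> borel_measurable borel"
proof -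
  note [measurable] = Sm_measurable Bad_measurable
  show ?thesis unfolding Lam_sum[abs_def] by measurable
qed

text \<open>A determinant below \<open>\<tau>\<close> forces \<open>z\<close> into a disc of radius
  \<open>\<tau> powr (1 / d i) = exp (- c0 / a i)\<close>. Writing \<open>ln n = d i / a i\<close>,
  the area times \<open>ln n\<close> is \<open>d i\<close> times an expression of the form
  \<open>x * exp (- x)\<close>, up to constants. This turns a loss per block into a loss
  proportional to the block size.\<close>

lemma Sm_area:
  assumes a: "a i > 0" and da: "real (d i) = a i * ln (real n)" and i: "i < l"
  shows "ln (real n) * measure lborel {z. i \<in> Sm z} \<le> pi / (2 * (\<gamma> - 1/2 - 3 * \<eta>)) * real (d i)"
    and "emeasure lborel {z. i \<in> Sm z} < \<top>"
proof -
  define c0 where "c0 = \<gamma> - 1/2 - 3 * \<eta>"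
  have c0: "c0 > 0" using \<gamma> by (simp add: c0_def)
  have sub: "{z. i \<in> Sm z} \<subseteq> cball (c i) (exp (- c0 / a i))"
  proof
    fix z assume "z \<in> {z. i \<in> Sm z}"
    then have lt: "cmod (z - c i) ^ d i < \<tau>" by (simp add: Sm_def)
    show "z \<in> cball (c i) (exp (- c0 / a i))"
    proof (rule ccontr)
      assume "z \<notin> cball (c i) (exp (- c0 / a i))"
      then have "exp (- c0 / a i) \<le> cmod (z - c i)" by (simp add: dist_norm norm_minus_commute)
      then have "exp (- c0 / a i) ^ d i \<le> cmod (z - c i) ^ d i" by (intro power_mono) auto
      moreover have "exp (- c0 / a i) ^ d i = \<tau>"
      proof -
        have "exp (- c0 / a i) ^ d i = exp (real (d i) * (- c0 / a i))" by (rule exp_of_nat_mult[symmetric])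
        also have "real (d i) * (- c0 / a i) = ln \<tau>" using a by (simp add: da params c0_def field_simps)
        finally show ?thesis using params(2) by (simp only: exp_ln)
      qed
      ultimately show False using lt by simp
    qed
  qed
  have fin: "emeasure lborel (cball (c i) (exp (- c0 / a i))) = ennreal (pi * (exp (- c0 / a i))\<^sup>2)"
    by (rule emeasure_cball_complex) simp
  have le: "emeasure lborel {z. i \<in> Sm z} \<le> ennreal (pi * (exp (- c0 / a i))\<^sup>2)"
    unfolding fin[symmetric] by (rule emeasure_mono[OF sub]) simp
  then show "emeasure lborel {z. i \<in> Sm z} < \<top>" by (rule le_less_trans) simp
  have "measure lborel {z. i \<in> Sm z} \<le> pi * (exp (- c0 / a i))\<^sup>2"
    unfolding measure_def using le by (intro enn2real_leI) auto
  then have "ln (real n) * measure lborel {z. i \<in> Sm z} \<le> ln (real n) * (pi * (exp (- c0 / a i))\<^sup>2)"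
    using ln_n by (intro mult_left_mono) auto
  also have "(exp (- c0 / a i))\<^sup>2 = exp (- (2 * c0 / a i))" by (simp add: power2_eq_square flip: exp_add)
  also have "ln (real n) * (pi * exp (- (2 * c0 / a i))) = pi / (2 * c0) * real (d i) * ((2 * c0 / a i) * exp (-
      (2 * c0 / a i)))"
    using a c0 by (simp add: da field_simps)
  also have "\<dots> \<le> pi / (2 * c0) * real (d i) * 1"
    using c0 by (intro mult_left_mono mult_exp_neg_le) auto
  finally show "ln (real n) * measure lborel {z. i \<in> Sm z} \<le> pi / (2 * (\<gamma> - 1/2 - 3 * \<eta>)) * real (d i)"
    by (simp add: c0_def)
qed

lemma Bad_area: "emeasure lborel {z. i \<in> Bad z} \<le> ennreal (4 * pi * \<theta>)"
proof (cases "i < l")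
  case True
  have sub: "{z. i \<in> Bad z} \<union> cball (c i) (1 - \<theta>) \<subseteq> cball (c i) (1 + \<theta>)"
    using params by (auto simp: Bad_def dist_norm norm_minus_commute)
  have disj: "{z. i \<in> Bad z} \<inter> cball (c i) (1 - \<theta>) = {}"
    by (auto simp: Bad_def dist_norm norm_minus_commute)
  have "emeasure lborel {z. i \<in> Bad z} + emeasure lborel (cball (c i) (1 - \<theta>)) = emeasure lborel ({z. i \<in> Bad z}
      \<union> cball (c i) (1 - \<theta>))"
    using Bad_measurable[of i] disj by (intro plus_emeasure) auto
  also have "\<dots> \<le> emeasure lborel (cball (c i) (1 + \<theta>))" by (rule emeasure_mono[OF sub]) simp
  also have "\<dots> = ennreal (pi * (1 + \<theta>)\<^sup>2)" using params by (intro emeasure_cball_complex) auto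
  also have "pi * (1 + \<theta>)\<^sup>2 = 4 * pi * \<theta> + pi * (1 - \<theta>)\<^sup>2" by (simp add: power2_eq_square algebra_simps)
  also have "ennreal (4 * pi * \<theta> + pi * (1 - \<theta>)\<^sup>2) = ennreal (4 * pi * \<theta>) + ennreal (pi * (1 - \<theta>)\<^sup>2)"
    using params by (intro ennreal_plus) auto
  also have "ennreal (pi * (1 - \<theta>)\<^sup>2) = emeasure lborel (cball (c i) (1 - \<theta>))"
    using params by (intro emeasure_cball_complex[symmetric]) auto
  finally have *: "emeasure lborel {z. i \<in> Bad z} + emeasure lborel (cball (c i) (1 - \<theta>)) \<le> ennreal (4 * pi * \<theta>)
      + emeasure lborel (cball (c i) (1 - \<theta>))" .
  have "emeasure lborel (cball (c i) (1 - \<theta>)) \<noteq> \<top>"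
    using emeasure_lborel_cball_finite[of "c i" "1 - \<theta>"] by auto
  then show ?thesis using * by (simp add: add.commute ennreal_add_left_cancel_le)
qed (simp add: Bad_def)

text \<open>The block sizes add up to \<open>n\<close>. Divided by \<open>n\<close>, the first term
  is of order \<open>\<eta>\<close> and does not improve with \<open>n\<close>;
  \<open>\<theta> = n powr (- \<eta>)\<close> beats the logarithm in the second. The summand 2 is
  the cost of the lower tail.\<close>

lemma Lam_integral:
  assumes a: "\<And>i. i < l \<Longrightarrow> a i > 0" and da: "\<And>i. i < l \<Longrightarrow> real (d i) = a i * ln (real n)" and R: "R \<ge> 0"
  shows "(\<integral>\<^sup>+z. ennreal (Lam z + 2) * indicator (cball 0 R) z \<partial>lborel)
    \<le> ennreal (3 * \<eta> * (pi / (2 * (\<gamma> - 1/2 - 3 * \<eta>))) * real n + (10 + \<gamma>) * ln (real n) * (4 * pi * \<theta>) * real n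
       + (10 * real l + sqrt (real l * real n) + 2 * \<kappa> * real n + 2) * (pi * R\<^sup>2))"
proof -
  note [measurable] = Sm_measurable Bad_measurable
  let ?C = "10 * real l + sqrt (real l * real n) + 2 * \<kappa> * real n + 2"
  let ?s = "\<lambda>i. 3 * \<eta> * ln (real n)" and ?b = "\<lambda>i. (10 + \<gamma>) * ln (real n) * real (d i)"
  have s0: "0 \<le> 3 * \<eta> * ln (real n)" using \<eta> ln_n by simp
  have b0: "0 \<le> ?b i" for i using \<gamma> \<eta> ln_n by (intro mult_nonneg_nonneg) auto
  have bt: "0 \<le> ?b i * (4 * pi * \<theta>)" for i by (rule mult_nonneg_nonneg[OF b0]) (use params(4) in simp)
  have C0: "0 \<le> ?C" using \<kappa> by (intro add_nonneg_nonneg) auto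
  have sumd: "(\<Sum>i<l. real (d i)) = real n" by (simp add: n bstart_def)
  have "(\<integral>\<^sup>+z. ennreal (Lam z + 2) * indicator (cball 0 R) z \<partial>lborel)
    \<le> (\<integral>\<^sup>+z. (\<Sum>i<l. ennreal (?s i) * indicator {z. i \<in> Sm z} z) + (\<Sum>i<l. ennreal (?b i) * indicator {z. i \<in> Bad
        z} z)
         + ennreal ?C * indicator (cball 0 R) z \<partial>lborel)"
  proof (rule nn_integral_mono)
    fix z
    show "ennreal (Lam z + 2) * indicator (cball 0 R) z \<le> (\<Sum>i<l. ennreal (?s i) * indicator {z. i \<in> Sm z} z) +
        (\<Sum>i<l. ennreal (?b i) * indicator {z. i \<in> Bad z} z)
         + ennreal ?C * indicator (cball 0 R) z"
    proof (cases "z \<in> cball 0 R")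
      case True
      have "ennreal (Lam z + 2) = ennreal ((\<Sum>i<l. ?s i * indicator {z. i \<in> Sm z} z) + (\<Sum>i<l. ?b i * indicator
          {z. i \<in> Bad z} z) + ?C)"
        by (simp only: Lam_sum add.assoc)
      also have "\<dots> = ennreal (\<Sum>i<l. ?s i * indicator {z. i \<in> Sm z} z) + ennreal (\<Sum>i<l. ?b i * indicator {z. i \<in>
          Bad z} z) + ennreal ?C"
      proof -
        have "0 \<le> (\<Sum>i<l. ?s i * indicator {z. i \<in> Sm z} z)" by (intro sum_nonneg mult_nonneg_nonneg[OF s0]) simp
        moreover have "0 \<le> (\<Sum>i<l. ?b i * indicator {z. i \<in> Bad z} z)" by (intro sum_nonneg mult_nonneg_nonneg[OF
            b0]) simp
        ultimately show ?thesis using C0 by (simp only: ennreal_plus add_nonneg_nonneg)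
      qed
      also have "ennreal (\<Sum>i<l. ?s i * indicator {z. i \<in> Sm z} z) = (\<Sum>i<l. ennreal (?s i) * indicator {z. i \<in> Sm
          z} z)"
        using s0 by (subst sum_ennreal[symmetric]) (auto simp: ennreal_mult ennreal_indicator intro!: sum.cong)
      also have "ennreal (\<Sum>i<l. ?b i * indicator {z. i \<in> Bad z} z) = (\<Sum>i<l. ennreal (?b i) * indicator {z. i \<in>
          Bad z} z)"
        using b0 by (subst sum_ennreal[symmetric]) (auto simp: ennreal_mult ennreal_indicator intro!: sum.cong)
      finally show ?thesis using True by simp
    qed simp
  qed
  also have "\<dots> = (\<Sum>i<l. ennreal (?s i) * emeasure lborel {z. i \<in> Sm z}) + (\<Sum>i<l. ennreal (?b i) * emeasure
      lborel {z. i \<in> Bad z})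
      + ennreal ?C * emeasure lborel (cball (0::complex) R)"
  proof -
    let ?S = "\<lambda>z. \<Sum>i<l. ennreal (?s i) * indicator {z. i \<in> Sm z} z" and ?B = "\<lambda>z. \<Sum>i<l. ennreal (?b i) *
        indicator {z. i \<in> Bad z} z"
    have mS: "?S \<in> borel_measurable lborel" and mB: "?B \<in> borel_measurable lborel" by measurable
    have "(\<integral>\<^sup>+z. ?S z + ?B z + ennreal ?C * indicator (cball (0::complex) R) z \<partial>lborel)
       = (\<integral>\<^sup>+z. ?S z + ?B z \<partial>lborel) + (\<integral>\<^sup>+z. ennreal ?C * indicator (cball (0::complex) R) z \<partial>lborel)"
      by (rule nn_integral_add) measurable
    also have "(\<integral>\<^sup>+z. ?S z + ?B z \<partial>lborel) = (\<integral>\<^sup>+z. ?S z \<partial>lborel) + (\<integral>\<^sup>+z. ?B z \<partial>lborel)"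
      by (rule nn_integral_add[OF mS mB])
    also have "(\<integral>\<^sup>+z. ?S z \<partial>lborel) = (\<Sum>i<l. \<integral>\<^sup>+z. ennreal (?s i) * indicator {z. i \<in> Sm z} z \<partial>lborel)"
      by (rule nn_integral_sum) measurable
    also have "\<dots> = (\<Sum>i<l. ennreal (?s i) * emeasure lborel {z. i \<in> Sm z})"
      by (intro sum.cong refl nn_integral_cmult_indicator) (use Sm_measurable in simp)
    also have "(\<integral>\<^sup>+z. ?B z \<partial>lborel) = (\<Sum>i<l. \<integral>\<^sup>+z. ennreal (?b i) * indicator {z. i \<in> Bad z} z \<partial>lborel)"
      by (rule nn_integral_sum) measurable
    also have "\<dots> = (\<Sum>i<l. ennreal (?b i) * emeasure lborel {z. i \<in> Bad z})"
      by (intro sum.cong refl nn_integral_cmult_indicator) (use Bad_measurable in simp)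
    also have "(\<integral>\<^sup>+z. ennreal ?C * indicator (cball (0::complex) R) z \<partial>lborel) = ennreal ?C * emeasure lborel
        (cball (0::complex) R)"
      by (rule nn_integral_cmult_indicator) simp
    finally show ?thesis .
  qed
  also have "\<dots> \<le> ennreal (\<Sum>i<l. 3 * \<eta> * (pi / (2 * (\<gamma> - 1/2 - 3 * \<eta>)) * real (d i))) + ennreal (\<Sum>i<l. ?b i * (4
      * pi * \<theta>)) + ennreal (?C * (pi * R\<^sup>2))"
  proof (intro add_mono)
    have "ennreal (?s i) * emeasure lborel {z. i \<in> Sm z} \<le> ennreal (3 * \<eta> * (pi / (2 * (\<gamma> - 1/2 - 3 * \<eta>)) * real
        (d i)))" if i: "i < l" for i
    proof -
      note ar = Sm_area[where a=a and i=i, OF a[OF i] da[OF i] i]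
      have "ennreal (?s i) * emeasure lborel {z. i \<in> Sm z} = ennreal (3 * \<eta> * (ln (real n) * measure lborel {z.
          i \<in> Sm z}))"
        using ar(2) s0 by (simp add: emeasure_eq_ennreal_measure ennreal_mult[symmetric] mult.assoc)
      also have "\<dots> \<le> ennreal (3 * \<eta> * (pi / (2 * (\<gamma> - 1/2 - 3 * \<eta>)) * real (d i)))"
        using \<eta> by (intro ennreal_leI mult_left_mono ar(1)) auto
      finally show ?thesis .
    qed
    then have "(\<Sum>i<l. ennreal (?s i) * emeasure lborel {z. i \<in> Sm z}) \<le> (\<Sum>i<l. ennreal (3 * \<eta> * (pi / (2 * (\<gamma> -
        1/2 - 3 * \<eta>)) * real (d i))))"
      by (intro sum_mono) auto
    also have "\<dots> = ennreal (\<Sum>i<l. 3 * \<eta> * (pi / (2 * (\<gamma> - 1/2 - 3 * \<eta>)) * real (d i)))"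
      using \<eta> \<gamma> by (intro sum_ennreal) (auto intro!: mult_nonneg_nonneg divide_nonneg_nonneg)
    finally show "(\<Sum>i<l. ennreal (?s i) * emeasure lborel {z. i \<in> Sm z}) \<le> ennreal (\<Sum>i<l. 3 * \<eta> * (pi / (2 * (\<gamma>
        - 1/2 - 3 * \<eta>)) * real (d i)))" .
    have "(\<Sum>i<l. ennreal (?b i) * emeasure lborel {z. i \<in> Bad z}) \<le> (\<Sum>i<l. ennreal (?b i) * ennreal (4 * pi *
        \<theta>))"
      by (intro sum_mono mult_left_mono Bad_area) auto
    also have "\<dots> = (\<Sum>i<l. ennreal (?b i * (4 * pi * \<theta>)))"
    proof (intro sum.cong refl)
      show "ennreal (?b i) * ennreal (4 * pi * \<theta>) = ennreal (?b i * (4 * pi * \<theta>))" for i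
        using params(4) by (intro ennreal_mult[symmetric] b0) simp
    qed
    also have "\<dots> = ennreal (\<Sum>i<l. ?b i * (4 * pi * \<theta>))"
      by (intro sum_ennreal bt)
    finally show "(\<Sum>i<l. ennreal (?b i) * emeasure lborel {z. i \<in> Bad z}) \<le> ennreal (\<Sum>i<l. ?b i * (4 * pi * \<theta>))"
        .
    have "emeasure lborel (cball (0::complex) R) = ennreal (pi * R\<^sup>2)" by (rule emeasure_cball_complex[OF R])
    then show "ennreal ?C * emeasure lborel (cball (0::complex) R) \<le> ennreal (?C * (pi * R\<^sup>2))"
      using C0 by (simp only: ennreal_mult[symmetric] zero_le_mult_iff pi_ge_zero zero_le_power2 order_refl
          simp_thms)
  qed
  also have "\<dots> = ennreal ((\<Sum>i<l. 3 * \<eta> * (pi / (2 * (\<gamma> - 1/2 - 3 * \<eta>)) * real (d i))) + (\<Sum>i<l. ?b i * (4 * pi *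
      \<theta>)) + ?C * (pi * R\<^sup>2))"
  proof -
    have "0 \<le> (\<Sum>i<l. 3 * \<eta> * (pi / (2 * (\<gamma> - 1/2 - 3 * \<eta>)) * real (d i)))"
      using \<eta> \<gamma> by (intro sum_nonneg mult_nonneg_nonneg divide_nonneg_nonneg) auto
    moreover have "0 \<le> (\<Sum>i<l. ?b i * (4 * pi * \<theta>))"
      by (intro sum_nonneg bt)
    moreover have "0 \<le> ?C * (pi * R\<^sup>2)" using C0 by (intro mult_nonneg_nonneg) auto
    ultimately show ?thesis by (simp only: ennreal_plus add_nonneg_nonneg)
  qed
  also have "(\<Sum>i<l. 3 * \<eta> * (pi / (2 * (\<gamma> - 1/2 - 3 * \<eta>)) * real (d i))) = 3 * \<eta> * (pi / (2 * (\<gamma> - 1/2 - 3 *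
      \<eta>))) * real n"
    by (simp only: sum_distrib_left[symmetric] sumd mult.assoc)
  also have "(\<Sum>i<l. ?b i * (4 * pi * \<theta>)) = (10 + \<gamma>) * ln (real n) * (4 * pi * \<theta>) * real n"
    by (simp add: sumd[symmetric] sum_distrib_left sum_distrib_right mult_ac)
  finally show ?thesis .
qed

text \<open>The upper tail is \<open>upper_core\<close>; the lower tail is dominated by an
  exponential, which is a multiple of \<open>qf\<close>. A singular matrix, where
  \<open>ln 0 = 0\<close>, is covered because \<open>qf 0\<close> is infinite.\<close>

lemma pointwise_bound:
  assumes "good n t x"
  shows "ennreal \<bar>ln (cmod (det (Xmat z x))) - target z\<bar>
    \<le> ennreal (Lam z) + ennreal (2 * exp ((target z - Lam z) / 2)) * qf (det (Xmat z x))"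
proof (cases "det (Xmat z x) = 0")
  case True
  then show ?thesis by (simp add: qf_def ennreal_mult_top)
next
  case False
  define L where "L = ln (cmod (det (Xmat z x)))"
  have pos: "cmod (det (Xmat z x)) > 0" using False by simp
  have up: "L \<le> target z + Lam z"
  proof -
    have "L \<le> ln (exp (target z + Lam z))" unfolding L_def using pos upper_core[OF assms] by (intro ln_mono)
        auto
    then show ?thesis by simp
  qed
  have qf: "qf (det (Xmat z x)) = ennreal (exp (- L / 2))"
    using False by (simp add: qf_def powr_def L_def)
  \<comment> \<open>The inequality \<open>x \<le> 2 * exp (x / 2)\<close>; the exponent 1/2 is the
    one that makes \<open>exp (- L / 2)\<close> equal to \<open>qf\<close>.\<close>
  have "target z - Lam z - L \<le> 2 * exp ((target z - Lam z - L) / 2)"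
    using exp_ge_add_one_self[of "(target z - Lam z - L) / 2"] by (simp add: field_simps)
  also have "exp ((target z - Lam z - L) / 2) = exp ((target z - Lam z) / 2) * exp (- L / 2)"
    by (simp add: exp_add[symmetric] diff_divide_distrib)
  finally have "target z - L \<le> Lam z + 2 * exp ((target z - Lam z) / 2) * exp (- L / 2)" by simp
  moreover have "0 \<le> 2 * exp ((target z - Lam z) / 2) * exp (- L / 2)" by simp
  ultimately have "\<bar>L - target z\<bar> \<le> Lam z + 2 * exp ((target z - Lam z) / 2) * exp (- L / 2)"
    using up by linarith
  then have "ennreal \<bar>L - target z\<bar> \<le> ennreal (Lam z + 2 * exp ((target z - Lam z) / 2) * exp (- L / 2))" by
      (rule ennreal_leI)
  also have "\<dots> = ennreal (Lam z) + ennreal (2 * exp ((target z - Lam z) / 2)) * ennreal (exp (- L / 2))"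
    using Lam_nonneg by (simp add: ennreal_plus ennreal_mult)
  finally show ?thesis unfolding qf L_def .
qed

text \<open>The weight of \<open>qf\<close> in \<open>pointwise_bound\<close> is twice the
  reciprocal of the bound in \<open>lower_core\<close>, so the lower tail costs exactly 2, whatever
  \<open>target z\<close> is.\<close>

lemma expected_deviation:
  "(\<integral>\<^sup>+x. ennreal \<bar>ln (cmod (det (Xmat z x))) - target z\<bar> * indicator {x. good n t x} x \<partial>gauss n) \<le> ennreal (Lam
      z + 2)"
proof -
  interpret prob_space "gauss n" by (rule prob_space_gauss)
  note [measurable] = Xmat_measurable[of z]
  let ?e = "2 * exp ((target z - Lam z) / 2)"
  have "(\<integral>\<^sup>+x. ennreal \<bar>ln (cmod (det (Xmat z x))) - target z\<bar> * indicator {x. good n t x} x \<partial>gauss n)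
    \<le> (\<integral>\<^sup>+x. ennreal (Lam z) + ennreal ?e * (qf (det (Xmat z x)) * indicator {x. good n t x} x) \<partial>gauss n)"
    using pointwise_bound by (intro nn_integral_mono) (auto split: split_indicator)
  also have "\<dots> = (\<integral>\<^sup>+x. ennreal (Lam z) \<partial>gauss n) + (\<integral>\<^sup>+x. ennreal ?e * (qf (det (Xmat z x)) * indicator {x.
      good n t x} x) \<partial>gauss n)"
    by (rule nn_integral_add) measurable
  also have "(\<integral>\<^sup>+x. ennreal ?e * (qf (det (Xmat z x)) * indicator {x. good n t x} x) \<partial>gauss n)
     = ennreal ?e * (\<integral>\<^sup>+x. qf (det (Xmat z x)) * indicator {x. good n t x} x \<partial>gauss n)"
    by (rule nn_integral_cmult) measurable
  also have "\<dots> \<le> ennreal ?e * ennreal (exp (- (target z - Lam z) / 2))" by (intro mult_left_mono lower_core)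
      simp
  also have "\<dots> = 2"
  proof -
    have "exp ((target z - Lam z) / 2) * exp (- (target z - Lam z) / 2) = exp ((target z - Lam z) / 2 + -
        (target z - Lam z) / 2)"
      by (rule exp_add[symmetric])
    also have "(target z - Lam z) / 2 + - (target z - Lam z) / 2 = 0" by (simp only:
        minus_divide_left[symmetric] add.right_inverse)
    finally have "?e * exp (- (target z - Lam z) / 2) = 2" by simp
    moreover have "ennreal ?e * ennreal (exp (- (target z - Lam z) / 2)) = ennreal (?e * exp (- (target z - Lam
        z) / 2))"
      by (rule ennreal_mult[symmetric]) simp_all
    ultimately show ?thesis by (simp only: ennreal_numeral)
  qed
  also have "(\<integral>\<^sup>+x. ennreal (Lam z) \<partial>gauss n) = ennreal (Lam z)" by (simp add: emeasure_space_1)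
  finally show ?thesis using Lam_nonneg by (simp add: ennreal_plus add_mono)
qed

lemma expected_potential_deviation:
  "(\<integral>\<^sup>+x. (\<integral>\<^sup>+z. ennreal \<bar>ln (cmod (det (Xmat z x))) - target z\<bar> * indicator (cball 0 R) z \<partial>lborel) * indicator
      {x. good n t x} x \<partial>gauss n)
     \<le> (\<integral>\<^sup>+z. ennreal (Lam z + 2) * indicator (cball 0 R) z \<partial>lborel)"
proof -
  interpret G: prob_space "gauss n" by (rule prob_space_gauss)
  interpret pair_sigma_finite "gauss n" "lborel :: complex measure" ..
  note [measurable] = det_Xmat_joint_measurable
  let ?f = "\<lambda>x z. (ennreal \<bar>ln (cmod (det (Xmat z x))) - target z\<bar> * indicator {x. good n t x} x) * indicator
      (cball 0 R) z"
  have m: "(\<lambda>(x,z). ?f x z) \<in> borel_measurable (gauss n \<Otimes>\<^sub>M (lborel :: complex measure))"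
  proof -
    have "(\<lambda>p. det (Xmat (snd p) (fst p))) \<in> borel_measurable (gauss n \<Otimes>\<^sub>M (lborel :: complex measure))"
      using det_Xmat_joint_measurable by (simp add: case_prod_beta')
    note [measurable] = this
    show ?thesis unfolding case_prod_beta' by measurable
  qed
  have "(\<integral>\<^sup>+x. (\<integral>\<^sup>+z. ennreal \<bar>ln (cmod (det (Xmat z x))) - target z\<bar> * indicator (cball 0 R) z \<partial>lborel) *
      indicator {x. good n t x} x \<partial>gauss n)
     = (\<integral>\<^sup>+x. (\<integral>\<^sup>+z. ?f x z \<partial>lborel) \<partial>gauss n)"
    by (intro nn_integral_cong) (auto split: split_indicator)
  also have "\<dots> = (\<integral>\<^sup>+z. (\<integral>\<^sup>+x. ?f x z \<partial>gauss n) \<partial>lborel)"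
    using Fubini'[OF m] by simp
  also have "\<dots> \<le> (\<integral>\<^sup>+z. ennreal (Lam z + 2) * indicator (cball 0 R) z \<partial>lborel)"
  proof (rule nn_integral_mono)
    fix z
    show "(\<integral>\<^sup>+x. ?f x z \<partial>gauss n) \<le> ennreal (Lam z + 2) * indicator (cball 0 R) z"
      using expected_deviation[of z] by (cases "z \<in> cball 0 R") auto
  qed
  finally show ?thesis .
qed

end

section \<open>Spectral and circle measures tested through the logarithmic kernel\<close>

lemma nn_integral_mixture:
  assumes \<nu>: "\<And>i. i \<in> I \<Longrightarrow> sets (\<nu> i) = sets borel" and f: "f \<in> borel_measurable borel"
  shows "(\<integral>\<^sup>+z. f z \<partial>mixture I w \<nu>) = (\<Sum>i\<in>I. ennreal (w i) * (\<integral>\<^sup>+z. f z \<partial>\<nu> i))"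
proof -
  have sp: "space (\<nu> i) = UNIV" if "i \<in> I" for i
    using sets_eq_imp_space_eq[OF \<nu>[OF that]] by simp
  have spm: "space (mixture I w \<nu>) = UNIV"
    using sets_eq_imp_space_eq[OF sets_mixture, of I w \<nu>] by simp
  have mm: "g \<in> borel_measurable (mixture I w \<nu>)" if "g \<in> borel_measurable borel" for g :: "complex \<Rightarrow> ennreal"
    using that by (simp cong: measurable_cong_sets)
  have mn: "g \<in> borel_measurable (\<nu> i)" if "g \<in> borel_measurable borel" "i \<in> I" for g :: "complex \<Rightarrow> ennreal" and
      i
    using that \<nu> by (simp cong: measurable_cong_sets)
  show ?thesis
    using f
  proof (induct rule: borel_measurable_induct)
    case (cong f g)
    then have "f = g" by auto
    with cong show ?case by simp
  next
    case (set A)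
    then show ?case using \<nu> by (simp add: emeasure_mixture)
  next
    case (mult v u)
    have "(\<integral>\<^sup>+z. u * v z \<partial>mixture I w \<nu>) = u * (\<integral>\<^sup>+z. v z \<partial>mixture I w \<nu>)"
      by (rule nn_integral_cmult) (rule mm[OF mult(2)])
    also have "\<dots> = (\<Sum>i\<in>I. ennreal (w i) * (\<integral>\<^sup>+z. u * v z \<partial>\<nu> i))"
      unfolding mult(4) sum_distrib_left
    proof (intro sum.cong refl)
      fix i assume "i \<in> I"
      then have "(\<integral>\<^sup>+z. u * v z \<partial>\<nu> i) = u * (\<integral>\<^sup>+z. v z \<partial>\<nu> i)" by (intro nn_integral_cmult mn mult(2))
      then show "u * (ennreal (w i) * (\<integral>\<^sup>+z. v z \<partial>\<nu> i)) = ennreal (w i) * (\<integral>\<^sup>+z. u * v z \<partial>\<nu> i)"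
        by (simp only: mult.left_commute)
    qed
    finally show ?case .
  next
    case (add u v)
    have "(\<integral>\<^sup>+z. v z + u z \<partial>mixture I w \<nu>) = (\<integral>\<^sup>+z. v z \<partial>mixture I w \<nu>) + (\<integral>\<^sup>+z. u z \<partial>mixture I w \<nu>)"
      by (intro nn_integral_add mm add)
    also have "\<dots> = (\<Sum>i\<in>I. ennreal (w i) * (\<integral>\<^sup>+z. v z + u z \<partial>\<nu> i))"
      unfolding add(3) add(7) sum.distrib[symmetric]
    proof (intro sum.cong refl)
      fix i assume "i \<in> I"
      then have "(\<integral>\<^sup>+z. v z + u z \<partial>\<nu> i) = (\<integral>\<^sup>+z. v z \<partial>\<nu> i) + (\<integral>\<^sup>+z. u z \<partial>\<nu> i)" by (intro nn_integral_add mn add)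
      then show "ennreal (w i) * (\<integral>\<^sup>+z. v z \<partial>\<nu> i) + ennreal (w i) * (\<integral>\<^sup>+z. u z \<partial>\<nu> i) = ennreal (w i) * (\<integral>\<^sup>+z. v
          z + u z \<partial>\<nu> i)"
        by (simp only: distrib_left)
    qed
    finally show ?case .
  next
    case (seq U)
    have "(\<integral>\<^sup>+z. (SUP k. U k) z \<partial>mixture I w \<nu>) = (SUP k. \<integral>\<^sup>+z. U k z \<partial>mixture I w \<nu>)"
      unfolding SUP_apply by (intro nn_integral_monotone_convergence_SUP seq mm)
    also have "\<dots> = (SUP k. \<Sum>i\<in>I. ennreal (w i) * (\<integral>\<^sup>+z. U k z \<partial>\<nu> i))" by (simp only: seq(3))
    also have "\<dots> = (\<Sum>i\<in>I. SUP k. ennreal (w i) * (\<integral>\<^sup>+z. U k z \<partial>\<nu> i))"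
      using seq(4) by (intro ennreal_SUP_sum) (auto simp: incseq_def le_fun_def intro!: mult_left_mono
          nn_integral_mono)
    also have "\<dots> = (\<Sum>i\<in>I. ennreal (w i) * (\<integral>\<^sup>+z. (SUP k. U k) z \<partial>\<nu> i))"
    proof (intro sum.cong refl)
      fix i assume i: "i \<in> I"
      have "(\<integral>\<^sup>+z. (SUP k. U k) z \<partial>\<nu> i) = (SUP k. \<integral>\<^sup>+z. U k z \<partial>\<nu> i)"
        unfolding SUP_apply using i by (intro nn_integral_monotone_convergence_SUP seq mn)
      then show "(SUP k. ennreal (w i) * (\<integral>\<^sup>+z. U k z \<partial>\<nu> i)) = ennreal (w i) * (\<integral>\<^sup>+z. (SUP k. U k) z \<partial>\<nu> i)"
        by (simp only: SUP_mult_left_ennreal)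
    qed
    finally show ?case .
  qed
qed

lemma integral_mixture:
  fixes \<phi> :: "complex \<Rightarrow> real"
  assumes I: "finite I" and w: "\<And>i. i \<in> I \<Longrightarrow> 0 \<le> w i"
    and \<nu>: "\<And>i. i \<in> I \<Longrightarrow> sets (\<nu> i) = sets borel" "\<And>i. i \<in> I \<Longrightarrow> prob_space (\<nu> i)"
    and \<phi>: "\<phi> \<in> borel_measurable borel" and B: "\<And>z. \<bar>\<phi> z\<bar> \<le> B"
  shows "(\<integral>z. \<phi> z \<partial>mixture I w \<nu>) = (\<Sum>i\<in>I. w i * (\<integral>z. \<phi> z \<partial>\<nu> i))"
proof -
  have int: "integrable (\<nu> i) \<phi>" if i: "i \<in> I" for i
  proof -
    interpret prob_space "\<nu> i" using \<nu>(2)[OF i] .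
    show ?thesis using B \<phi> \<nu>(1)[OF i]
      by (intro integrable_const_bound[where B=B]) (auto cong: measurable_cong_sets)
  qed
  have fin: "(\<integral>\<^sup>+z. ennreal (\<phi> z) \<partial>\<nu> i) < \<top>" "(\<integral>\<^sup>+z. ennreal (- \<phi> z) \<partial>\<nu> i) < \<top>" if i: "i \<in> I" for i
    using int[OF i] by (auto simp: real_integrable_def less_top)
  have e: "(\<integral>\<^sup>+z. f z \<partial>mixture I w \<nu>) = (\<Sum>i\<in>I. ennreal (w i) * (\<integral>\<^sup>+z. f z \<partial>\<nu> i))" if "f \<in> borel_measurable
      borel" for f
    using \<nu>(1) that by (intro nn_integral_mixture)
  have pos: "enn2real (\<integral>\<^sup>+z. ennreal (f z) \<partial>mixture I w \<nu>) = (\<Sum>i\<in>I. w i * enn2real (\<integral>\<^sup>+z. ennreal (f z) \<partial>\<nu> i))"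
    "(\<integral>\<^sup>+z. ennreal (f z) \<partial>mixture I w \<nu>) < \<top>"
    if f: "f \<in> borel_measurable borel" "\<And>i. i \<in> I \<Longrightarrow> (\<integral>\<^sup>+z. ennreal (f z) \<partial>\<nu> i) < \<top>" for f :: "complex \<Rightarrow> real"
  proof -
    have m: "(\<lambda>z. ennreal (f z)) \<in> borel_measurable borel" using f(1) by measurable
    have t: "ennreal (w i) * (\<integral>\<^sup>+z. ennreal (f z) \<partial>\<nu> i) < \<top>" if "i \<in> I" for i
      using f(2)[OF that] by (simp add: ennreal_mult_less_top)
    show "(\<integral>\<^sup>+z. ennreal (f z) \<partial>mixture I w \<nu>) < \<top>"
      unfolding e[OF m] using t I by simp
    show "enn2real (\<integral>\<^sup>+z. ennreal (f z) \<partial>mixture I w \<nu>) = (\<Sum>i\<in>I. w i * enn2real (\<integral>\<^sup>+z. ennreal (f z) \<partial>\<nu> i))"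
      unfolding e[OF m] using t w by (subst enn2real_sum) (auto simp: enn2real_mult intro!: sum.cong)
  qed
  have "integrable (mixture I w \<nu>) \<phi>"
    unfolding real_integrable_def using pos(2)[of \<phi>] pos(2)[of "\<lambda>z. - \<phi> z"] fin \<phi>
    by (auto simp: less_top cong: measurable_cong_sets)
  then have "(\<integral>z. \<phi> z \<partial>mixture I w \<nu>) = enn2real (\<integral>\<^sup>+z. ennreal (\<phi> z) \<partial>mixture I w \<nu>) - enn2real (\<integral>\<^sup>+z. ennreal
      (- \<phi> z) \<partial>mixture I w \<nu>)"
    by (rule real_lebesgue_integral_def)
  also have "\<dots> = (\<Sum>i\<in>I. w i * (enn2real (\<integral>\<^sup>+z. ennreal (\<phi> z) \<partial>\<nu> i) - enn2real (\<integral>\<^sup>+z. ennreal (- \<phi> z) \<partial>\<nu> i)))"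
    using pos(1)[of \<phi>] pos(1)[of "\<lambda>z. - \<phi> z"] fin \<phi> by (simp add: sum_subtractf right_diff_distrib)
  also have "\<dots> = (\<Sum>i\<in>I. w i * (\<integral>z. \<phi> z \<partial>\<nu> i))"
    using int by (intro sum.cong refl) (simp add: real_lebesgue_integral_def)
  finally show ?thesis .
qed

lemma sets_circle_measure [simp]: "sets (circle_measure c r) = sets borel"
  by (simp add: circle_measure_def)

lemma circle_map_measurable [measurable]: "(\<lambda>t. c + complex_of_real r * cis t) \<in> borel_measurable borel"
  by (intro borel_measurable_continuous_onI continuous_intros)

lemma prob_space_circle_measure: "prob_space (circle_measure c r)"
proof -
  interpret prob_space unif_angle by (rule prob_space_unif_angle)
  show ?thesis unfolding circle_measure_def by (rule prob_space_distr) simp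
qed

lemma integral_circle_measure:
  fixes \<phi> :: "complex \<Rightarrow> real"
  assumes "\<phi> \<in> borel_measurable borel"
  shows "(\<integral>z. \<phi> z \<partial>circle_measure c r) = (\<integral>t. \<phi> (c + of_real r * cis t) \<partial>unif_angle)"
  unfolding circle_measure_def using assms by (subst integral_distr) auto

lemma order_linear_factors: "Polynomial.order z (\<Prod>a\<leftarrow>as. [:- a, 1:]) = count_list as (z :: complex)"
proof (induct as)
  case Nil
  then show ?case by (simp add: order_1_eq_0 one_poly_eq_simps(1))
next
  case (Cons a as)
  have noisy_rows: "(\<Prod>a\<leftarrow>as. [:- a, 1:]) \<noteq> 0" by (auto simp: prod_list_zero_iff)
  have "Polynomial.order z [:- a, 1:] = (if z = a then 1 else 0)"
  proof (cases "z = a")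
    case True
    then show ?thesis using order_power_n_n[of a 1] by simp
  next
    case False
    then show ?thesis by (simp add: order_0I)
  qed
  then show ?case using Cons noisy_rows by (simp add: order_mult[OF no_zero_divisors] del: mult_pCons_left)
qed

lemma sum_list_count: "(\<Sum>a\<leftarrow>as. f a) = (\<Sum>a\<in>set as. real (count_list as a) * f a)"
proof (induct as)
  case (Cons b as)
  have "(\<Sum>a\<in>set (b # as). real (count_list (b # as) a) * f a)
     = (\<Sum>a\<in>Set.insert b (set as). real (count_list as a) * f a + (if a = b then f b else 0))"
    by (intro sum.cong) (auto simp: algebra_simps)
  also have "\<dots> = (\<Sum>a\<in>Set.insert b (set as). real (count_list as a) * f a) + f b"
    by (simp add: sum.distrib)
  also have "(\<Sum>a\<in>Set.insert b (set as). real (count_list as a) * f a) = (\<Sum>a\<in>set as. real (count_list as a) * f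
      a)"
    by (intro sum.mono_neutral_right) (auto simp: count_list_0_iff)
  finally show ?case using Cons by simp
qed simp

text \<open>One list of roots, repeated by multiplicity, describes the determinant as a product and
  the spectral integrals as averages; all later statements about the spectrum go through it.\<close>

lemma empirical_roots:
  assumes A: "A \<in> carrier_mat n n"
  obtains as where "length as = n" "\<And>z. det (z \<cdot>\<^sub>m 1\<^sub>m n - A) = (\<Prod>a\<leftarrow>as. z - a)"
    "\<And>\<phi> B. \<phi> \<in> borel_measurable borel \<Longrightarrow> (\<And>z. \<bar>\<phi> z\<bar> \<le> B) \<Longrightarrow>
       (\<integral>z. \<phi> z \<partial>empirical_spectral_measure A) = (\<Sum>a\<leftarrow>as. \<phi> a) / real n"
proof -
  obtain as where as: "char_poly A = (\<Prod>a\<leftarrow>as. [:- a, 1:])" "length as = n"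
    using char_poly_factorized[OF A] by auto
  have det: "det (z \<cdot>\<^sub>m 1\<^sub>m n - A) = (\<Prod>a\<leftarrow>as. z - a)" for z
  proof -
    have "- char_matrix A z = z \<cdot>\<^sub>m 1\<^sub>m n - A"
      using A by (intro eq_matI) (auto simp: char_matrix_def)
    then have "det (z \<cdot>\<^sub>m 1\<^sub>m n - A) = poly (char_poly A) z" using char_poly_matrix[OF A, of z] by simp
    also have "\<dots> = (\<Prod>a\<leftarrow>as. z - a)"
      unfolding as(1) poly_prod_list map_map by (rule arg_cong[where f=prod_list]) simp
    finally show ?thesis .
  qed
  have eig: "{z. eigenvalue A z} = set as"
    unfolding eigenvalue_root_char_poly[OF A] as(1) by (auto simp: poly_prod_list prod_list_zero_iff)
  have int: "(\<integral>z. \<phi> z \<partial>empirical_spectral_measure A) = (\<Sum>a\<leftarrow>as. \<phi> a) / real n"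
    if \<phi>: "\<phi> \<in> borel_measurable borel" "\<And>z. \<bar>\<phi> z\<bar> \<le> B" for \<phi> :: "complex \<Rightarrow> real" and B
  proof -
    have "(\<integral>z. \<phi> z \<partial>empirical_spectral_measure A) = (\<Sum>z\<in>set as. real (Polynomial.order z (char_poly A)) / real
        (dim_row A) * (\<integral>u. \<phi> u \<partial>return borel z))"
      unfolding empirical_spectral_measure_def eig using \<phi>
      by (intro integral_mixture[where B=B]) (auto intro: prob_space_return)
    also have "\<dots> = (\<Sum>z\<in>set as. real (count_list as z) / real n * \<phi> z)"
      using \<phi> A unfolding as(1) order_linear_factors by (simp add: integral_return)
    also have "\<dots> = (\<Sum>a\<leftarrow>as. \<phi> a) / real n"
      unfolding sum_list_count by (simp add: sum_divide_distrib)
    finally show ?thesis .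
  qed
  show ?thesis by (rule that[OF as(2) det int])
qed

lemma integral_log_roots:
  assumes g: "bdd_supp B R g"
  shows "integrable lborel (\<lambda>z. ln (cmod (\<Prod>a\<leftarrow>as. z - a)) * g z)"
    and "(\<integral>z. ln (cmod (\<Prod>a\<leftarrow>as. z - a)) * g z \<partial>lborel) = (\<Sum>a\<leftarrow>as. \<integral>z. ln (cmod (z - a)) * g z \<partial>lborel)"
proof -
  have [measurable]: "g \<in> borel_measurable borel" using g by (rule bdd_suppD)
  have pm: "(\<lambda>z. \<Prod>a\<leftarrow>as. z - a) \<in> borel_measurable borel" for as :: "complex list"
    by (induct as) auto
  have "integrable lborel (\<lambda>z. ln (cmod (\<Prod>a\<leftarrow>as. z - a)) * g z) \<and>
     (\<integral>z. ln (cmod (\<Prod>a\<leftarrow>as. z - a)) * g z \<partial>lborel) = (\<Sum>a\<leftarrow>as. \<integral>z. ln (cmod (z - a)) * g z \<partial>lborel)"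
  proof (induct as)
    case (Cons b as)
    note [measurable] = pm[of as]
    let ?f = "\<lambda>z. ln (cmod (z - b)) * g z + ln (cmod (\<Prod>a\<leftarrow>as. z - a)) * g z"
    have i: "integrable lborel ?f" using Cons integrable_ln_kernel[OF g] by simp
    \<comment> \<open>At a root the logarithm of the product is \<open>ln 0 = 0\<close> and
      additivity fails; the roots are finitely many points.\<close>
    have "AE z in lborel. z \<notin> set (b # as)"
      by (rule AE_not_in[OF finite_imp_null_set_lborel]) simp
    then have ae: "AE z in lborel. ?f z = ln (cmod (\<Prod>a\<leftarrow>(b # as). z - a)) * g z"
    proof eventually_elim
      case (elim z)
      then have "z - b \<noteq> 0" "(\<Prod>a\<leftarrow>as. z - a) \<noteq> 0" by (auto simp: prod_list_zero_iff)
      then show ?case by (simp add: norm_mult ln_mult distrib_right)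
    qed
    have m1: "?f \<in> borel_measurable lborel" by measurable
    have m2: "(\<lambda>z. ln (cmod (\<Prod>a\<leftarrow>(b # as). z - a)) * g z) \<in> borel_measurable lborel"
      using pm[of "b # as"] by measurable
    have "integrable lborel (\<lambda>z. ln (cmod (\<Prod>a\<leftarrow>(b # as). z - a)) * g z)"
      using integrable_cong_AE_imp[OF i m2] ae by (simp add: eq_commute)
    moreover have "(\<integral>z. ln (cmod (\<Prod>a\<leftarrow>(b # as). z - a)) * g z \<partial>lborel) = (\<integral>z. ?f z \<partial>lborel)"
      using ae by (intro integral_cong_AE m1 m2) (simp add: eq_commute)
    moreover have "(\<integral>z. ?f z \<partial>lborel) = (\<Sum>a\<leftarrow>(b # as). \<integral>z. ln (cmod (z - a)) * g z \<partial>lborel)"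
      using Cons integrable_ln_kernel[OF g] by simp
    ultimately show ?case by simp
  qed simp
  then show "integrable lborel (\<lambda>z. ln (cmod (\<Prod>a\<leftarrow>as. z - a)) * g z)"
    "(\<integral>z. ln (cmod (\<Prod>a\<leftarrow>as. z - a)) * g z \<partial>lborel) = (\<Sum>a\<leftarrow>as. \<integral>z. ln (cmod (z - a)) * g z \<partial>lborel)"
    by auto
qed

lemma integrable_ln_max:
  assumes g: "bdd_supp B R g"
  shows "integrable lborel (\<lambda>z. ln (max (cmod (z - w)) r) * g z)"
proof (rule Bochner_Integration.integrable_bound[of _ "\<lambda>p. \<bar>ln (cmod (p - w)) * g p\<bar> + \<bar>ln r\<bar> * (B * indicator
    (cball 0 R) p)"])
  have [measurable]: "g \<in> borel_measurable borel" using g by (rule bdd_suppD)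
  show "integrable lborel (\<lambda>p. \<bar>ln (cmod (p - w)) * g p\<bar> + \<bar>ln r\<bar> * (B * indicator (cball 0 R) p))"
    by (intro Bochner_Integration.integrable_add integrable_abs integrable_ln_kernel[OF g] integrable_mult_right
        integrable_real_indicator)
       (auto simp: emeasure_lborel_cball_finite[unfolded infinity_ennreal_def])
  show "AE p in lborel. norm (ln (max (cmod (p - w)) r) * g p) \<le> norm (\<bar>ln (cmod (p - w)) * g p\<bar> + \<bar>ln r\<bar> * (B *
      indicator (cball 0 R) p))"
  proof (rule AE_I2)
    fix p
    have "\<bar>ln (max (cmod (p - w)) r) * g p\<bar> \<le> \<bar>ln (cmod (p - w)) * g p\<bar> + \<bar>ln r\<bar> * \<bar>g p\<bar>"
      by (auto simp: max_def abs_mult)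
    also have "\<bar>g p\<bar> \<le> B * indicator (cball 0 R) p"
      using bdd_suppD(2,3)[OF g, of p] by (auto split: split_indicator)
    finally show "norm (ln (max (cmod (p - w)) r) * g p) \<le> norm (\<bar>ln (cmod (p - w)) * g p\<bar> + \<bar>ln r\<bar> * (B *
        indicator (cball 0 R) p))"
      by (auto simp: mult_left_mono)
  qed
  show "(\<lambda>z. ln (max (cmod (z - w)) r) * g z) \<in> borel_measurable lborel" by measurable
qed

text \<open>Transports the given random matrix to the canonical product space, where rows can be
  separated by \<open>merge\<close> and integrated by Fubini. As \<open>n > 0\<close>, the index set
  is nonempty and independence can be read as equality with a product measure.\<close>

lemma std_gaussian_distr:
  assumes P: "prob_space P" and G: "std_gaussian_matrix P n G" and n: "n > 0"
  shows "(\<lambda>\<omega>. \<lambda>p\<in>{..<n}\<times>{..<n}. G \<omega> $$ p) \<in> P \<rightarrow>\<^sub>M gauss n"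
    and "distr P (gauss n) (\<lambda>\<omega>. \<lambda>p\<in>{..<n}\<times>{..<n}. G \<omega> $$ p) = gauss n"
proof -
  interpret prob_space P by fact
  let ?I = "{..<n}\<times>{..<n}" and ?X = "\<lambda>\<omega>. \<lambda>p\<in>{..<n}\<times>{..<n}. G \<omega> $$ p"
  have D: "distributed P lborel (\<lambda>\<omega>. G \<omega> $$ p) std_normal_density" if "p \<in> ?I" for p
    using G that by (cases p) (auto simp: std_gaussian_matrix_def)
  have m: "(\<lambda>\<omega>. G \<omega> $$ p) \<in> borel_measurable P" if "p \<in> ?I" for p
    using distributed_measurable[OF D[OF that]] by simp
  have d: "distr P borel (\<lambda>\<omega>. G \<omega> $$ p) = stdn" if "p \<in> ?I" for p
  proof -
    have "distr P borel (\<lambda>\<omega>. G \<omega> $$ p) = distr P lborel (\<lambda>\<omega>. G \<omega> $$ p)" by (rule distr_cong) auto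
    then show ?thesis using distributed_distr_eq_density[OF D[OF that]] by (simp add: stdn_def)
  qed
  have sg: "sets (gauss n) = sets (PiM ?I (\<lambda>_. borel))" by (rule sets_PiM_cong) simp_all
  show "?X \<in> P \<rightarrow>\<^sub>M gauss n" using m by (intro measurable_restrict) simp
  have ind: "indep_vars (\<lambda>_. borel) (\<lambda>p \<omega>. G \<omega> $$ p) ?I" using G by (simp add: std_gaussian_matrix_def)
  have "distr P (gauss n) ?X = distr P (PiM ?I (\<lambda>_. borel)) ?X" by (rule distr_cong) (auto simp: sg)
  also have "\<dots> = PiM ?I (\<lambda>p. distr P borel (\<lambda>\<omega>. G \<omega> $$ p))"
    using ind by (subst (asm) indep_vars_iff_distr_eq_PiM') (use n m in auto)
  also have "\<dots> = gauss n" by (intro PiM_cong refl d)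
  finally show "distr P (gauss n) ?X = gauss n" .
qed

section \<open>From potentials to spectral and circle measures\<close>

context core
begin

definition "Amat G = block_matrix l d c + complex_of_real \<delta> \<cdot>\<^sub>m map_mat complex_of_real G"
definition "entries (G :: real mat) = (\<lambda>p\<in>{..<n}\<times>{..<n}. G $$ p)"

lemma Amat_carrier: "G \<in> carrier_mat n n \<Longrightarrow> Amat G \<in> carrier_mat n n"
  using shifted_block_matrix(2)[OF n, of c] by (auto simp: Amat_def)

lemma det_shift:
  assumes "G \<in> carrier_mat n n"
  shows "det (z \<cdot>\<^sub>m 1\<^sub>m n - Amat G) = det (Xmat z (entries G))"
proof -
  have "z \<cdot>\<^sub>m 1\<^sub>m n - Amat G = Xmat z (entries G)"
    unfolding Xmat_alt using assms shifted_block_matrix(2)[OF n, of c]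
    by (intro eq_matI) (auto simp: Amat_def entries_def)
  then show ?thesis by simp
qed

definition "potential g x = (\<integral>z. ln (cmod (det (Xmat z x))) * g z \<partial>lborel)"

lemma spec_approx:
  assumes G: "G \<in> carrier_mat n n" and g: "bdd_supp B R g"
    and \<phi>: "\<phi> \<in> borel_measurable borel" "\<And>z. \<bar>\<phi> z\<bar> \<le> B'"
    and e: "\<And>w. \<bar>(\<integral>z. ln (cmod (z - w)) * g z \<partial>lborel) - \<phi> w\<bar> \<le> e"
  shows "integrable lborel (\<lambda>z. ln (cmod (det (Xmat z (entries G)))) * g z)"
    and "\<bar>(\<integral>z. \<phi> z \<partial>empirical_spectral_measure (Amat G)) - potential g (entries G) / real n\<bar> \<le> e"
proof -
  obtain as where as: "length as = n" "\<And>z. det (z \<cdot>\<^sub>m 1\<^sub>m n - Amat G) = (\<Prod>a\<leftarrow>as. z - a)"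
    "\<And>\<phi> B. \<phi> \<in> borel_measurable borel \<Longrightarrow> (\<And>z. \<bar>\<phi> z\<bar> \<le> B) \<Longrightarrow>
       (\<integral>z. \<phi> z \<partial>empirical_spectral_measure (Amat G)) = (\<Sum>a\<leftarrow>as. \<phi> a) / real n"
    by (rule empirical_roots[OF Amat_carrier[OF G]]) blast
  have det: "det (Xmat z (entries G)) = (\<Prod>a\<leftarrow>as. z - a)" for z
    using as(2)[of z] det_shift[OF G, of z] by simp
  show "integrable lborel (\<lambda>z. ln (cmod (det (Xmat z (entries G)))) * g z)"
    unfolding det by (rule integral_log_roots[OF g])
  have potential: "potential g (entries G) = (\<Sum>a\<leftarrow>as. \<integral>z. ln (cmod (z - a)) * g z \<partial>lborel)"
    unfolding potential_def det by (rule integral_log_roots[OF g])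
  have "\<bar>(\<Sum>a\<leftarrow>xs. \<phi> a) - (\<Sum>a\<leftarrow>xs. \<integral>z. ln (cmod (z - a)) * g z \<partial>lborel)\<bar> \<le> e * real (length xs)" for xs
  proof (induct xs)
    case (Cons a xs)
    have "\<bar>\<phi> a - (\<integral>z. ln (cmod (z - a)) * g z \<partial>lborel)\<bar> \<le> e" using e[of a] by (simp add: abs_minus_commute)
    with Cons show ?case by (simp add: algebra_simps)
  qed simp
  from this[of as] have "\<bar>(\<Sum>a\<leftarrow>as. \<phi> a) - potential g (entries G)\<bar> \<le> e * real n" by (simp add: potential as(1))
  then have "\<bar>(\<Sum>a\<leftarrow>as. \<phi> a) - potential g (entries G)\<bar> / real n \<le> e" using n3 by (simp add: divide_le_eq)
  moreover have "(\<Sum>a\<leftarrow>as. \<phi> a) / real n - potential g (entries G) / real n = ((\<Sum>a\<leftarrow>as. \<phi> a) - potential g (entries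
      G)) / real n"
    by (simp add: diff_divide_distrib)
  ultimately show "\<bar>(\<integral>z. \<phi> z \<partial>empirical_spectral_measure (Amat G)) - potential g (entries G) / real n\<bar> \<le> e"
    using as(3)[OF \<phi>] by (simp add: abs_divide)
qed

lemma radius_power:
  assumes a: "a i > 0" and da: "real (d i) = a i * ln (real n)"
  shows "block_radius \<gamma> (a i) ^ d i = thr"
proof -
  have "block_radius \<gamma> (a i) ^ d i = exp (real (d i) * ((- \<gamma> + 1/2) / a i))"
    unfolding block_radius_def by (rule exp_of_nat_mult[symmetric])
  also have "real (d i) * ((- \<gamma> + 1/2) / a i) = ln thr" using a by (simp add: da params field_simps)
  finally show ?thesis using params(6) by (simp only: exp_ln)
qed

text \<open>For every block \<open>r ^ d = thr\<close>, so the maximum commutes with the power: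
  \<open>max (cmod (z - c)) r ^ d = max (cmod (z - c) ^ d) thr\<close>. Hence \<open>target\<close>
  is \<open>n\<close> times the potential of the circle mixture, and on each circle
  \<open>\<phi>\<close> is replaced by a logarithmic potential at cost \<open>e\<close>.\<close>

lemma circ_approx:
  assumes a: "\<And>i. i < l \<Longrightarrow> a i > 0" and da: "\<And>i. i < l \<Longrightarrow> real (d i) = a i * ln (real n)"
    and g: "bdd_supp B R g"
    and \<phi>: "\<phi> \<in> borel_measurable borel" "\<And>z. \<bar>\<phi> z\<bar> \<le> B'"
    and e: "\<And>w. \<bar>(\<integral>z. ln (cmod (z - w)) * g z \<partial>lborel) - \<phi> w\<bar> \<le> e"
  shows "integrable lborel (\<lambda>z. target z * g z)"
    and "\<bar>(\<integral>z. \<phi> z \<partial>circle_mixture \<gamma> n l a c) - (\<integral>z. target z * g z \<partial>lborel) / real n\<bar> \<le> e"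
proof -
  interpret U: prob_space unif_angle by (rule prob_space_unif_angle)
  have n0: "real n > 0" using n3 by simp
  let ?r = "\<lambda>i. block_radius \<gamma> (a i)"
  have r: "?r i > 0" for i by (simp add: block_radius_def)
  let ?h = "\<lambda>i z. ln (max (cmod (z - c i)) (?r i)) * g z"
  have tg: "target z * g z = (\<Sum>i<l. real (d i) * ?h i z)" for z
  proof -
    have "ln (max (cmod (z - c i) ^ d i) thr) = real (d i) * ln (max (cmod (z - c i)) (?r i))" if i: "i < l" for
        i
    proof -
      have "max (cmod (z - c i)) (?r i) ^ d i = max (cmod (z - c i) ^ d i) (?r i ^ d i)"
        using r[of i] by (auto simp: max_def power_mono intro: antisym dest: power_mono[of _ _ "d i"])
      then have "max (cmod (z - c i) ^ d i) thr = max (cmod (z - c i)) (?r i) ^ d i"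
        using radius_power[of a i, OF a[OF i] da[OF i]] by simp
      then show ?thesis using r[of i] by (simp add: ln_realpow max.strict_coboundedI2)
    qed
    then show ?thesis unfolding target_def sum_distrib_right by (intro sum.cong refl) (simp add: mult.assoc)
  qed
  show int: "integrable lborel (\<lambda>z. target z * g z)"
    unfolding tg using integrable_ln_max[OF g] by auto
  have I: "(\<integral>z. target z * g z \<partial>lborel) = (\<Sum>i<l. real (d i) * (\<integral>z. ?h i z \<partial>lborel))"
    unfolding tg using integrable_ln_max[OF g] by simp
  have M: "(\<integral>z. \<phi> z \<partial>circle_mixture \<gamma> n l a c) = (\<Sum>i<l. a i * ln (real n) / real n * (\<integral>z. \<phi> z \<partial>circle_measure (c
      i) (?r i)))"
    unfolding circle_mixture_def
  proof (rule integral_mixture[OF _ _ _ _ \<phi>])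
    show "0 \<le> a i * ln (real n) / real n" if "i \<in> {..<l}" for i using a[of i] that ln_n by simp
  qed (auto intro: prob_space_circle_measure)
  have close: "\<bar>(\<integral>z. \<phi> z \<partial>circle_measure (c i) (?r i)) - (\<integral>z. ?h i z \<partial>lborel)\<bar> \<le> e" for i
  proof -
    let ?u = "\<lambda>t. c i + of_real (?r i) * cis t"
    let ?\<Phi> = "\<lambda>t. \<integral>z. ln (cmod (z - ?u t)) * g z \<partial>lborel"
    note [measurable] = \<phi>(1)
    have i1: "integrable unif_angle (\<lambda>t. \<phi> (?u t))" using \<phi>(2) by (intro U.integrable_const_bound[where B=B'])
        auto
    have i2: "integrable unif_angle ?\<Phi>" by (rule circle_fubini(1)[OF g r])
    have "(\<integral>z. \<phi> z \<partial>circle_measure (c i) (?r i)) - (\<integral>z. ?h i z \<partial>lborel) = (\<integral>t. \<phi> (?u t) - ?\<Phi> t \<partial>unif_angle)"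
      using i1 i2 circle_fubini(2)[OF g r, of "c i" i] by (simp add: integral_circle_measure \<phi>(1))
    also have "\<bar>\<dots>\<bar> \<le> (\<integral>t. \<bar>\<phi> (?u t) - ?\<Phi> t\<bar> \<partial>unif_angle)" by (rule integral_abs_bound)
    also have "\<dots> \<le> e"
      using i1 i2 e by (intro U.integral_le_const integrable_abs Bochner_Integration.integrable_diff) (auto
          simp: abs_minus_commute)
    finally show ?thesis .
  qed
  have "(\<integral>z. \<phi> z \<partial>circle_mixture \<gamma> n l a c) - (\<integral>z. target z * g z \<partial>lborel) / real n
    = (\<Sum>i<l. real (d i) / real n * ((\<integral>z. \<phi> z \<partial>circle_measure (c i) (?r i)) - (\<integral>z. ?h i z \<partial>lborel)))"
    unfolding M I sum_divide_distrib sum_subtractf[symmetric]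
    by (intro sum.cong refl) (simp add: da right_diff_distrib)
  also have "\<bar>\<dots>\<bar> \<le> (\<Sum>i<l. real (d i) / real n * e)"
    using close n0 by (intro order_trans[OF sum_abs] sum_mono) (simp add: abs_mult mult_left_mono
        divide_right_mono)
  also have "\<dots> = (\<Sum>i<l. real (d i)) / real n * e"
    by (simp add: sum_distrib_right sum_divide_distrib)
  also have "(\<Sum>i<l. real (d i)) = real n" by (simp add: n bstart_def)
  finally show "\<bar>(\<integral>z. \<phi> z \<partial>circle_mixture \<gamma> n l a c) - (\<integral>z. target z * g z \<partial>lborel) / real n\<bar> \<le> e"
    using n0 by simp
qed

definition "deviation R x = (\<integral>\<^sup>+z. ennreal \<bar>ln (cmod (det (Xmat z x))) - target z\<bar> * indicator (cball 0 R) z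
    \<partial>lborel)"

lemma deviation_measurable [measurable]: "deviation R \<in> borel_measurable (gauss n)"
proof -
  have "(\<lambda>p. det (Xmat (snd p) (fst p))) \<in> borel_measurable (gauss n \<Otimes>\<^sub>M (lborel :: complex measure))"
    using det_Xmat_joint_measurable by (simp add: case_prod_beta')
  note [measurable] = this
  have "(\<lambda>(x,z). ennreal \<bar>ln (cmod (det (Xmat z x))) - target z\<bar> * indicator (cball 0 R) z) \<in> borel_measurable
      (gauss n \<Otimes>\<^sub>M (lborel :: complex measure))"
    unfolding case_prod_beta' by measurable
  then show ?thesis unfolding deviation_def[abs_def] by (rule lborel.borel_measurable_nn_integral)
qed

text \<open>Replacing \<open>\<phi>\<close> by a potential costs \<open>e\<close> on the spectral
  side and \<open>e\<close> on the circle side. A discrepancy above \<open>3 * e\<close> therefore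
  leaves \<open>e\<close> to the difference of the two potentials, integrated against a density
  bounded by \<open>B\<close>.\<close>

lemma deviation_bound:
  assumes a: "\<And>i. i < l \<Longrightarrow> a i > 0" and da: "\<And>i. i < l \<Longrightarrow> real (d i) = a i * ln (real n)"
    and G: "G \<in> carrier_mat n n" and g: "bdd_supp B R g"
    and \<phi>: "\<phi> \<in> borel_measurable borel" "\<And>z. \<bar>\<phi> z\<bar> \<le> B'"
    and e: "\<And>w. \<bar>(\<integral>z. ln (cmod (z - w)) * g z \<partial>lborel) - \<phi> w\<bar> \<le> e"
    and big: "3 * e < \<bar>(\<integral>z. \<phi> z \<partial>empirical_spectral_measure (Amat G)) - (\<integral>z. \<phi> z \<partial>circle_mixture \<gamma> n l a c)\<bar>"
  shows "ennreal (e * real n) \<le> ennreal B * deviation R (entries G)"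
proof -
  have n0: "real n > 0" using n3 by simp
  have m: "(\<lambda>z. det (Xmat z (entries G))) \<in> borel_measurable borel"
  proof -
    have "(\<lambda>z. det (z \<cdot>\<^sub>m 1\<^sub>m n - Amat G)) \<in> borel_measurable borel"
    proof -
      have "z \<cdot>\<^sub>m 1\<^sub>m n - Amat G = mat n n (\<lambda>(i,j). (if i = j then z else 0) - Amat G $$ (i,j))" for z
        using Amat_carrier[OF G] by (intro eq_matI) auto
      then have "(\<lambda>z. det (z \<cdot>\<^sub>m 1\<^sub>m n - Amat G)) = (\<lambda>z. det (mat n n (\<lambda>(i,j). (if i = j then z else 0) - Amat G
          $$ (i,j))))" by simp
      also have "\<dots> \<in> borel_measurable borel" by (rule borel_measurable_det) measurable
      finally show ?thesis .
    qed
    then show ?thesis by (simp only: det_shift[OF G])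
  qed
  note s = spec_approx[OF G g \<phi> e]
  note t = circ_approx[OF a da g \<phi> e]
  let ?D = "potential g (entries G) - (\<integral>z. target z * g z \<partial>lborel)"
  have "3 * e \<le> 2 * e + \<bar>?D / real n\<bar>"
    using s(2) t(2) big by (simp add: diff_divide_distrib)
  then have "e \<le> \<bar>?D\<bar> / real n" using n0 by (simp add: abs_divide)
  then have "e * real n \<le> \<bar>?D\<bar>" using n0 by (simp add: le_divide_eq)
  also have "?D = (\<integral>z. (ln (cmod (det (Xmat z (entries G)))) - target z) * g z \<partial>lborel)"
    using s(1) t(1) by (simp add: potential_def left_diff_distrib)
  finally have "ennreal (e * real n) \<le> ennreal (norm (\<integral>z. (ln (cmod (det (Xmat z (entries G)))) - target z) * g
      z \<partial>lborel))"
    by (intro ennreal_leI) simp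
  also have "\<dots> \<le> (\<integral>\<^sup>+z. ennreal (norm ((ln (cmod (det (Xmat z (entries G)))) - target z) * g z)) \<partial>lborel)"
    using s(1) t(1) by (intro integral_norm_bound_ennreal) (simp add: left_diff_distrib)
  also have "\<dots> \<le> (\<integral>\<^sup>+z. ennreal B * (ennreal \<bar>ln (cmod (det (Xmat z (entries G)))) - target z\<bar> * indicator
      (cball 0 R) z) \<partial>lborel)"
  proof (rule nn_integral_mono)
    fix z
    let ?x = "ln (cmod (det (Xmat z (entries G)))) - target z"
    show "ennreal (norm (?x * g z)) \<le> ennreal B * (ennreal \<bar>?x\<bar> * indicator (cball 0 R) z)"
    proof (cases "z \<in> cball 0 R")
      case False
      then have "g z = 0" using bdd_suppD(3)[OF g, of z] by simp
      then show ?thesis by simp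
    next
      case True
      have "\<bar>?x * g z\<bar> \<le> B * \<bar>?x\<bar>" using bdd_suppD(2)[OF g, of z] by (simp add: abs_mult mult.commute[of _ "\<bar>g
          z\<bar>"] mult_right_mono)
      then have "ennreal (norm (?x * g z)) \<le> ennreal (B * \<bar>?x\<bar>)" by (intro ennreal_leI) simp
      also have "\<dots> = ennreal B * ennreal \<bar>?x\<bar>" using bdd_suppD(4)[OF g] by (intro ennreal_mult) auto
      finally show ?thesis using True by simp
    qed
  qed
  also have "\<dots> = ennreal B * deviation R (entries G)"
  proof -
    note [measurable] = m
    have "(\<lambda>z. ennreal \<bar>ln (cmod (det (Xmat z (entries G)))) - target z\<bar> * indicator (cball 0 R) z) \<in>
        borel_measurable lborel" by measurable
    then show ?thesis unfolding deviation_def by (rule nn_integral_cmult)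
  qed
  finally show ?thesis .
qed

text \<open>Either the norm event fails, or by \<open>deviation_bound\<close> the deviation
  restricted to that event exceeds a multiple of \<open>n\<close>; Markov's inequality with mean at
  most \<open>K\<close> bounds the latter.\<close>

lemma prob_deviation:
  assumes a: "\<And>i. i < l \<Longrightarrow> a i > 0" and da: "\<And>i. i < l \<Longrightarrow> real (d i) = a i * ln (real n)"
    and P: "prob_space P" and G: "std_gaussian_matrix P n G"
    and g: "bdd_supp B R g" and B: "B > 0"
    and \<phi>: "\<phi> \<in> borel_measurable borel" "\<And>z. \<bar>\<phi> z\<bar> \<le> B'" and e0: "e > 0"
    and e: "\<And>w. \<bar>(\<integral>z. ln (cmod (z - w)) * g z \<partial>lborel) - \<phi> w\<bar> \<le> e"
    and K: "K \<ge> 0" "(\<integral>\<^sup>+z. ennreal (Lam z + 2) * indicator (cball 0 R) z \<partial>lborel) \<le> ennreal K"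
  shows "measure P {\<omega>\<in>space P. 3 * e < \<bar>(\<integral>z. \<phi> z \<partial>empirical_spectral_measure (Amat (G \<omega>))) - (\<integral>z. \<phi> z
      \<partial>circle_mixture \<gamma> n l a c)\<bar>}
     \<le> (2 * (real n)\<^sup>2 + 1) ^ (2 * n) * exp (- t\<^sup>2 / 2) + 1 / real n + B * K / (e * real n)"
proof -
  interpret prob_space P by fact
  have n0: "real n > 0" "n > 0" using n3 by auto
  let ?X = "\<lambda>\<omega>. \<lambda>p\<in>{..<n}\<times>{..<n}. G \<omega> $$ p"
  let ?S1 = "{x\<in>space (gauss n). \<not> good n t x}"
  let ?c = "B / (e * real n)"
  let ?F = "\<lambda>x. deviation R x * indicator {x. good n t x} x"
  let ?S2 = "{x\<in>space (gauss n). 1 \<le> ennreal ?c * ?F x}"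
  note X = std_gaussian_distr[OF P G n0(2)]
  have S1: "?S1 \<in> sets (gauss n)" by measurable
  have S2: "?S2 \<in> sets (gauss n)" by measurable
  have c0: "?c > 0" using B e0 n0 by simp
  have sub: "{\<omega>\<in>space P. 3 * e < \<bar>(\<integral>z. \<phi> z \<partial>empirical_spectral_measure (Amat (G \<omega>))) - (\<integral>z. \<phi> z \<partial>circle_mixture
      \<gamma> n l a c)\<bar>}
     \<subseteq> ?X -` (?S1 \<union> ?S2) \<inter> space P"
  proof
    fix \<omega> assume \<omega>: "\<omega> \<in> {\<omega>\<in>space P. 3 * e < \<bar>(\<integral>z. \<phi> z \<partial>empirical_spectral_measure (Amat (G \<omega>))) - (\<integral>z. \<phi> z
        \<partial>circle_mixture \<gamma> n l a c)\<bar>}"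
    then have Gc: "G \<omega> \<in> carrier_mat n n" using G by (auto simp: std_gaussian_matrix_def)
    have Xs: "?X \<omega> \<in> space (gauss n)" using \<omega> X(1) by (auto dest: measurable_space)
    have "ennreal (e * real n) \<le> ennreal B * deviation R (?X \<omega>)"
      using deviation_bound[OF a da Gc g \<phi> e] \<omega> by (simp add: entries_def)
    then have "ennreal (1 / (e * real n)) * ennreal (e * real n) \<le> ennreal (1 / (e * real n)) * (ennreal B *
        deviation R (?X \<omega>))"
      by (rule mult_left_mono) simp
    moreover have "ennreal (1 / (e * real n)) * ennreal (e * real n) = 1"
      using e0 n0 by (simp add: ennreal_mult[symmetric])
    moreover have "ennreal (1 / (e * real n)) * (ennreal B * deviation R (?X \<omega>)) = ennreal ?c * deviation R (?X
        \<omega>)"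
      using e0 n0 B by (simp add: ennreal_mult[symmetric] mult.assoc[symmetric])
    ultimately have "1 \<le> ennreal ?c * deviation R (?X \<omega>)" by simp
    then have "?X \<omega> \<in> ?S1 \<union> ?S2" using Xs by (cases "good n t (?X \<omega>)") (simp_all only: mem_Collect_eq Un_iff
        indicator_def if_True mult_1_right of_bool_eq simp_thms)
    then show "\<omega> \<in> ?X -` (?S1 \<union> ?S2) \<inter> space P" using \<omega> by auto
  qed
  have "measure P {\<omega>\<in>space P. 3 * e < \<bar>(\<integral>z. \<phi> z \<partial>empirical_spectral_measure (Amat (G \<omega>))) - (\<integral>z. \<phi> z
      \<partial>circle_mixture \<gamma> n l a c)\<bar>}
     \<le> measure P (?X -` (?S1 \<union> ?S2) \<inter> space P)"
    by (rule finite_measure_mono[OF sub]) (use measurable_sets[OF X(1)] S1 S2 in blast)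
  moreover have "emeasure P (?X -` (?S1 \<union> ?S2) \<inter> space P) \<le> ennreal ((2 * (real n)\<^sup>2 + 1) ^ (2 * n) * exp (- t\<^sup>2
      / 2) + 1 / real n + B * K / (e * real n))"
  proof -
    have "emeasure P (?X -` (?S1 \<union> ?S2) \<inter> space P) = emeasure (distr P (gauss n) ?X) (?S1 \<union> ?S2)"
      using S1 S2 X(1) by (intro emeasure_distr[symmetric]) auto
    also have "\<dots> = emeasure (gauss n) (?S1 \<union> ?S2)" by (simp only: X(2))
    also have "\<dots> \<le> emeasure (gauss n) ?S1 + emeasure (gauss n) ?S2" by (rule emeasure_subadditive[OF S1 S2])
    also have "emeasure (gauss n) ?S2 \<le> ennreal ?c * (\<integral>\<^sup>+x. ?F x \<partial>gauss n)"
      using nn_integral_Markov_inequality[of ?F "space (gauss n)" "gauss n" "ennreal ?c"]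
      by (simp add: nn_set_integral_space)
    also have "(\<integral>\<^sup>+x. ?F x \<partial>gauss n) \<le> ennreal K"
      using expected_potential_deviation[of R] K(2) unfolding deviation_def[symmetric] by (rule order_trans)
    also have "emeasure (gauss n) ?S1 \<le> ennreal ((2 * (real n)\<^sup>2 + 1) ^ (2 * n) * exp (- t\<^sup>2 / 2) + 1 / real n)"
      by (rule prob_not_good[OF n0(2)])
    finally have "emeasure P (?X -` (?S1 \<union> ?S2) \<inter> space P) \<le> ennreal ((2 * (real n)\<^sup>2 + 1) ^ (2 * n) * exp (-
        t\<^sup>2 / 2) + 1 / real n) + ennreal ?c * ennreal K"
      by (simp add: add_mono mult_left_mono)
    also have "\<dots> = ennreal ((2 * (real n)\<^sup>2 + 1) ^ (2 * n) * exp (- t\<^sup>2 / 2) + 1 / real n + ?c * K)"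
    proof -
      have "ennreal ?c * ennreal K = ennreal (?c * K)" using c0 K(1) by (intro ennreal_mult[symmetric]) auto
      moreover have "0 \<le> (2 * (real n)\<^sup>2 + 1) ^ (2 * n) * exp (- t\<^sup>2 / 2) + 1 / real n" by simp
      moreover have "0 \<le> ?c * K" by (rule mult_nonneg_nonneg[OF less_imp_le[OF c0] K(1)])
      ultimately show ?thesis by (simp only: ennreal_plus)
    qed
    finally show ?thesis by simp
  qed
  moreover have "0 \<le> (2 * (real n)\<^sup>2 + 1) ^ (2 * n) * exp (- t\<^sup>2 / 2) + 1 / real n + B * K / (e * real n)"
    using B K(1) e0 by simp
  ultimately show ?thesis unfolding measure_def using enn2real_leI order_trans by meson
qed

text \<open>A measurable choice of eigenvalues is avoided: the spectral integral is the pointwise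
  limit of potentials of precision \<open>1 / (k + 1)\<close>, which are integrals of functions
  jointly measurable in \<open>z\<close> and the entries.\<close>

lemma spec_measurable_compact:
  fixes \<phi> :: "complex \<Rightarrow> real"
  assumes P: "prob_space P" and G: "std_gaussian_matrix P n G"
    and \<phi>: "continuous_on UNIV \<phi>" "\<And>z. \<bar>\<phi> z\<bar> \<le> B'" and supp: "\<And>z. cmod z > R \<Longrightarrow> \<phi> z = 0"
  shows "(\<lambda>\<omega>. \<integral>z. \<phi> z \<partial>empirical_spectral_measure (Amat (G \<omega>))) \<in> borel_measurable P"
proof -
  have n0: "n > 0" using n3 by simp
  note X = std_gaussian_distr[OF P G n0]
  have \<phi>m: "\<phi> \<in> borel_measurable borel" using \<phi>(1) by (rule borel_measurable_continuous_onI)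
  have "\<exists>g. (\<exists>B R'. bdd_supp B R' g) \<and> (\<forall>w. \<bar>(\<integral>z. ln (cmod (z - w)) * g z \<partial>lborel) - \<phi> w\<bar> \<le> 1 / real (Suc k))"
      for k
    using log_smoothing[where R=R and e="1 / real (Suc k)", OF \<phi>(1) supp] by fastforce
  then obtain g where g: "\<And>k. \<exists>B R'. bdd_supp B R' (g k)"
    "\<And>k w. \<bar>(\<integral>z. ln (cmod (z - w)) * g k z \<partial>lborel) - \<phi> w\<bar> \<le> 1 / real (Suc k)" by metis
  have pm: "potential (g k) \<in> borel_measurable (gauss n)" for k
  proof -
    have [measurable]: "g k \<in> borel_measurable borel" using g(1)[of k] by (auto simp: bdd_supp_def)
    have "(\<lambda>p. det (Xmat (snd p) (fst p))) \<in> borel_measurable (gauss n \<Otimes>\<^sub>M (lborel :: complex measure))"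
      using det_Xmat_joint_measurable by (simp add: case_prod_beta')
    note [measurable] = this
    have "(\<lambda>(x,z). ln (cmod (det (Xmat z x))) * g k z) \<in> borel_measurable (gauss n \<Otimes>\<^sub>M (lborel :: complex
        measure))"
      unfolding case_prod_beta' by measurable
    then show ?thesis unfolding potential_def[abs_def] by (rule lborel.borel_measurable_lebesgue_integral)
  qed
  show ?thesis
  proof (rule borel_measurable_LIMSEQ_real)
    show "(\<lambda>\<omega>. potential (g k) (\<lambda>p\<in>{..<n}\<times>{..<n}. G \<omega> $$ p) / real n) \<in> borel_measurable P" for k
      using measurable_compose[OF X(1) pm[of k]] by simp
    fix \<omega> assume "\<omega> \<in> space P"
    then have Gc: "G \<omega> \<in> carrier_mat n n" using G by (auto simp: std_gaussian_matrix_def)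
    show "(\<lambda>k. potential (g k) (\<lambda>p\<in>{..<n}\<times>{..<n}. G \<omega> $$ p) / real n) \<longlonglongrightarrow> (\<integral>z. \<phi> z \<partial>empirical_spectral_measure
        (Amat (G \<omega>)))"
    proof (rule LIMSEQ_I)
      fix r :: real assume "0 < r"
      then obtain k0 where k0: "1 / real (Suc k0) < r" using reals_Archimedean by (auto simp: inverse_eq_divide)
      have "norm (potential (g k) (\<lambda>p\<in>{..<n}\<times>{..<n}. G \<omega> $$ p) / real n - (\<integral>z. \<phi> z \<partial>empirical_spectral_measure
          (Amat (G \<omega>)))) < r" if k: "k \<ge> k0" for k
      proof -
        obtain B R' where "bdd_supp B R' (g k)" using g(1) by blast
        from spec_approx(2)[OF Gc this \<phi>m \<phi>(2) g(2)]
        have "\<bar>(\<integral>z. \<phi> z \<partial>empirical_spectral_measure (Amat (G \<omega>))) - potential (g k) (entries (G \<omega>)) / real n\<bar> \<le>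
            1 / real (Suc k)" .
        also have "\<dots> \<le> 1 / real (Suc k0)" using k by (intro divide_left_mono) auto
        finally show ?thesis using k0 by (simp add: entries_def abs_minus_commute)
      qed
      then show "\<exists>no. \<forall>k\<ge>no. norm (potential (g k) (\<lambda>p\<in>{..<n}\<times>{..<n}. G \<omega> $$ p) / real n - (\<integral>z. \<phi> z
          \<partial>empirical_spectral_measure (Amat (G \<omega>)))) < r" by blast
    qed
  qed
qed

text \<open>For a fixed outcome the spectrum is finite, so a growing cutoff eventually equals 1 at
  every eigenvalue.\<close>

lemma spec_measurable:
  fixes \<phi> :: "complex \<Rightarrow> real"
  assumes P: "prob_space P" and G: "std_gaussian_matrix P n G"
    and \<phi>: "continuous_on UNIV \<phi>" "\<And>z. \<bar>\<phi> z\<bar> \<le> B'"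
  shows "(\<lambda>\<omega>. \<integral>z. \<phi> z \<partial>empirical_spectral_measure (Amat (G \<omega>))) \<in> borel_measurable P"
proof (rule borel_measurable_LIMSEQ_real)
  define cut where "cut = (\<lambda>k z. max 0 (min 1 (real k + 1 - cmod z)))"
  have cut: "0 \<le> cut k z" "cut k z \<le> 1" "continuous_on UNIV (cut k)" "cmod z > real k + 1 \<Longrightarrow> cut k z = 0" "cmod z
      \<le> real k \<Longrightarrow> cut k z = 1" for k z
    by (auto simp: cut_def intro!: continuous_intros)
  have b: "\<bar>\<phi> z * cut k z\<bar> \<le> B'" for k z
  proof -
    have "\<bar>\<phi> z * cut k z\<bar> \<le> \<bar>\<phi> z\<bar> * 1" unfolding abs_mult using cut(1,2)[of k z] by (intro mult_left_mono) auto
    then show ?thesis using \<phi>(2)[of z] by simp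
  qed
  have c: "continuous_on UNIV (\<lambda>z. \<phi> z * cut k z)" for k using \<phi>(1) cut(3) by (intro continuous_intros)
  show "(\<lambda>\<omega>. \<integral>z. \<phi> z * cut k z \<partial>empirical_spectral_measure (Amat (G \<omega>))) \<in> borel_measurable P" for k
    by (rule spec_measurable_compact[OF P G c b, where R="real k + 1"]) (simp add: cut(4))
  fix \<omega> assume "\<omega> \<in> space P"
  then have Gc: "G \<omega> \<in> carrier_mat n n" using G by (auto simp: std_gaussian_matrix_def)
  obtain as where as: "\<And>\<phi> B. \<phi> \<in> borel_measurable borel \<Longrightarrow> (\<And>z. \<bar>\<phi> z\<bar> \<le> B) \<Longrightarrow>
       (\<integral>z. \<phi> z \<partial>empirical_spectral_measure (Amat (G \<omega>))) = (\<Sum>a\<leftarrow>as. \<phi> a) / real n"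
    by (rule empirical_roots[OF Amat_carrier[OF Gc]]) blast
  have e1: "(\<integral>z. \<phi> z * cut k z \<partial>empirical_spectral_measure (Amat (G \<omega>))) = (\<Sum>a\<leftarrow>as. \<phi> a * cut k a) / real n" for
      k
    by (rule as[OF borel_measurable_continuous_onI[OF c] b])
  have e2: "(\<integral>z. \<phi> z \<partial>empirical_spectral_measure (Amat (G \<omega>))) = (\<Sum>a\<leftarrow>as. \<phi> a) / real n"
    by (rule as[OF borel_measurable_continuous_onI[OF \<phi>(1)] \<phi>(2)])
  have "(\<lambda>k. \<Sum>a\<leftarrow>as. \<phi> a * cut k a) \<longlonglongrightarrow> (\<Sum>a\<leftarrow>as. \<phi> a)"
  proof (induct as)
    case (Cons a as)
    have "\<forall>\<^sub>F k in sequentially. \<phi> a * cut k a = \<phi> a"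
    proof -
      obtain k0 where "cmod a \<le> real k0" using real_arch_simple by blast
      then have "\<phi> a * cut k a = \<phi> a" if "k \<ge> k0" for k using that cut(5)[of a k] by simp
      then show ?thesis by (auto simp: eventually_sequentially)
    qed
    then have "(\<lambda>k. \<phi> a * cut k a) \<longlonglongrightarrow> \<phi> a" by (rule tendsto_eventually)
    from tendsto_add[OF this Cons] show ?case by simp
  qed simp
  then show "(\<lambda>k. \<integral>z. \<phi> z * cut k z \<partial>empirical_spectral_measure (Amat (G \<omega>))) \<longlonglongrightarrow> (\<integral>z. \<phi> z
      \<partial>empirical_spectral_measure (Amat (G \<omega>)))"
    unfolding e1 e2 using n3 by (intro tendsto_divide tendsto_const) auto
qed

end

section \<open>Convergence\<close>

lemma grid_tail_limit:
  assumes "\<eta> > (0::real)"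
  shows "(\<lambda>N. (2 * (real N)\<^sup>2 + 1) ^ (2 * N) * exp (- (real N powr (1/2 + \<eta>/2))\<^sup>2 / 2)) \<longlonglongrightarrow> 0"
proof -
  have "(\<lambda>N::nat. exp (2 * real N * ln (2 * (real N)\<^sup>2 + 1) - real N powr (1 + \<eta>) / 2)) \<longlonglongrightarrow> 0"
    using assms by real_asymp
  moreover have "exp (2 * real N * ln (2 * (real N)\<^sup>2 + 1) - real N powr (1 + \<eta>) / 2)
     = (2 * (real N)\<^sup>2 + 1) ^ (2 * N) * exp (- (real N powr (1/2 + \<eta>/2))\<^sup>2 / 2)" for N
  proof -
    have "exp (2 * real N * ln (2 * (real N)\<^sup>2 + 1)) = exp (ln (2 * (real N)\<^sup>2 + 1)) ^ (2 * N)"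
      using exp_of_nat_mult[of "2 * N" "ln (2 * (real N)\<^sup>2 + 1)"] by simp
    also have "exp (ln (2 * (real N)\<^sup>2 + 1)) = 2 * (real N)\<^sup>2 + 1"
      by (rule exp_ln) (simp add: add_nonneg_pos)
    finally have 1: "exp (2 * real N * ln (2 * (real N)\<^sup>2 + 1)) = (2 * (real N)\<^sup>2 + 1) ^ (2 * N)" .
    have "(real N powr (1/2 + \<eta>/2))\<^sup>2 = real N powr ((1/2 + \<eta>/2) + (1/2 + \<eta>/2))"
      by (simp only: power2_eq_square powr_add)
    also have "(1/2 + \<eta>/2) + (1/2 + \<eta>/2) = 1 + \<eta>" by simp
    finally show ?thesis by (simp only: diff_conv_add_uminus exp_add 1 minus_divide_left)
  qed
  ultimately show ?thesis by (simp only:)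
qed

lemma bad_area_limit: "\<eta> > (0::real) \<Longrightarrow> (\<lambda>N. ln (real N) * real N powr (-\<eta>)) \<longlonglongrightarrow> 0"
  by real_asymp

text \<open>The denominator is \<open>N powr (1/2 - \<gamma> + \<eta>)\<close> and the numerator of
  order \<open>N powr (1/2 - \<gamma> + \<eta>/2)\<close>; \<open>\<gamma>\<close> cancels and
  \<open>N powr (- \<eta>/2)\<close> is left.\<close>

lemma kappa_limit:
  assumes "\<eta> > (0::real)"
  shows "(\<lambda>N. 3 * (real N powr (-\<gamma>) * (real N powr (1/2 + \<eta>/2) + 2)) / ((real N powr (-\<eta>))\<^sup>2 * real N powr (-\<gamma> +
      1/2 + 3 * \<eta>))) \<longlonglongrightarrow> 0"
proof -
  have "(\<lambda>N::nat. 3 * (real N powr (-\<eta>/2) + 2 * real N powr (-1/2 - \<eta>))) \<longlonglongrightarrow> 0"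
    using assms by real_asymp
  moreover have "\<forall>\<^sub>F N in sequentially. 3 * (real N powr (-\<eta>/2) + 2 * real N powr (-1/2 - \<eta>))
    = 3 * (real N powr (-\<gamma>) * (real N powr (1/2 + \<eta>/2) + 2)) / ((real N powr (-\<eta>))\<^sup>2 * real N powr (-\<gamma> + 1/2 + 3
        * \<eta>))"
    using eventually_gt_at_top[of 0]
  proof eventually_elim
    case (elim N)
    let ?N = "real N"
    have p: "?N > 0" using elim by simp
    have den: "(?N powr (-\<eta>))\<^sup>2 * ?N powr (-\<gamma> + 1/2 + 3 * \<eta>) = ?N powr (-\<gamma> + 1/2 + \<eta>)"
      unfolding power2_eq_square powr_add[symmetric] by (rule arg_cong[where f="\<lambda>x. ?N powr x"]) simp
    have "?N powr (-\<eta>/2) * ?N powr (-\<gamma> + 1/2 + \<eta>) = ?N powr (-\<gamma>) * ?N powr (1/2 + \<eta>/2)"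
      unfolding powr_add[symmetric] by (rule arg_cong[where f="\<lambda>x. ?N powr x"]) simp
    moreover have "?N powr (-1/2 - \<eta>) * ?N powr (-\<gamma> + 1/2 + \<eta>) = ?N powr (-\<gamma>)"
      unfolding powr_add[symmetric] by (rule arg_cong[where f="\<lambda>x. ?N powr x"]) simp
    ultimately have "3 * (?N powr (-\<eta>/2) + 2 * ?N powr (-1/2 - \<eta>)) * ?N powr (-\<gamma> + 1/2 + \<eta>)
       = 3 * (?N powr (-\<gamma>) * (?N powr (1/2 + \<eta>/2) + 2))"
      by (simp add: algebra_simps)
    then show ?case unfolding den using p by (simp add: eq_divide_eq)
  qed
  ultimately show ?thesis by (rule Lim_transform_eventually)
qed

locale jordan_noise =
  fixes \<gamma> :: real and l :: "nat \<Rightarrow> nat" and a :: "nat \<Rightarrow> nat \<Rightarrow> real" and d :: "nat \<Rightarrow> nat \<Rightarrow> nat"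
    and c :: "nat \<Rightarrow> nat \<Rightarrow> complex" and P :: "nat \<Rightarrow> 'w measure" and G :: "nat \<Rightarrow> 'w \<Rightarrow> real mat"
  assumes \<gamma>: "\<gamma> > 1"
    and a_pos: "\<And>N i. N \<ge> 2 \<Longrightarrow> i < l N \<Longrightarrow> a N i > 0"
    and d_eq: "\<And>N i. N \<ge> 2 \<Longrightarrow> i < l N \<Longrightarrow> d N i > 0 \<and> real (d N i) = a N i * ln (real N)"
    and sum_a: "\<And>N. N \<ge> 2 \<Longrightarrow> (\<Sum>i<l N. a N i * ln (real N)) = real N"
    and prob: "\<And>N. prob_space (P N)"
    and gauss: "\<And>N. std_gaussian_matrix (P N) N (G N)"
    and l_small: "(\<lambda>N. real (l N)) \<in> o(\<lambda>N. real N)"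
begin

definition "LN N \<omega> = empirical_spectral_measure (block_matrix (l N) (d N) (c N) +
   complex_of_real (real N powr (- \<gamma>)) \<cdot>\<^sub>m map_mat complex_of_real (G N \<omega>))"
definition "mu N = circle_mixture \<gamma> N (l N) (a N) (c N)"
text \<open>The value of \<open>\<kappa>\<close> for which the condition \<open>small\<close> of
  \<open>core\<close> is an equality.\<close>

definition "kap \<eta> N = 3 * (real N powr (-\<gamma>) * (real N powr (1/2 + \<eta>/2) + 2)) / ((real N powr (-\<eta>))\<^sup>2 * real N
    powr (-\<gamma> + 1/2 + 3 * \<eta>))"

lemma size: "N \<ge> 2 \<Longrightarrow> N = bstart (d N) (l N)"
proof -
  assume N: "N \<ge> 2"
  have "real (bstart (d N) (l N)) = (\<Sum>i<l N. a N i * ln (real N))"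
    using d_eq[OF N] by (simp add: bstart_def)
  then show ?thesis using sum_a[OF N] by simp
qed

text \<open>The bound \<open>\<eta> \<le> 1/12\<close> keeps \<open>1/2 + 3 * \<eta>\<close> at most
  3/4, which is below \<open>\<gamma>\<close> by more than 1/4.\<close>

lemma core_eventually:
  assumes \<eta>: "0 < \<eta>" "\<eta> \<le> 1/12"
  shows "\<forall>\<^sub>F N in sequentially. core (l N) (d N) N \<gamma> \<eta> (real N powr (1/2 + \<eta>/2)) (kap \<eta> N)
     (real N powr (-\<eta>)) (real N powr (-\<gamma> + 1/2 + 3 * \<eta>)) (real N powr (-\<gamma>))"
proof -
  have "(\<lambda>N. real N powr (-\<eta>)) \<longlonglongrightarrow> 0" using \<eta> by real_asymp
  then have "\<forall>\<^sub>F N in sequentially. real N powr (-\<eta>) < 1/2" by (rule order_tendstoD) simp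
  moreover have "(\<lambda>N. kap \<eta> N) \<longlonglongrightarrow> 0" unfolding kap_def by (rule kappa_limit[OF \<eta>(1)])
  then have "\<forall>\<^sub>F N in sequentially. kap \<eta> N < 1/2" by (rule order_tendstoD) simp
  ultimately show ?thesis using eventually_ge_at_top[of 3]
  proof eventually_elim
    case (elim N)
    then have N: "N \<ge> 2" "real N > 0" by auto
    show ?case
    proof
      show "d N i > 0" if "i < l N" for i using d_eq[OF N(1) that] by simp
      show "N = bstart (d N) (l N)" by (rule size[OF N(1)])
      show "3 \<le> N" by fact
      show "real N powr - \<eta> \<le> 1/2" "kap \<eta> N \<le> 1/2" using elim by auto
      show "1/2 + 3 * \<eta> < \<gamma>" using \<gamma> \<eta> by simp
      show "0 < real N powr (1/2 + \<eta>/2)" using N by simp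
      show "0 \<le> kap \<eta> N" by (simp add: kap_def)
      show "real N powr - \<gamma> * (real N powr (1 / 2 + \<eta> / 2) + 2) \<le> kap \<eta> N * ((real N powr - \<eta>)\<^sup>2 * real N powr
          (- \<gamma> + 1 / 2 + 3 * \<eta>) / 3)"
        using N(2) by (simp add: kap_def)
    qed (use \<eta> in auto)
  qed
qed

text \<open>For fixed \<open>\<eta>\<close> the bound tends to \<open>B / e * Cc\<close>, of order
  \<open>\<eta>\<close>, and not to 0. The density \<open>g\<close>, and with it \<open>B\<close>
  and \<open>R'\<close>, depends only on \<open>\<phi>\<close> and \<open>\<epsilon>\<close>, so
  \<open>\<eta>\<close> can be chosen afterwards for each tolerance \<open>\<rho>\<close>.\<close>

lemma test_compact:
  fixes \<phi> :: "complex \<Rightarrow> real"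
  assumes \<phi>: "continuous_on UNIV \<phi>" "\<And>z. \<bar>\<phi> z\<bar> \<le> B'" and supp: "\<And>z. cmod z > R \<Longrightarrow> \<phi> z = 0" and \<epsilon>: "\<epsilon> > 0"
  shows "(\<lambda>N. measure (P N) {\<omega>\<in>space (P N). \<epsilon> < \<bar>(\<integral>z. \<phi> z \<partial>LN N \<omega>) - (\<integral>z. \<phi> z \<partial>mu N)\<bar>}) \<longlonglongrightarrow> 0"
proof -
  define e where "e = \<epsilon> / 3"
  have e0: "e > 0" using \<epsilon> by (simp add: e_def)
  have \<phi>m: "\<phi> \<in> borel_measurable borel" using \<phi>(1) by (rule borel_measurable_continuous_onI)
  obtain g B0 R0 where g0: "bdd_supp B0 R0 g" and ge: "\<And>w. \<bar>(\<integral>z. ln (cmod (z - w)) * g z \<partial>lborel) - \<phi> w\<bar> \<le> e"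
    using log_smoothing[where R=R, OF \<phi>(1) supp e0] by blast
  define B where "B = B0 + 1"
  define R' where "R' = max R0 0"
  have B: "B > 0" using bdd_suppD(4)[OF g0] by (simp add: B_def)
  have R': "R' \<ge> 0" by (simp add: R'_def)
  have g: "bdd_supp B R' g" using g0 unfolding bdd_supp_def B_def R'_def by (auto intro: order_trans)
  show ?thesis
  proof (rule LIMSEQ_I)
    fix \<rho> :: real assume \<rho>: "0 < \<rho>"
    \<comment> \<open>The second entry makes
      \<open>B / e * 6 * pi * \<eta> \<le> \<rho> / 4\<close>, where
      \<open>Cc \<le> 6 * pi * \<eta>\<close> because
      \<open>2 * (\<gamma> - 1/2 - 3 * \<eta>) \<ge> 1/2\<close>.\<close>
    define \<eta> where "\<eta> = min (1/12) (\<rho> * e / (24 * pi * B))"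
    have \<eta>: "0 < \<eta>" "\<eta> \<le> 1/12" using \<rho> e0 B by (auto simp: \<eta>_def)
    define Cc where "Cc = 3 * \<eta> * (pi / (2 * (\<gamma> - 1/2 - 3 * \<eta>)))"
    have Cc: "B / e * Cc \<le> \<rho> / 4"
    proof -
      have "1/2 \<le> 2 * (\<gamma> - 1/2 - 3 * \<eta>)" using \<gamma> \<eta> by simp
      then have "pi / (2 * (\<gamma> - 1/2 - 3 * \<eta>)) \<le> pi / (1/2)" by (intro divide_left_mono) auto
      then have "Cc \<le> 3 * \<eta> * (pi / (1/2))" unfolding Cc_def using \<eta> by (intro mult_left_mono) auto
      also have "\<dots> = 6 * pi * \<eta>" by simp
      also have "\<dots> \<le> 6 * pi * (\<rho> * e / (24 * pi * B))" by (intro mult_left_mono) (simp_all add: \<eta>_def)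
      also have "\<dots> = \<rho> * e / (4 * B)" by simp
      finally have "B / e * Cc \<le> B / e * (\<rho> * e / (4 * B))" using B e0 by (intro mult_left_mono) auto
      then show ?thesis using B e0 by simp
    qed
    define bnd where "bnd = (\<lambda>N. (2 * (real N)\<^sup>2 + 1) ^ (2 * N) * exp (- (real N powr (1/2 + \<eta>/2))\<^sup>2 / 2) + 1 /
        real N
       + B / e * (Cc + (10 + \<gamma>) * (4 * pi) * (ln (real N) * real N powr (-\<eta>))
         + (10 * (real (l N) / real N) + sqrt (real (l N) / real N) + 2 * kap \<eta> N + 2 / real N) * (pi * R'\<^sup>2)))"
    have lN: "(\<lambda>N. real (l N) / real N) \<longlonglongrightarrow> 0" using l_small by (rule smalloD_tendsto)
    have iN: "(\<lambda>N. 1 / real N) \<longlonglongrightarrow> 0" "(\<lambda>N. 2 / real N) \<longlonglongrightarrow> 0" by real_asymp+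
    have sq: "(\<lambda>N. sqrt (real (l N) / real N)) \<longlonglongrightarrow> 0" using tendsto_real_sqrt[OF lN] by simp
    have kp: "(\<lambda>N. kap \<eta> N) \<longlonglongrightarrow> 0" unfolding kap_def by (rule kappa_limit[OF \<eta>(1)])
    have "bnd \<longlonglongrightarrow> 0 + 0 + B / e * (Cc + (10 + \<gamma>) * (4 * pi) * 0 + (10 * 0 + 0 + 2 * 0 + 0) * (pi * R'\<^sup>2))"
      unfolding bnd_def
      by (intro tendsto_add tendsto_mult tendsto_const grid_tail_limit[OF \<eta>(1)] bad_area_limit[OF \<eta>(1)] lN iN sq
          kp)
    then have "bnd \<longlonglongrightarrow> B / e * Cc" by simp
    moreover have "B / e * Cc < \<rho>" using Cc \<rho> by linarith
    ultimately have "\<forall>\<^sub>F N in sequentially. bnd N < \<rho>" by (rule order_tendstoD)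
    then have "\<forall>\<^sub>F N in sequentially. norm (measure (P N) {\<omega>\<in>space (P N). \<epsilon> < \<bar>(\<integral>z. \<phi> z \<partial>LN N \<omega>) - (\<integral>z. \<phi> z \<partial>mu
        N)\<bar>} - 0) < \<rho>"
      using core_eventually[OF \<eta>] eventually_ge_at_top[of 2]
    proof eventually_elim
      case (elim N)
      interpret core "l N" "d N" "c N" N \<gamma> \<eta> "real N powr (1/2 + \<eta>/2)" "kap \<eta> N"
        "real N powr (-\<eta>)" "real N powr (-\<gamma> + 1/2 + 3 * \<eta>)" "real N powr (-\<gamma>)" by (rule elim(2))
      have N0: "real N > 0" using elim(3) by simp
      have aN: "\<And>i. i < l N \<Longrightarrow> a N i > 0" using a_pos elim(3) by blast
      have dN: "\<And>i. i < l N \<Longrightarrow> real (d N i) = a N i * ln (real N)" using d_eq elim(3) by blast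
      let ?K = "3 * \<eta> * (pi / (2 * (\<gamma> - 1/2 - 3 * \<eta>))) * real N + (10 + \<gamma>) * ln (real N) * (4 * pi * real N powr
          (-\<eta>)) * real N
       + (10 * real (l N) + sqrt (real (l N) * real N) + 2 * kap \<eta> N * real N + 2) * (pi * R'\<^sup>2)"
      have K0: "0 \<le> ?K"
        using \<eta> \<gamma> ln_n \<kappa> by (intro add_nonneg_nonneg mult_nonneg_nonneg divide_nonneg_nonneg) auto
      have "measure (P N) {\<omega>\<in>space (P N). 3 * e < \<bar>(\<integral>z. \<phi> z \<partial>empirical_spectral_measure (Amat (G N \<omega>))) - (\<integral>z. \<phi>
          z \<partial>circle_mixture \<gamma> N (l N) (a N) (c N))\<bar>}
        \<le> (2 * (real N)\<^sup>2 + 1) ^ (2 * N) * exp (- (real N powr (1/2 + \<eta>/2))\<^sup>2 / 2) + 1 / real N + B * ?K / (e *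
            real N)"
        by (rule prob_deviation[OF aN dN prob gauss g B \<phi>m \<phi>(2) e0 ge K0 Lam_integral[OF aN dN R']])
      also have "B * ?K / (e * real N) = B / e * (?K / real N)" by simp
      also have "?K / real N = Cc + (10 + \<gamma>) * (4 * pi) * (ln (real N) * real N powr (-\<eta>))
         + (10 * (real (l N) / real N) + sqrt (real (l N) / real N) + 2 * kap \<eta> N + 2 / real N) * (pi * R'\<^sup>2)"
      proof -
        have "sqrt (real (l N) * real N) / real N = sqrt (real (l N) / real N)"
          using N0 by (simp add: real_sqrt_mult real_sqrt_divide real_div_sqrt field_simps)
        moreover have "?K / real N = Cc + (10 + \<gamma>) * (4 * pi) * (ln (real N) * real N powr (-\<eta>))
         + (10 * (real (l N) / real N) + sqrt (real (l N) * real N) / real N + 2 * kap \<eta> N + 2 / real N) * (pi *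
             R'\<^sup>2)"
          unfolding Cc_def using N0 by (simp add: add_divide_distrib distrib_right)
        ultimately show ?thesis by simp
      qed
      finally have "measure (P N) {\<omega>\<in>space (P N). \<epsilon> < \<bar>(\<integral>z. \<phi> z \<partial>LN N \<omega>) - (\<integral>z. \<phi> z \<partial>mu N)\<bar>} \<le> bnd N"
        by (simp add: LN_def mu_def Amat_def e_def bnd_def)
      then show ?case using elim(1) by simp
    qed
    then show "\<exists>no. \<forall>N\<ge>no. norm (measure (P N) {\<omega>\<in>space (P N). \<epsilon> < \<bar>(\<integral>z. \<phi> z \<partial>LN N \<omega>) - (\<integral>z. \<phi> z \<partial>mu N)\<bar>} - 0) <
        \<rho>"
      by (simp add: eventually_sequentially)
  qed
qed

lemma LN_measurable:
  fixes \<phi> :: "complex \<Rightarrow> real"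
  assumes \<phi>: "continuous_on UNIV \<phi>" "\<And>z. \<bar>\<phi> z\<bar> \<le> B'"
  shows "\<forall>\<^sub>F N in sequentially. (\<lambda>\<omega>. \<integral>z. \<phi> z \<partial>LN N \<omega>) \<in> borel_measurable (P N)"
proof -
  have "\<forall>\<^sub>F N in sequentially. core (l N) (d N) N \<gamma> (1/12) (real N powr (1/2 + (1/12)/2)) (kap (1/12) N)
     (real N powr (-(1/12))) (real N powr (-\<gamma> + 1/2 + 3 * (1/12))) (real N powr (-\<gamma>))"
    by (rule core_eventually) auto
  then show ?thesis
  proof eventually_elim
    case (elim N)
    interpret core "l N" "d N" "c N" N \<gamma> "1/12" "real N powr (1/2 + (1/12)/2)" "kap (1/12) N"
        "real N powr (-(1/12))" "real N powr (-\<gamma> + 1/2 + 3 * (1/12))" "real N powr (-\<gamma>)" by (rule elim)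
    show ?case using spec_measurable[OF prob gauss \<phi>] by (simp add: LN_def Amat_def)
  qed
qed

lemma LN_integral:
  assumes "N \<ge> 2" "\<omega> \<in> space (P N)"
  obtains as where "length as = N" "\<And>\<phi> B. \<phi> \<in> borel_measurable borel \<Longrightarrow> (\<And>z. \<bar>\<phi> z\<bar> \<le> B) \<Longrightarrow>
       (\<integral>z. \<phi> z \<partial>LN N \<omega>) = (\<Sum>a\<leftarrow>as. \<phi> a) / real N"
proof -
  have Gc: "G N \<omega> \<in> carrier_mat N N" using gauss[of N] assms(2) by (auto simp: std_gaussian_matrix_def)
  have "block_matrix (l N) (d N) (c N) + complex_of_real (real N powr (- \<gamma>)) \<cdot>\<^sub>m map_mat complex_of_real (G N \<omega>)
      \<in> carrier_mat N N"
    using Gc shifted_block_matrix(2)[OF size[OF assms(1)], of "c N"] by auto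
  then show ?thesis
  proof (rule empirical_roots)
    fix as
    assume len: "length as = N" and int: "\<And>\<phi> B. \<phi> \<in> borel_measurable borel \<Longrightarrow> (\<And>z. \<bar>\<phi> z\<bar> \<le> B) \<Longrightarrow>
       (\<integral>z. \<phi> z \<partial>empirical_spectral_measure (block_matrix (l N) (d N) (c N) +
          complex_of_real (real N powr (- \<gamma>)) \<cdot>\<^sub>m map_mat complex_of_real (G N \<omega>))) = (\<Sum>a\<leftarrow>as. \<phi> a) / real N"
    show ?thesis by (rule that[OF len], unfold LN_def, rule int)
  qed
qed

lemma mu_total: "N \<ge> 2 \<Longrightarrow> (\<integral>z. 1 \<partial>mu N) = (1::real)"
proof -
  assume N: "N \<ge> 2"
  have "(\<integral>z. 1 \<partial>mu N) = (\<Sum>i<l N. a N i * ln (real N) / real N * (\<integral>z. 1 \<partial>circle_measure (c N i) (block_radius \<gamma>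
      (a N i))))"
    unfolding mu_def circle_mixture_def
  proof (rule integral_mixture[where B=1])
    show "0 \<le> a N i * ln (real N) / real N" if "i \<in> {..<l N}" for i using a_pos[OF N, of i] that N by simp
  qed (auto intro: prob_space_circle_measure)
  also have "\<dots> = (\<Sum>i<l N. a N i * ln (real N)) / real N"
    using prob_space.prob_space[OF prob_space_circle_measure] by (simp add: sum_divide_distrib)
  finally show ?thesis using sum_a[OF N] N by simp
qed

text \<open>The spectral measures are not confined to a fixed compact set. Their escaping mass is
  controlled by testing with \<open>cut\<close>, itself compactly supported and 1 on
  \<open>K\<close>: the integral of \<open>1 - cut\<close> is close to its value under
  \<open>mu N\<close>, which is 0. The rest of \<open>\<phi>\<close> is the compactly supported
  \<open>\<phi> * cut\<close>.\<close>

lemma test_bounded: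
  fixes \<phi> :: "complex \<Rightarrow> real"
  assumes K: "compact K" "\<And>N. N \<ge> 2 \<Longrightarrow> emeasure (mu N) (UNIV - K) = 0"
    and \<phi>: "continuous_on UNIV \<phi>" "\<And>z. \<bar>\<phi> z\<bar> \<le> B'" and \<epsilon>: "\<epsilon> > 0"
  shows "(\<lambda>N. measure (P N) {\<omega>\<in>space (P N). \<epsilon> < \<bar>(\<integral>z. \<phi> z \<partial>LN N \<omega>) - (\<integral>z. \<phi> z \<partial>mu N)\<bar>}) \<longlonglongrightarrow> 0"
proof -
  obtain r where r: "\<And>z. z \<in> K \<Longrightarrow> cmod z \<le> r" using compact_imp_bounded[OF K(1)] by (auto simp: bounded_iff)
  define cut where "cut = (\<lambda>z::complex. max 0 (min 1 (r + 1 - cmod z)))"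
  have cut: "0 \<le> cut z" "cut z \<le> 1" "\<bar>cut z\<bar> \<le> 1" "continuous_on UNIV cut" "cmod z > r + 1 \<Longrightarrow> cut z = 0" "z \<in> K \<Longrightarrow>
      cut z = 1" for z
    using r[of z] by (auto simp: cut_def intro!: continuous_intros)
  define B where "B = B' + 1"
  have "0 \<le> B'" using \<phi>(2)[of 0] by linarith
  then have B: "B > 0" "\<bar>\<phi> z\<bar> \<le> B" for z using \<phi>(2)[of z] by (simp_all add: B_def)
  let ?\<psi> = "\<lambda>z. \<phi> z * cut z"
  have \<psi>b: "\<bar>?\<psi> z\<bar> \<le> B" for z
  proof -
    have "\<bar>?\<psi> z\<bar> \<le> \<bar>\<phi> z\<bar> * 1" unfolding abs_mult using cut(3)[of z] by (intro mult_left_mono) auto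
    then show ?thesis using B(2)[of z] by simp
  qed
  have \<psi>c: "continuous_on UNIV ?\<psi>" using \<phi>(1) cut(4) by (intro continuous_intros)
  have m: "\<phi> \<in> borel_measurable borel" "?\<psi> \<in> borel_measurable borel" "cut \<in> borel_measurable borel"
    using \<phi>(1) \<psi>c cut(4) by (auto intro: borel_measurable_continuous_onI)
  \<comment> \<open>The error is split evenly: \<open>\<epsilon>/2\<close> for the truncated
    function, and \<open>\<epsilon>/(2*B)\<close> for the escaping mass, which is weighted by the
    bound \<open>B\<close> of \<open>\<phi>\<close>.\<close>
  let ?A = "\<lambda>N. {\<omega>\<in>space (P N). \<epsilon>/2 < \<bar>(\<integral>z. ?\<psi> z \<partial>LN N \<omega>) - (\<integral>z. ?\<psi> z \<partial>mu N)\<bar>}"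
  let ?C = "\<lambda>N. {\<omega>\<in>space (P N). \<epsilon>/(2*B) < \<bar>(\<integral>z. cut z \<partial>LN N \<omega>) - (\<integral>z. cut z \<partial>mu N)\<bar>}"
  have lim: "(\<lambda>N. measure (P N) (?A N) + measure (P N) (?C N)) \<longlonglongrightarrow> 0 + 0"
  proof (rule tendsto_add)
    show "(\<lambda>N. measure (P N) (?A N)) \<longlonglongrightarrow> 0"
      by (rule test_compact[OF \<psi>c \<psi>b, where R="r+1"]) (use \<epsilon> cut(5) in auto)
    show "(\<lambda>N. measure (P N) (?C N)) \<longlonglongrightarrow> 0"
      by (rule test_compact[OF cut(4) cut(3), where R="r+1"]) (use \<epsilon> B cut(5) in auto)
  qed
  show ?thesis
  proof (rule Lim_null_comparison[OF _ lim[unfolded add_0]])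
    show "\<forall>\<^sub>F N in sequentially. norm (measure (P N) {\<omega>\<in>space (P N). \<epsilon> < \<bar>(\<integral>z. \<phi> z \<partial>LN N \<omega>) - (\<integral>z. \<phi> z \<partial>mu N)\<bar>})
      \<le> measure (P N) (?A N) + measure (P N) (?C N)"
      using LN_measurable[OF \<psi>c \<psi>b] LN_measurable[OF cut(4) cut(3)] eventually_ge_at_top[of 2]
    proof eventually_elim
      case (elim N)
      interpret prob_space "P N" by (rule prob)
      note [measurable] = elim(1,2)
      have meas: "?A N \<in> sets (P N)" "?C N \<in> sets (P N)" by measurable
      have sm: "sets (mu N) = sets borel" "space (mu N) = UNIV"
        using sets_eq_imp_space_eq[of "mu N" borel] by (auto simp: mu_def circle_mixture_def)
      have ae: "AE z in mu N. z \<in> K"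
        using K(2)[OF elim(3)] sm K(1) by (intro AE_I[where N="UNIV - K"]) (auto intro: borel_closed
            compact_imp_closed)
      have mm: "f \<in> borel_measurable (mu N)" if "f \<in> borel_measurable borel" for f :: "complex \<Rightarrow> real"
        using that sm by (simp cong: measurable_cong_sets)
      have mu1: "(\<integral>z. cut z \<partial>mu N) = 1"
      proof -
        have "(\<integral>z. cut z \<partial>mu N) = (\<integral>z. 1 \<partial>mu N)"
          by (rule integral_cong_AE) (use ae cut(6) in \<open>auto intro: mm m\<close>)
        then show ?thesis using mu_total[OF elim(3)] by simp
      qed
      have mu2: "(\<integral>z. ?\<psi> z \<partial>mu N) = (\<integral>z. \<phi> z \<partial>mu N)"
        by (rule integral_cong_AE) (use ae cut(6) in \<open>auto intro: mm m\<close>)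
      have sub: "{\<omega>\<in>space (P N). \<epsilon> < \<bar>(\<integral>z. \<phi> z \<partial>LN N \<omega>) - (\<integral>z. \<phi> z \<partial>mu N)\<bar>} \<subseteq> ?A N \<union> ?C N"
      proof (rule subsetI, rule ccontr)
        fix \<omega> assume \<omega>: "\<omega> \<in> {\<omega>\<in>space (P N). \<epsilon> < \<bar>(\<integral>z. \<phi> z \<partial>LN N \<omega>) - (\<integral>z. \<phi> z \<partial>mu N)\<bar>}" and n: "\<omega> \<notin> ?A N \<union> ?C
            N"
        obtain as where as: "length as = N" "\<And>\<phi> B. \<phi> \<in> borel_measurable borel \<Longrightarrow> (\<And>z. \<bar>\<phi> z\<bar> \<le> B) \<Longrightarrow>
          (\<integral>z. \<phi> z \<partial>LN N \<omega>) = (\<Sum>a\<leftarrow>as. \<phi> a) / real N"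
          using LN_integral[OF elim(3), of \<omega>] \<omega> by blast
        have i: "(\<integral>z. \<phi> z \<partial>LN N \<omega>) = (\<Sum>a\<leftarrow>as. \<phi> a) / real N" "(\<integral>z. ?\<psi> z \<partial>LN N \<omega>) = (\<Sum>a\<leftarrow>as. ?\<psi> a) / real N"
          "(\<integral>z. cut z \<partial>LN N \<omega>) = (\<Sum>a\<leftarrow>as. cut a) / real N"
          by (rule as(2)[OF m(1) B(2)], rule as(2)[OF m(2) \<psi>b], rule as(2)[OF m(3) cut(3)])
        have "\<bar>(\<Sum>a\<leftarrow>xs. \<phi> a) - (\<Sum>a\<leftarrow>xs. ?\<psi> a)\<bar> \<le> B * (real (length xs) - (\<Sum>a\<leftarrow>xs. cut a))" for xs
        proof (induct xs)
          case (Cons x xs)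
          have "\<bar>\<phi> x - ?\<psi> x\<bar> = \<bar>\<phi> x\<bar> * (1 - cut x)" 
          proof -
            have "\<phi> x - ?\<psi> x = \<phi> x * (1 - cut x)" by (simp add: right_diff_distrib)
            then show ?thesis using cut(2)[of x] by (simp add: abs_mult)
          qed
          also have "\<dots> \<le> B * (1 - cut x)" using B(2)[of x] cut(2)[of x] by (intro mult_right_mono) auto
          finally show ?case using Cons by (simp add: algebra_simps)
        qed simp
        from this[of as] have "\<bar>(\<Sum>a\<leftarrow>as. \<phi> a) - (\<Sum>a\<leftarrow>as. ?\<psi> a)\<bar> / real N \<le> B * (real N - (\<Sum>a\<leftarrow>as. cut a)) / real N"
          by (intro divide_right_mono) (simp_all add: as(1))
        also have "\<dots> = B * (1 - (\<integral>z. cut z \<partial>LN N \<omega>))" unfolding i using elim(3) by (simp add: field_simps)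
        also have "\<dots> \<le> B * (\<epsilon> / (2 * B))"
        proof (rule mult_left_mono)
          show "1 - (\<integral>z. cut z \<partial>LN N \<omega>) \<le> \<epsilon> / (2 * B)" using n \<omega> by (auto simp: mu1)
        qed (use B in simp)
        also have "\<dots> = \<epsilon> / 2" using B by simp
        finally have "\<bar>(\<integral>z. \<phi> z \<partial>LN N \<omega>) - (\<integral>z. ?\<psi> z \<partial>LN N \<omega>)\<bar> \<le> \<epsilon> / 2"
          unfolding i by (simp add: abs_divide flip: diff_divide_distrib)
        moreover have "\<bar>(\<integral>z. ?\<psi> z \<partial>LN N \<omega>) - (\<integral>z. \<phi> z \<partial>mu N)\<bar> \<le> \<epsilon> / 2" using n \<omega> by (auto simp: mu2)
        moreover have "\<epsilon> < \<bar>(\<integral>z. \<phi> z \<partial>LN N \<omega>) - (\<integral>z. \<phi> z \<partial>mu N)\<bar>" using \<omega> by simp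
        ultimately show False by linarith
      qed
      have "measure (P N) {\<omega>\<in>space (P N). \<epsilon> < \<bar>(\<integral>z. \<phi> z \<partial>LN N \<omega>) - (\<integral>z. \<phi> z \<partial>mu N)\<bar>} \<le> measure (P N) (?A N \<union> ?C
          N)"
        using meas by (intro finite_measure_mono[OF sub]) auto
      also have "\<dots> \<le> measure (P N) (?A N) + measure (P N) (?C N)" by (rule measure_Un_le[OF meas])
      finally show ?case by simp
    qed
  qed
qed

text \<open>The integrals against \<open>mu N\<close> are deterministic and eventually within
  \<open>\<epsilon>/2\<close> of the limit, so comparison with \<open>mu N\<close> at level
  \<open>\<epsilon>/2\<close> is enough.\<close>

lemma converges:
  assumes K: "compact K" "\<And>N. N \<ge> 2 \<Longrightarrow> emeasure (mu N) (UNIV - K) = 0"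
    and weak: "converges_weakly mu \<mu>"
  shows "converges_weakly_in_probability P LN \<mu>"
  unfolding converges_weakly_in_probability_def tendsto_in_probability_def
proof (intro allI impI conjI)
  fix \<phi> :: "complex \<Rightarrow> real" assume \<phi>: "continuous_on UNIV \<phi>" "bounded (range \<phi>)"
  obtain B where B: "\<And>z. \<bar>\<phi> z\<bar> \<le> B" using \<phi>(2) by (auto simp: bounded_iff)
  show "\<forall>\<^sub>F N in sequentially. (\<lambda>\<omega>. \<integral>z. \<phi> z \<partial>LN N \<omega>) \<in> borel_measurable (P N)"
    by (rule LN_measurable[OF \<phi>(1) B])
  fix \<epsilon> :: real assume \<epsilon>: "\<epsilon> > 0"
  have lim: "(\<lambda>N. measure (P N) {\<omega>\<in>space (P N). \<epsilon>/2 < \<bar>(\<integral>z. \<phi> z \<partial>LN N \<omega>) - (\<integral>z. \<phi> z \<partial>mu N)\<bar>}) \<longlonglongrightarrow> 0"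
    using \<epsilon> by (intro test_bounded[OF K \<phi>(1) B]) auto
  have "(\<lambda>N. \<integral>z. \<phi> z \<partial>mu N) \<longlonglongrightarrow> (\<integral>z. \<phi> z \<partial>\<mu>)" using weak \<phi> by (simp add: converges_weakly_def)
  then have close: "\<forall>\<^sub>F N in sequentially. dist (\<integral>z. \<phi> z \<partial>mu N) (\<integral>z. \<phi> z \<partial>\<mu>) < \<epsilon>/2"
    using \<epsilon> by (intro tendstoD) auto
  show "(\<lambda>N. measure (P N) {\<omega>\<in>space (P N). \<epsilon> < \<bar>(\<integral>z. \<phi> z \<partial>LN N \<omega>) - (\<integral>z. \<phi> z \<partial>\<mu>)\<bar>}) \<longlonglongrightarrow> 0"
  proof (rule Lim_null_comparison[OF _ lim])
    show "\<forall>\<^sub>F N in sequentially. norm (measure (P N) {\<omega>\<in>space (P N). \<epsilon> < \<bar>(\<integral>z. \<phi> z \<partial>LN N \<omega>) - (\<integral>z. \<phi> z \<partial>\<mu>)\<bar>})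
       \<le> measure (P N) {\<omega>\<in>space (P N). \<epsilon>/2 < \<bar>(\<integral>z. \<phi> z \<partial>LN N \<omega>) - (\<integral>z. \<phi> z \<partial>mu N)\<bar>}"
      using close LN_measurable[OF \<phi>(1) B]
    proof eventually_elim
      case (elim N)
      interpret prob_space "P N" by (rule prob)
      note [measurable] = elim(2)
      have "{\<omega>\<in>space (P N). \<epsilon> < \<bar>(\<integral>z. \<phi> z \<partial>LN N \<omega>) - (\<integral>z. \<phi> z \<partial>\<mu>)\<bar>} \<subseteq> {\<omega>\<in>space (P N). \<epsilon>/2 < \<bar>(\<integral>z. \<phi> z \<partial>LN N \<omega>) -
          (\<integral>z. \<phi> z \<partial>mu N)\<bar>}"
      proof
        fix \<omega> assume "\<omega> \<in> {\<omega>\<in>space (P N). \<epsilon> < \<bar>(\<integral>z. \<phi> z \<partial>LN N \<omega>) - (\<integral>z. \<phi> z \<partial>\<mu>)\<bar>}"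
        then have "\<omega> \<in> space (P N)" "\<epsilon> < \<bar>(\<integral>z. \<phi> z \<partial>LN N \<omega>) - (\<integral>z. \<phi> z \<partial>\<mu>)\<bar>" by auto
        moreover from this(2) have "\<epsilon>/2 < \<bar>(\<integral>z. \<phi> z \<partial>LN N \<omega>) - (\<integral>z. \<phi> z \<partial>mu N)\<bar>"
          using elim(1) unfolding dist_real_def by linarith
        ultimately show "\<omega> \<in> {\<omega>\<in>space (P N). \<epsilon>/2 < \<bar>(\<integral>z. \<phi> z \<partial>LN N \<omega>) - (\<integral>z. \<phi> z \<partial>mu N)\<bar>}" by blast
      qed
      then show ?case by (simp, intro finite_measure_mono) measurable
    qed
  qed
qed

end

theorem theorem1p1:
  fixes \<gamma> :: real
    and l :: "nat \<Rightarrow> nat"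
    and a :: "nat \<Rightarrow> nat \<Rightarrow> real"
    and d :: "nat \<Rightarrow> nat \<Rightarrow> nat"
    and c :: "nat \<Rightarrow> nat \<Rightarrow> complex"
    and P :: "nat \<Rightarrow> 'w measure"
    and G :: "nat \<Rightarrow> 'w \<Rightarrow> real mat"
    and K :: "complex set"
    and \<mu> :: "complex measure"
  assumes "\<gamma> > 1"
    and "\<And>N i. N \<ge> 2 \<Longrightarrow> i < l N \<Longrightarrow> a N i > 0"
    and "\<And>N i. N \<ge> 2 \<Longrightarrow> i < l N \<Longrightarrow> d N i > 0 \<and> real (d N i) = a N i * ln (real N)"
    and "\<And>N. N \<ge> 2 \<Longrightarrow> (\<Sum>i<l N. a N i * ln (real N)) = real N"
    and "\<And>N. prob_space (P N)"
    and "\<And>N. std_gaussian_matrix (P N) N (G N)"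
    and "(\<lambda>N. real (l N)) \<in> o(\<lambda>N. real N)"
    and "compact K"
    and "\<And>N. N \<ge> 2 \<Longrightarrow> emeasure (circle_mixture \<gamma> N (l N) (a N) (c N)) (UNIV - K) = 0"
    and "prob_space \<mu>" and "sets \<mu> = sets borel"
    and "converges_weakly (\<lambda>N. circle_mixture \<gamma> N (l N) (a N) (c N)) \<mu>"
  shows "converges_weakly_in_probability P
           (\<lambda>N \<omega>. empirical_spectral_measure
              (block_matrix (l N) (d N) (c N) +
               complex_of_real (real N powr (- \<gamma>)) \<cdot>\<^sub>m map_mat complex_of_real (G N \<omega>))) \<mu>"
proof -
  interpret jordan_noise \<gamma> l a d c P G
    by (rule jordan_noise.intro[OF assms(1-7)])
  have "converges_weakly_in_probability P LN \<mu>"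
    by (rule converges[OF assms(8)]) (use assms(9,12) in \<open>simp_all add: mu_def[abs_def]\<close>)
  then show ?thesis by (simp add: LN_def[abs_def])
qed

end
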